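(* For every $n\in\mathbb N$ and all $f^{(n)},g^{(n)}\in B_0(\mathbb R_+^n)$, $$\big(\langle P^{(n)}(\omega),f^{(n)}\rangle,\langle P^{(n)}(\omega),g^{(n)}\rangle\big)_{L^2(\tau)}=\int_{T_n}f^{(n)}g^{(n)}\,dm_n .$$ In particular $\langle P^{(n)}(\omega),f^{(n)}\rangle$ depends only on the restriction of $f^{(n)}$ to $T_n$ (up to $m_n$-null sets).
   Context: Setup. Let $\nu$ be a probability measure on $\mathbb R$ with compact support, $\mathbb R_+=[0,\infty)$. For $n\in\mathbb N$ let $T_n=\{(t_1,\dots,t_n)\in\mathbb R_+^n: t_1\ge t_2\ge\dots\ge t_n\}$ and $S_n=\{(t_1,s_1,\dots,t_n,s_n)\in(\mathbb R_+\times\mathbb R)^n:(t_1,\dots,t_n)\in T_n\}$. The monotone Fock space is $\mathcal F=\bigoplus_{n\ge0}\mathcal F^{(n)}$, $\mathcal F^{(0)}=\mathbb R$, $\mathcal F^{(n)}=L^2(S_n,dt_1\,d\nu(s_1)\cdots dt_n\,d\nu(s_n))$; $\Omega=(1,0,0,\dots)$ is the vacuum and $f^{(n)}\in\mathcal F^{(n)}$ is identified with the corresponding element of $\mathcal F$. $B_0(\mathbb R_+^n)$ is the space of bounded measurable functions on $\mathbb R_+^n$ with compact support; a sequence converges in $B_0(\mathbb R_+^n)$ if all terms vanish outside a common compact set and it converges uniformly. For $h\in B_0(\mathbb R_+)$ define bounded operators on $\mathcal F$: the creation operator $a^+(h)$, $a^+(h)\Omega=h$ (the function $(t,s)\mapsto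 h(t)$), $(a^+(h)f^{(n)})(t_1,s_1,\dots,t_{n+1},s_{n+1})=h(t_1)f^{(n)}(t_2,s_2,\dots,t_{n+1},s_{n+1})$; the neutral operator $a^0(h)$, $a^0(h)\Omega=0$, $(a^0(h)f^{(n)})(t_1,s_1,\dots,t_n,s_n)=h(t_1)s_1f^{(n)}(t_1,s_1,\dots,t_n,s_n)$; the annihilation operator $a^-(h)$, $a^-(h)\Omega=0$, $(a^-(h)f^{(n)})(t_1,s_1,\dots,t_{n-1},s_{n-1})=\int_{t_1}^\infty\int_{\mathbb R}h(u)f^{(n)}(u,v,t_1,s_1,\dots,t_{n-1},s_{n-1})\,d\nu(v)\,du$ (for $n=1$: $\int_0^\infty\int_{\mathbb R}h(u)f^{(1)}(u,v)\,d\nu(v)\,du\;\Omega$). Put $\langle\omega,h\rangle=a^+(h)+a^0(h)+a^-(h)$, a bounded self-adjoint operator. For $h_1,\dots,h_n\in B_0(\mathbb R_+)$ put $\langle\omega^{\otimes n},h_1\otimes\cdots\otimes h_n\rangle=\langle\omega,h_1\rangle\cdots\langle\omega,h_n\rangle$, where $(h_1\otimes\cdots\otimes h_n)(t_1,\dots,t_n)=h_1(t_1)\cdots h_n(t_n)$; this extends by linearity and strong continuity to a map $f^{(n)}\mapsto\langle\omega^{\otimes n},f^{(n)}\rangle$ from $B_0(\mathbb R_+^n)$ to bounded operators on $\mathcal F$ (monomials of order $n$; monomials of order $0$ are real multiples of the identity). Let $\mathbf P$ be the linear span of all monomials (polynomials of $\omega$) and $\mathbf P^{(n)}$ the span of monomials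 of order $\le n$. $L^2(\tau)$ is the Hilbert space completion of $\mathbf P$ modulo null vectors with respect to $(P_1,P_2)_{L^2(\tau)}=(P_1\Omega,P_2\Omega)_{\mathcal F}$. Let $\mathbf S^{(0)}=\overline{\mathbf P^{(0)}}$ and $\mathbf S^{(n)}=\overline{\mathbf P^{(n)}}\ominus\overline{\mathbf P^{(n-1)}}$ (closures in $L^2(\tau)$). For $f^{(n)}\in B_0(\mathbb R_+^n)$ the orthogonal polynomial $\langle P^{(n)}(\omega),f^{(n)}\rangle$ is the orthogonal projection in $L^2(\tau)$ of $\langle\omega^{\otimes n},f^{(n)}\rangle$ onto $\mathbf S^{(n)}$. Orthogonal polynomials of $\nu$: $(p_k)_{k\ge0}$ are the monic orthogonal polynomials in $L^2(\mathbb R,\nu)$ (if $\operatorname{supp}\nu$ has $N$ points, $p_k:=0$ for $k\ge N$), satisfying $sp_k(s)=p_{k+1}(s)+b_kp_k(s)+a_kp_{k-1}(s)$, $k\ge0$, $p_{-1}=0$, $b_k\in\mathbb R$, $a_k\ge0$; set $a_0=1$ and $c_k=\int p_{k-1}^2\,d\nu=a_0a_1\cdots a_{k-1}$, $k\in\mathbb N$. Measures $m_n$: $M$ is the set of tuples $(l_1,\dots,l_i)\in\mathbb N_0^i$, $i\in\mathbb N$. For $(l_1,\dots,l_i)\in M$ with $l_1+\dots+l_i+i=n$, let $\phi_{(l_1,\dots,l_i)}$ map $(\tau_1,\dots,\tau_i)$ with $\tau_1>\dots>\tau_i\ge0$ to the point of $T_n$ whose coordinates are $\tau_1$ repeated $l_1+1$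 times, then $\tau_2$ repeated $l_2+1$ times, …, then $\tau_i$ repeated $l_i+1$ times; its image is $T^{(l_1,\dots,l_i)}$ (these sets partition $T_n$). $m^{(l_1,\dots,l_i)}$ is the image under $\phi_{(l_1,\dots,l_i)}$ of the measure $c_{l_1+1}c_{l_2+1}\cdots c_{l_i+1}\,d\tau_1\cdots d\tau_i$, regarded as a measure on $T_n$, and $m_n=\sum_{(l_1,\dots,l_i)\in M,\ l_1+\dots+l_i+i=n}m^{(l_1,\dots,l_i)}$. *)

theory Defs
  imports "HOL-Probability.Probability" "HOL-Computational_Algebra.Polynomial"
begin

definition opoly_prop :: "real measure \<Rightarrow> nat \<Rightarrow> real poly \<Rightarrow> bool" where
  "opoly_prop \<nu> k p \<longleftrightarrow> degree p = k \<and> lead_coeff p = 1 \<and>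
     (\<forall>j<k. (\<integral>x. poly p x * x ^ j \<partial>\<nu>) = 0) \<and> (\<integral>x. (poly p x)\<^sup>2 \<partial>\<nu>) \<noteq> 0"

text \<open>p_k: the monic orthogonal polynomial of degree k (nonzero in L2(nu)); p_k := 0 if none exists
  (i.e. k at least the number of support points).\<close>
definition opoly :: "real measure \<Rightarrow> nat \<Rightarrow> real poly" where
  "opoly \<nu> k = (if \<exists>!p. opoly_prop \<nu> k p then THE p. opoly_prop \<nu> k p else 0)"

definition cconst :: "real measure \<Rightarrow> nat \<Rightarrow> real" where
  "cconst \<nu> k = (\<integral>x. (poly (opoly \<nu> (k - 1)) x)\<^sup>2 \<partial>\<nu>)"

section \<open>Monotone Fock space (vectors represented by families of representative functions)\<close>

text \<open>A point of S_m is encoded as z :: nat => real * real, z i = (t_(i+1), s_(i+1)) for i < m.\<close>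
type_synonym fock = "nat \<Rightarrow> (nat \<Rightarrow> real \<times> real) \<Rightarrow> real"

definition vcons :: "'a \<Rightarrow> (nat \<Rightarrow> 'a) \<Rightarrow> nat \<Rightarrow> 'a" where
  "vcons a z = (\<lambda>i. case i of 0 \<Rightarrow> a | Suc j \<Rightarrow> z j)"

definition vshift :: "(nat \<Rightarrow> 'a) \<Rightarrow> nat \<Rightarrow> 'a" where
  "vshift z = (\<lambda>i. z (Suc i))"

definition S_set :: "nat \<Rightarrow> (nat \<Rightarrow> real \<times> real) set" where
  "S_set m = {z. (\<forall>i<m. 0 \<le> fst (z i)) \<and> (\<forall>i j. i \<le> j \<longrightarrow> j < m \<longrightarrow> fst (z j) \<le> fst (z i))}"

definition fock_measure :: "real measure \<Rightarrow> nat \<Rightarrow> (nat \<Rightarrow> real \<times> real) measure" where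
  "fock_measure \<nu> m = PiM {..<m} (\<lambda>_. lborel \<Otimes>\<^sub>M \<nu>)"

definition fock_inner :: "real measure \<Rightarrow> fock \<Rightarrow> fock \<Rightarrow> real" where
  "fock_inner \<nu> \<psi> \<phi> = (\<Sum>m. (\<integral>z. indicator (S_set m) z * \<psi> m z * \<phi> m z \<partial>fock_measure \<nu> m))"

definition fock_norm :: "real measure \<Rightarrow> fock \<Rightarrow> real" where
  "fock_norm \<nu> \<psi> = sqrt (fock_inner \<nu> \<psi> \<psi>)"

definition fock_space :: "real measure \<Rightarrow> fock set" where
  "fock_space \<nu> = {\<psi>. (\<forall>m. \<psi> m \<in> borel_measurable (fock_measure \<nu> m) \<and>
       integrable (fock_measure \<nu> m) (\<lambda>z. indicator (S_set m) z * (\<psi> m z)\<^sup>2)) \<and>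
     summable (\<lambda>m. \<integral>z. indicator (S_set m) z * (\<psi> m z)\<^sup>2 \<partial>fock_measure \<nu> m)}"

definition vacuum :: fock where
  "vacuum = (\<lambda>m z. if m = 0 then 1 else 0)"

text \<open>Creation + neutral + annihilation operator, applied to a family B of operators
  depending on the time parameter of the (leftmost) test function.  For B u = h(u) * Id
  this is exactly <omega,h> = a^+(h) + a^0(h) + a^-(h).\<close>
definition Xop :: "real measure \<Rightarrow> (real \<Rightarrow> fock \<Rightarrow> fock) \<Rightarrow> fock \<Rightarrow> fock" where
  "Xop \<nu> B \<psi> = (\<lambda>m z.
     (case m of 0 \<Rightarrow> 0
      | Suc k \<Rightarrow> B (fst (z 0)) \<psi> k (vshift z) + snd (z 0) * B (fst (z 0)) \<psi> m z)
     + (\<integral>u. indicator {(if m = 0 then 0 else fst (z 0))..} u *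
              (\<integral>v. B u \<psi> (Suc m) (vcons (u, v) z) \<partial>\<nu>) \<partial>lborel))"

text \<open>The monomial <omega^{(x)n}, f> acting on Fock vectors; for f = h_1 (x) ... (x) h_n it is
  <omega,h_1> ... <omega,h_n>.\<close>
fun mono :: "real measure \<Rightarrow> nat \<Rightarrow> ((nat \<Rightarrow> real) \<Rightarrow> real) \<Rightarrow> fock \<Rightarrow> fock" where
  "mono \<nu> 0 f \<psi> = (\<lambda>m z. f (\<lambda>_. undefined) * \<psi> m z)"
| "mono \<nu> (Suc n) f \<psi> = Xop \<nu> (\<lambda>u. mono \<nu> n (\<lambda>x. f (vcons u x))) \<psi>"

text \<open>B_0(R_+^n): bounded measurable functions with compact support in R_+^n
  (values at points with a negative coordinate are irrelevant).\<close>
definition B0 :: "nat \<Rightarrow> ((nat \<Rightarrow> real) \<Rightarrow> real) set" where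
  "B0 n = {f. f \<in> borel_measurable (PiM {..<n} (\<lambda>_. lborel)) \<and> (\<exists>C. \<forall>x. \<bar>f x\<bar> \<le> C) \<and>
            (\<exists>R. \<forall>x. (\<exists>i<n. R < x i) \<longrightarrow> f x = 0)}"

inductive_set polyvec :: "real measure \<Rightarrow> nat \<Rightarrow> fock set" for \<nu> N where
  mono_in: "k \<le> N \<Longrightarrow> f \<in> B0 k \<Longrightarrow> mono \<nu> k f vacuum \<in> polyvec \<nu> N"
| add_in: "x \<in> polyvec \<nu> N \<Longrightarrow> y \<in> polyvec \<nu> N \<Longrightarrow> (\<lambda>m z. x m z + y m z) \<in> polyvec \<nu> N"
| scale_in: "x \<in> polyvec \<nu> N \<Longrightarrow> (\<lambda>m z. c * x m z) \<in> polyvec \<nu> N"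

text \<open>Closure in the Fock norm (L2(tau) is identified with the closure of P Omega in F).\<close>
definition fclos :: "real measure \<Rightarrow> fock set \<Rightarrow> fock set" where
  "fclos \<nu> A = {\<psi> \<in> fock_space \<nu>. \<exists>\<phi>. (\<forall>k. \<phi> k \<in> A) \<and>
       (\<lambda>k. fock_norm \<nu> (\<lambda>m z. \<psi> m z - \<phi> k m z)) \<longlonglongrightarrow> 0}"

definition Sspace :: "real measure \<Rightarrow> nat \<Rightarrow> fock set" where
  "Sspace \<nu> n = {y \<in> fclos \<nu> (polyvec \<nu> n). \<forall>w \<in> fclos \<nu> (polyvec \<nu> (n - 1)). fock_inner \<nu> y w = 0}"

definition is_proj :: "real measure \<Rightarrow> fock set \<Rightarrow> fock \<Rightarrow> fock \<Rightarrow> bool" where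
  "is_proj \<nu> V x y \<longleftrightarrow> y \<in> V \<and> (\<forall>w\<in>V. fock_inner \<nu> (\<lambda>m z. x m z - y m z) w = 0)"

text \<open>The orthogonal polynomial <P^(n)(omega), f> (as a vector P Omega in F).\<close>
definition orth_poly :: "real measure \<Rightarrow> nat \<Rightarrow> ((nat \<Rightarrow> real) \<Rightarrow> real) \<Rightarrow> fock" where
  "orth_poly \<nu> n f = (SOME y. is_proj \<nu> (Sspace \<nu> n) (mono \<nu> n f vacuum) y)"

definition T_set :: "nat \<Rightarrow> (nat \<Rightarrow> real) set" where
  "T_set n = {t. (\<forall>i<n. 0 \<le> t i) \<and> (\<forall>i j. i \<le> j \<longrightarrow> j < n \<longrightarrow> t j \<le> t i)}"

definition comps :: "nat \<Rightarrow> nat list set" where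
  "comps n = {ls. ls \<noteq> [] \<and> sum_list (map Suc ls) = n}"

definition blk :: "nat list \<Rightarrow> nat \<Rightarrow> nat" where
  "blk ls k = (LEAST j. k < (\<Sum>a<Suc j. Suc (ls ! a)))"

definition phi :: "nat list \<Rightarrow> (nat \<Rightarrow> real) \<Rightarrow> nat \<Rightarrow> real" where
  "phi ls \<tau> = restrict (\<lambda>k. \<tau> (blk ls k)) {..<sum_list (map Suc ls)}"

definition Dec :: "nat \<Rightarrow> (nat \<Rightarrow> real) set" where
  "Dec i = {\<tau>. (\<forall>j. Suc j < i \<longrightarrow> \<tau> (Suc j) < \<tau> j) \<and> (0 < i \<longrightarrow> 0 \<le> \<tau> (i - 1))}"

definition m_comp :: "real measure \<Rightarrow> nat list \<Rightarrow> (nat \<Rightarrow> real) measure" where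
  "m_comp \<nu> ls = distr
     (density (PiM {..<length ls} (\<lambda>_. lborel))
        (\<lambda>\<tau>. ennreal (\<Prod>j<length ls. cconst \<nu> (Suc (ls ! j))) * indicator (Dec (length ls)) \<tau>))
     (PiM {..<sum_list (map Suc ls)} (\<lambda>_. lborel)) (phi ls)"

definition m_meas :: "real measure \<Rightarrow> nat \<Rightarrow> (nat \<Rightarrow> real) measure" where
  "m_meas \<nu> n = measure_of (space (PiM {..<n} (\<lambda>_. lborel))) (sets (PiM {..<n} (\<lambda>_. lborel)))
     (\<lambda>A. \<Sum>ls\<in>comps n. emeasure (m_comp \<nu> ls) A)"

end

theory Submission
  imports Defs
begin

text \<open>
  The kernel \<open>P_l\<^sub>1(s\<^sub>1) \<dots> P_l\<^sub>m(s\<^sub>m) F(t\<^sub>1, \<dots>, t\<^sub>m)\<close> on the \<open>m\<close>-particle level is assigned the order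
  \<open>(l\<^sub>1 + 1) + \<dots> + (l\<^sub>m + 1)\<close>. By the three-term recurrence of the \<open>P_k\<close>, creation together with the
  raising part of the neutral operator increases the order of a kernel by one, and the remaining
  parts keep or lower it. Hence a monomial of order \<open>n\<close> with test function \<open>f\<close>, applied to the vacuum,
  is a sum of kernels of order at most \<open>n\<close>, and in order exactly \<open>n\<close> the coefficient function is
  \<open>f\<close> composed with \<open>phi (l\<^sub>1, \<dots>, l\<^sub>m)\<close>. Conversely, a test function supported on the stratum
  \<open>T^(l\<^sub>1, \<dots>, l\<^sub>m)\<close> isolates a single kernel of top order up to lower order, so the kernels of order
  at most \<open>n\<close> span the polynomials of order at most \<open>n\<close>. Kernels with different indices are
  orthogonal by orthogonality of the \<open>P_k\<close>; therefore the part of order \<open>n\<close> is the orthogonal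
  projection, and its inner products are read off from the norms \<open>c_(l + 1)\<close> of the \<open>P_l\<close>.
\<close>

section \<open>Orthogonal polynomials\<close>

text \<open>The measures \<open>m_n\<close> charge diagonals because the neutral operator of a
  factor \<open>h\<close> acts at the time \<open>t_1\<close> that the first particle already
  occupies: multiplying \<open>P_l(s_1)\<close> by \<open>s_1\<close> produces
  \<open>P_(l + 1)(s_1)\<close> and evaluates the test function once more at \<open>t_1\<close>. A
  particle carrying \<open>P_l\<close> thus accounts for \<open>l + 1\<close> equal arguments of the
  test function, which explains \<open>phi\<close>, and the squared norm of \<open>P_l\<close>
  becomes the weight \<open>c_(l + 1)\<close>. Two obstacles shape the argument. Vectors are
  families of functions rather than classes, so the form on them is only semidefinite, monomials are
  compared with kernels only on \<open>S_set\<close>, and the strata can be told apart only where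
  different particles have different times; ties form a null set. Moreover \<open>orth_poly\<close>
  is an arbitrary choice among projections, hence accessible only through its inner products, and a
  projection is exhibited explicitly instead of being drawn from completeness.\<close>

locale compact_prob = prob_space \<nu> for \<nu> :: "real measure" +
  assumes sets_nu [measurable_cong]: "sets \<nu> = sets borel"
    and compact_carrier: "\<exists>K. compact K \<and> K \<in> sets \<nu> \<and> emeasure \<nu> K = 1"

text \<open>Monic orthogonal polynomials of every degree. Once the norm of some \<open>mpoly \<nu> k\<close> vanishes,
  \<open>x / 0 = 0\<close> lets the recursion continue with polynomials that are null in \<open>L\<^sup>2(\<nu>)\<close> but not zero;
  unlike for \<open>opoly\<close>, the three-term recurrence then holds at every point and not only almost everywhere.\<close>
fun mpoly :: "real measure \<Rightarrow> nat \<Rightarrow> real poly" where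
  "mpoly \<nu> 0 = 1"
| "mpoly \<nu> (Suc 0) = [:- (\<integral>x. x \<partial>\<nu>), 1:]"
| "mpoly \<nu> (Suc (Suc k)) =
     [:- ((\<integral>x. x * (poly (mpoly \<nu> (Suc k)) x)\<^sup>2 \<partial>\<nu>) / (\<integral>x. (poly (mpoly \<nu> (Suc k)) x)\<^sup>2 \<partial>\<nu>)), 1:]
        * mpoly \<nu> (Suc k)
     - smult ((\<integral>x. (poly (mpoly \<nu> (Suc k)) x)\<^sup>2 \<partial>\<nu>) / (\<integral>x. (poly (mpoly \<nu> k) x)\<^sup>2 \<partial>\<nu>)) (mpoly \<nu> k)"

declare mpoly.simps(2,3) [simp del]

context compact_prob
begin

abbreviation P :: "nat \<Rightarrow> real poly" where "P \<equiv> mpoly \<nu>"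

definition L :: "real poly \<Rightarrow> real" where "L p = (\<integral>x. poly p x \<partial>\<nu>)"

definition jacobi_b :: "nat \<Rightarrow> real" where "jacobi_b k = L ([:0, 1:] * (P k * P k)) / L (P k * P k)"

text \<open>The quotient \<open>c_(k + 1) / c_k\<close>, as forced by pairing the recurrence with
  \<open>P (k - 1)\<close>. The value 0 at \<open>k = 0\<close> stands for \<open>p_(-1) = 0\<close>
  and is unrelated to the convention \<open>a_0 = 1\<close> in the constants
  \<open>c_k\<close>.\<close>

definition jacobi_a :: "nat \<Rightarrow> real" where
  "jacobi_a k = (if k = 0 then 0 else L (P k * P k) / L (P (k - 1) * P (k - 1)))"

lemma poly_measurable [measurable]: "poly p \<in> borel_measurable \<nu>"
proof -
  have "poly p \<in> borel_measurable borel"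
    by (intro borel_measurable_continuous_onI continuous_intros)
  then show ?thesis by (simp add: measurable_cong_sets[OF sets_nu refl])
qed

text \<open>Compactness of the carrier enters here: a polynomial is bounded on it, hence bounded
  almost everywhere.\<close>

lemma integrable_poly: "integrable \<nu> (poly p)"
proof -
  obtain K where K: "compact K" "K \<in> sets \<nu>" "emeasure \<nu> K = 1"
    using compact_carrier by blast
  have "bounded (poly p ` K)"
    by (intro compact_imp_bounded compact_continuous_image K(1) continuous_intros)
  then obtain B where B: "\<And>x. x \<in> K \<Longrightarrow> norm (poly p x) \<le> B"
    unfolding bounded_iff by auto
  have "AE x in \<nu>. x \<in> K"
    using K by (auto simp: AE_in_set_eq_1 measure_def)
  then have "AE x in \<nu>. norm (poly p x) \<le> B"
    using B by (auto elim: AE_mp)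
  then show ?thesis
    by (intro integrable_const_bound) auto
qed

lemma L_add: "L (p + q) = L p + L q"
  by (simp add: L_def integrable_poly)

lemma L_diff: "L (p - q) = L p - L q"
  by (simp add: L_def integrable_poly)

lemma L_smult: "L (smult c p) = c * L p"
  by (simp add: L_def)

lemma L_sum: "L (\<Sum>i\<in>A. p i) = (\<Sum>i\<in>A. L (p i))"
  by (simp add: L_def poly_sum integrable_poly)

lemma L_0: "L 0 = 0"
  by (simp add: L_def)

lemma L_1: "L 1 = 1"
  by (simp add: L_def prob_space)

text \<open>A nonnegative function with integral 0 vanishes almost everywhere, and every multiple of
  \<open>p\<close> vanishes with \<open>p\<close>. This handles measures with finitely many support
  points, where norms cannot be divided by.\<close>

lemma L_null:
  assumes "L (p * p) = 0" shows "L (p * q) = 0"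
proof -
  have "AE x in \<nu>. poly (p * p) x = 0"
    using assms integrable_poly unfolding L_def
    by (subst (asm) integral_nonneg_eq_0_iff_AE) auto
  then have "AE x in \<nu>. poly (p * q) x = 0"
    by eventually_elim simp
  then show ?thesis unfolding L_def by (rule integral_eq_zero_AE)
qed

lemma P_Suc: "P (Suc k) = [:- jacobi_b k, 1:] * P k - (if k = 0 then 0 else smult (jacobi_a k) (P (k - 1)))"
  by (cases k) (simp_all add: mpoly.simps jacobi_b_def jacobi_a_def L_def prob_space power2_eq_square)

lemma P_rec:
  "[:0, 1:] * P k = P (Suc k) + smult (jacobi_b k) (P k) + (if k = 0 then 0 else smult (jacobi_a k) (P (k - 1)))"
  unfolding P_Suc by (simp add: algebra_simps)

lemma poly_P_rec:
  "s * poly (P k) s = poly (P (Suc k)) s + jacobi_b k * poly (P k) s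
      + (if k = 0 then 0 else jacobi_a k * poly (P (k - 1)) s)"
  using arg_cong[OF P_rec[of k], of "\<lambda>p. poly p s"] by (auto split: if_splits)

lemma degree_P: "degree (P k) = k \<and> lead_coeff (P k) = 1"
proof (induction k rule: less_induct)
  case (less k)
  show ?case
  proof (cases k)
    case (Suc j)
    have IH: "degree (P j) = j" "lead_coeff (P j) = 1" "P j \<noteq> 0"
      using less.IH[of j] Suc by auto
    have d: "degree ([:- jacobi_b j, 1:] * P j) = Suc j"
      using IH by (subst degree_mult_eq) auto
    have l: "lead_coeff ([:- jacobi_b j, 1:] * P j) = 1"
      by (subst lead_coeff_mult) (simp add: IH(2))
    have "degree (if j = 0 then 0 else smult (jacobi_a j) (P (j - 1))) < Suc j"
      using less.IH[of "j - 1"] Suc by (auto intro: le_less_trans[OF degree_smult_le])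
    with d l have "degree (P (Suc j)) = Suc j" "lead_coeff (P (Suc j)) = 1"
      unfolding P_Suc
      by (simp_all only: diff_conv_add_uminus degree_add_eq_left degree_minus)
         (simp_all only: coeff_add coeff_minus coeff_eq_0 minus_zero add_0_right)
    with Suc show ?thesis by blast
  qed simp
qed

text \<open>The vanishing norm is the numerator of \<open>jacobi_a k\<close>, so the recursion makes
  \<open>P (Suc k)\<close> a multiple of the null polynomial \<open>P k\<close>.\<close>

lemma P_null_Suc:
  assumes "L (P k * P k) = 0" shows "L (P (Suc k) * q) = 0"
proof -
  have "L (P k * r) = 0" for r by (rule L_null[OF assms])
  moreover have "jacobi_a k = 0" using assms by (simp add: jacobi_a_def)
  moreover have "P (Suc k) * q = P k * ([:- jacobi_b k, 1:] * q)
      - (if k = 0 then 0 else smult (jacobi_a k) (P (k - 1) * q))"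
    unfolding P_Suc by (simp add: algebra_simps)
  ultimately show ?thesis by (simp add: L_diff L_0)
qed

text \<open>Strong induction: the recurrence lowers \<open>P k\<close> to \<open>P k'\<close>, and
  the remaining factor \<open>X\<close> is moved to \<open>P j\<close> and expanded again. Only
  \<open>j = k'\<close> and \<open>Suc j = k'\<close> leave terms that the induction does not kill;
  these cancel by the choice of \<open>jacobi_b\<close> and \<open>jacobi_a\<close>.\<close>

lemma P_orth: "j < k \<Longrightarrow> L (P k * P j) = 0"
proof (induction k arbitrary: j rule: less_induct)
  case (less k)
  then obtain k' where k: "k = Suc k'" by (cases k) auto
  have IH: "L (P i * P j) = 0" if "i < k" "j < k" "i \<noteq> j" for i j
    using less.IH[of i j] less.IH[of j i] that by (cases i j rule: linorder_cases) (auto simp: mult.commute)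
  show ?case
  proof (cases "L (P k' * P k') = 0")
    case True
    then show ?thesis unfolding k by (rule P_null_Suc)
  next
    case False
    have e: "L (P k * P j) = L ([:0, 1:] * P k' * P j) - jacobi_b k' * L (P k' * P j)
        - (if k' = 0 then 0 else jacobi_a k' * L (P (k' - 1) * P j))" for j
    proof -
      have "P k * P j = [:0, 1:] * P k' * P j - smult (jacobi_b k') (P k' * P j)
        - (if k' = 0 then 0 else smult (jacobi_a k') (P (k' - 1) * P j))"
        unfolding k P_Suc by (simp add: algebra_simps)
      then show ?thesis by (simp add: L_diff L_smult L_0)
    qed
    show ?thesis
    proof (cases "j = k'")
      case True
      have "L ([:0, 1:] * P k' * P k') = jacobi_b k' * L (P k' * P k')"
        using False by (simp add: jacobi_b_def mult.assoc)
      moreover have "k' \<noteq> 0 \<Longrightarrow> L (P (k' - 1) * P k') = 0"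
        using k by (intro IH) auto
      ultimately show ?thesis unfolding True e by simp
    next
      case ne: False
      with less.prems k have jk: "j < k'" by simp
      have x: "L ([:0, 1:] * P k' * P j) = L (P k' * P (Suc j)) + jacobi_b j * L (P k' * P j)
         + (if j = 0 then 0 else jacobi_a j * L (P k' * P (j - 1)))"
      proof -
        have "[:0, 1:] * P k' * P j = P k' * ([:0, 1:] * P j)" by (simp add: algebra_simps)
        also have "\<dots> = P k' * P (Suc j) + smult (jacobi_b j) (P k' * P j)
            + (if j = 0 then 0 else smult (jacobi_a j) (P k' * P (j - 1)))"
          unfolding P_rec by (simp add: algebra_simps)
        finally show ?thesis by (simp add: L_add L_smult L_0)
      qed
      have z: "L (P k' * P j) = 0" "j \<noteq> 0 \<Longrightarrow> L (P k' * P (j - 1)) = 0"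
        using jk k by (auto intro!: IH)
      show ?thesis
      proof (cases "Suc j = k'")
        case True
        \<comment> \<open>A null \<open>P j\<close> would make its successor \<open>P k'\<close>
          null, which is excluded here; so the division in \<open>jacobi_a k'\<close> is a genuine
          one.\<close>
        have "L (P j * P j) \<noteq> 0"
          using False P_null_Suc[of j] unfolding True[symmetric] by blast
        then have "jacobi_a k' * L (P (k' - 1) * P j) = L (P k' * P k')"
          using True by (auto simp: jacobi_a_def)
        then show ?thesis unfolding e x using z True by auto
      next
        case False
        then have "L (P k' * P (Suc j)) = 0" "L (P (k' - 1) * P j) = 0"
          using jk k by (auto intro!: IH)
        then show ?thesis unfolding e x using z by auto
      qed
    qed
  qed
qed

lemma L_P_P: "L (P i * P j) = (if i = j then L (P i * P i) else 0)"
  using P_orth[of i j] P_orth[of j i] by (cases i j rule: linorder_cases) (auto simp: mult.commute)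

lemma L_P: "L (P k) = (if k = 0 then 1 else 0)"
  using L_P_P[of k 0] by (auto simp: L_1)

lemma P_span:
  "\<forall>i\<ge>k. coeff q i = 0 \<Longrightarrow> \<exists>c. q = (\<Sum>j<k. smult (c j) (P j))"
proof (induction k arbitrary: q)
  case 0
  then show ?case by (auto simp: poly_eq_iff)
next
  case (Suc k)
  have "\<forall>i\<ge>k. coeff (q - smult (coeff q k) (P k)) i = 0"
  proof (intro allI impI)
    fix i assume "k \<le> i"
    then consider "i = k" | "i > k" by linarith
    then show "coeff (q - smult (coeff q k) (P k)) i = 0"
    proof cases
      case 1
      then show ?thesis using conjunct2[OF degree_P[of k]] conjunct1[OF degree_P[of k]] by auto
    next
      case 2
      then show ?thesis using degree_P[of k] Suc.prems by (simp add: coeff_eq_0)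
    qed
  qed
  then obtain c where "q - smult (coeff q k) (P k) = (\<Sum>j<k. smult (c j) (P j))"
    using Suc.IH by blast
  then have "q = (\<Sum>j<Suc k. smult ((c(k := coeff q k)) j) (P j))"
    by (simp add: algebra_simps)
  then show ?case by blast
qed

lemma P_orth_low:
  assumes "\<forall>i\<ge>k. coeff q i = 0" shows "L (P k * q) = 0"
proof -
  obtain c where "q = (\<Sum>j<k. smult (c j) (P j))" using P_span[OF assms] by blast
  then have "P k * q = (\<Sum>j<k. smult (c j) (P k * P j))" by (simp add: sum_distrib_left)
  then show ?thesis by (simp add: L_sum L_smult P_orth)
qed

text \<open>For uniqueness, \<open>d = p - P k\<close> has degree below \<open>k\<close> and is
  orthogonal to each \<open>P j\<close> with \<open>j < k\<close>; expanding \<open>d\<close> in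
  these and using that none of them is null gives \<open>d = 0\<close>. A null \<open>P k\<close>
  admits no candidate, since \<open>L (p * p) = L (p * P k)\<close>.\<close>

lemma opoly_prop_iff:
  "opoly_prop \<nu> k p \<longleftrightarrow> L (P k * P k) \<noteq> 0 \<and> p = P k"
proof
  assume p: "opoly_prop \<nu> k p"
  have deg: "degree p = k" "lead_coeff p = 1" and ne: "L (p * p) \<noteq> 0"
    using p by (auto simp: opoly_prop_def L_def power2_eq_square)
  have mo: "L (p * monom 1 j) = 0" if "j < k" for j
    using p that by (auto simp: opoly_prop_def L_def poly_monom)
  have low: "L (p * q) = 0" if "\<forall>i\<ge>k. coeff q i = 0" for q
  proof -
    have "degree q \<le> k" using that by (intro degree_le) auto
    then have "q = (\<Sum>i\<le>k. monom (coeff q i) i)" by (simp add: poly_as_sum_of_monoms')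
    also have "\<dots> = (\<Sum>i\<le>k. smult (coeff q i) (monom 1 i))" by (simp add: smult_monom)
    finally have "p * q = (\<Sum>i\<le>k. smult (coeff q i) (p * monom 1 i))"
      by (metis (no_types, lifting) mult_smult_right sum.cong sum_distrib_left)
    then have "L (p * q) = (\<Sum>i\<le>k. coeff q i * L (p * monom 1 i))"
      by (simp add: L_sum L_smult)
    also have "\<dots> = 0"
      using mo that by (intro sum.neutral) (auto simp: le_less)
    finally show ?thesis .
  qed
  define d where "d = p - P k"
  have d: "\<forall>i\<ge>k. coeff d i = 0"
  proof (intro allI impI)
    fix i assume "k \<le> i"
    then consider "i = k" | "i > k" by linarith
    then show "coeff d i = 0"
      using degree_P[of k] deg by cases (auto simp: d_def coeff_eq_0)
  qed
  have "L (p * p) = L (p * P k) + L (p * d)"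
    by (simp add: d_def L_add[symmetric] algebra_simps)
  then have "L (P k * p) \<noteq> 0" using low[OF d] ne by (simp add: mult.commute)
  then have nk: "L (P k * P k) \<noteq> 0" using L_null by blast
  \<comment> \<open>Nullness passes from each index to the next, so a non-null \<open>P k\<close>
    keeps all earlier polynomials non-null.\<close>
  have nj: "L (P j * P j) \<noteq> 0" if "j \<le> k" for j
    using that nk
  proof (induction rule: inc_induct)
    case (step n)
    then show ?case using P_null_Suc by blast
  qed
  obtain c where c: "d = (\<Sum>j<k. smult (c j) (P j))" using P_span[OF d] by blast
  have "c j = 0" if "j < k" for j
  proof -
    have "L (d * P j) = L (p * P j) - L (P k * P j)"
      by (simp add: d_def L_diff[symmetric] algebra_simps)
    also have "\<dots> = 0"
    proof -
      have "\<forall>i\<ge>k. coeff (P j) i = 0" using degree_P[of j] that by (auto intro!: coeff_eq_0)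
      then show ?thesis using low that by (simp add: P_orth)
    qed
    finally have "L (d * P j) = 0" .
    moreover have "L (d * P j) = (\<Sum>i<k. c i * L (P i * P j))"
      by (simp add: c sum_distrib_right L_sum L_smult)
    moreover have "\<dots> = (\<Sum>i<k. if i = j then c i * L (P i * P i) else 0)"
      by (intro sum.cong refl) (metis L_P_P mult_zero_right)
    moreover have "\<dots> = c j * L (P j * P j)" using that by simp
    ultimately show ?thesis using nj[of j] that by simp
  qed
  then have "d = 0" unfolding c by simp
  then show "L (P k * P k) \<noteq> 0 \<and> p = P k" using nk by (simp add: d_def)
next
  assume *: "L (P k * P k) \<noteq> 0 \<and> p = P k"
  have "(\<integral>x. poly p x * x ^ j \<partial>\<nu>) = 0" if "j < k" for j
  proof -
    have "L (P k * monom 1 j) = 0" using that by (intro P_orth_low) auto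
    then show ?thesis using * by (simp add: L_def poly_monom)
  qed
  then show "opoly_prop \<nu> k p"
    using * degree_P[of k] by (auto simp: opoly_prop_def L_def power2_eq_square)
qed

text \<open>The two degenerate conventions agree: if \<open>P k\<close> is null, no admissible
  polynomial exists, \<open>opoly\<close> is 0, and both sides are 0.\<close>

lemma cconst_Suc: "cconst \<nu> (Suc k) = L (P k * P k)"
proof (cases "L (P k * P k) = 0")
  case True
  then have "\<not> (\<exists>!p. opoly_prop \<nu> k p)" unfolding opoly_prop_iff by blast
  then show ?thesis using True by (simp add: cconst_def opoly_def)
next
  case False
  then have "opoly_prop \<nu> k = (\<lambda>p. p = P k)"
    by (auto simp: fun_eq_iff opoly_prop_iff)
  then have "opoly \<nu> k = P k"
    by (simp add: opoly_def)
  then show ?thesis by (simp add: cconst_def L_def power2_eq_square)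
qed

lemma L_square_nonneg: "0 \<le> L (p * p)"
  by (simp add: L_def)

end

section \<open>Index tuples and the kernel recursion\<close>

lemma vcons_simps [simp]: "vcons a z 0 = a" "vcons a z (Suc i) = z i" "vshift (vcons a z) = z"
  by (auto simp: vcons_def vshift_def)

lemma vcons_eta [simp]: "vcons (z 0) (vshift z) = z"
  by (auto simp: vcons_def vshift_def fun_eq_iff split: nat.splits)

section \<open>Measurability of prepending and removing a coordinate\<close>

lemma measurable_PiM_nth:
  "h \<in> measurable N (PiM I (\<lambda>_. M)) \<Longrightarrow> i \<in> I \<Longrightarrow> (\<lambda>w. h w i) \<in> measurable N M"
  by (rule measurable_compose[OF _ measurable_component_singleton])

lemma vcons_measurable [measurable (raw)]:
  assumes g: "g \<in> measurable N M" and h: "h \<in> measurable N (PiM {..<n} (\<lambda>_. M))"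
  shows "(\<lambda>w. vcons (g w) (h w)) \<in> measurable N (PiM {..<Suc n} (\<lambda>_. M))"
proof (rule measurable_PiM_single')
  fix i assume "i \<in> {..<Suc n}"
  then show "(\<lambda>w. vcons (g w) (h w) i) \<in> measurable N M"
    using g measurable_PiM_nth[OF h, of "i - 1"] by (cases i) auto
next
  show "(\<lambda>w i. vcons (g w) (h w) i) \<in> space N \<rightarrow> (\<Pi>\<^sub>E i\<in>{..<Suc n}. space M)"
  proof
    fix w assume w: "w \<in> space N"
    then have "h w \<in> (\<Pi>\<^sub>E i\<in>{..<n}. space M)"
      using measurable_space[OF h] by (simp add: space_PiM)
    then show "(\<lambda>i. vcons (g w) (h w) i) \<in> (\<Pi>\<^sub>E i\<in>{..<Suc n}. space M)"
      using measurable_space[OF g w] by (auto simp: PiE_iff extensional_def vcons_def split: nat.splits)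
  qed
qed

lemma vshift_measurable [measurable (raw)]:
  assumes h: "h \<in> measurable N (PiM {..<Suc n} (\<lambda>_. M))"
  shows "(\<lambda>w. vshift (h w)) \<in> measurable N (PiM {..<n} (\<lambda>_. M))"
proof (rule measurable_PiM_single')
  fix i assume "i \<in> {..<n}"
  then have "Suc i \<in> {..<Suc n}" by simp
  then show "(\<lambda>w. vshift (h w) i) \<in> measurable N M"
    unfolding vshift_def by (rule measurable_PiM_nth[OF h])
next
  show "(\<lambda>w i. vshift (h w) i) \<in> space N \<rightarrow> (\<Pi>\<^sub>E i\<in>{..<n}. space M)"
  proof
    fix w assume w: "w \<in> space N"
    then have "h w \<in> (\<Pi>\<^sub>E i\<in>{..<Suc n}. space M)"
      using measurable_space[OF h] by (simp add: space_PiM)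
    then show "(\<lambda>i. vshift (h w) i) \<in> (\<Pi>\<^sub>E i\<in>{..<n}. space M)"
      by (auto simp: PiE_iff extensional_def vshift_def)
  qed
qed

text \<open>Full sequences serve as the parameter space in \<open>ker_measurable\<close>, where the
  number of stored variables grows along the recursion; hence a variant over
  \<open>UNIV\<close>.\<close>

lemma vcons_measurable_UNIV [measurable (raw)]:
  assumes g: "g \<in> measurable N M" and h: "h \<in> measurable N (PiM UNIV (\<lambda>_. M))"
  shows "(\<lambda>w. vcons (g w) (h w)) \<in> measurable N (PiM UNIV (\<lambda>_. M))"
proof (rule measurable_PiM_single')
  fix i :: nat
  show "(\<lambda>w. vcons (g w) (h w) i) \<in> measurable N M"
    using g measurable_PiM_nth[OF h, of "i - 1"] by (cases i) auto
next
  show "(\<lambda>w i. vcons (g w) (h w) i) \<in> space N \<rightarrow> (\<Pi>\<^sub>E i\<in>UNIV. space M)"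
  proof
    fix w assume w: "w \<in> space N"
    then have "h w \<in> (\<Pi>\<^sub>E i\<in>UNIV. space M)"
      using measurable_space[OF h] by (simp add: space_PiM)
    then show "(\<lambda>i. vcons (g w) (h w) i) \<in> (\<Pi>\<^sub>E i\<in>UNIV. space M)"
      using measurable_space[OF g w] by (auto simp: PiE_iff extensional_def vcons_def split: nat.splits)
  qed
qed

lemma vshift_measurable_UNIV [measurable (raw)]:
  assumes h: "h \<in> measurable N (PiM UNIV (\<lambda>_. M))"
  shows "(\<lambda>w. vshift (h w)) \<in> measurable N (PiM UNIV (\<lambda>_. M))"
proof (rule measurable_PiM_single')
  fix i :: nat
  show "(\<lambda>w. vshift (h w) i) \<in> measurable N M"
    unfolding vshift_def by (rule measurable_PiM_nth[OF h]) auto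
next
  show "(\<lambda>w i. vshift (h w) i) \<in> space N \<rightarrow> (\<Pi>\<^sub>E i\<in>UNIV. space M)"
  proof
    fix w assume w: "w \<in> space N"
    then have "h w \<in> (\<Pi>\<^sub>E i\<in>UNIV. space M)"
      using measurable_space[OF h] by (simp add: space_PiM)
    then show "(\<lambda>i. vshift (h w) i) \<in> (\<Pi>\<^sub>E i\<in>UNIV. space M)"
      by (auto simp: PiE_iff extensional_def vshift_def)
  qed
qed

section \<open>Block structure of the map \<open>phi\<close>\<close>

abbreviation wlen :: "nat list \<Rightarrow> nat" where "wlen ls \<equiv> sum_list (map Suc ls)"

lemma psum_length: "(\<Sum>a<length ls. Suc (ls ! a)) = wlen ls"
  by (simp add: sum_list_sum_nth atLeast0LessThan)

lemma blk_Cons: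
  assumes "k < wlen (l # ls)"
  shows "blk (l # ls) k = (if k \<le> l then 0 else Suc (blk ls (k - Suc l)))"
proof -
  have b: "blk (l # ls) k = (LEAST j. k < Suc l + (\<Sum>a<j. Suc (ls ! a)))"
    unfolding blk_def by (simp add: sum.lessThan_Suc_shift del: sum.lessThan_Suc)
  show ?thesis
  proof (cases "k \<le> l")
    case True
    then have "(LEAST j. k < Suc l + (\<Sum>a<j. Suc (ls ! a))) = 0"
      by (intro Least_equality) auto
    with True b show ?thesis by simp
  next
    case False
    \<comment> \<open>\<open>Least_Suc\<close> asks for a witness; \<open>length ls\<close> is one
      because \<open>k\<close> lies below the total order.\<close>
    have "k < Suc l + (\<Sum>a<length ls. Suc (ls ! a))"
      using assms unfolding psum_length by simp
    then have "(LEAST j. k < Suc l + (\<Sum>a<j. Suc (ls ! a)))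
        = Suc (LEAST j. k < Suc l + (\<Sum>a<Suc j. Suc (ls ! a)))"
      using False by (intro Least_Suc) auto
    also have "(\<lambda>j. k < Suc l + (\<Sum>a<Suc j. Suc (ls ! a))) = (\<lambda>j. k - Suc l < (\<Sum>a<Suc j. Suc (ls ! a)))"
      using False by (auto simp: fun_eq_iff)
    finally show ?thesis using False b by (simp add: blk_def)
  qed
qed

lemma phi_Nil: "phi [] t = (\<lambda>_. undefined)"
  by (simp add: phi_def fun_eq_iff)

lemma phi_Cons:
  "phi (l # ls) t k = (if k \<le> l then t 0 else phi ls (vshift t) (k - Suc l))"
  by (auto simp: phi_def blk_Cons vshift_def restrict_def)

text \<open>This equation and the next mirror the two ways in which a factor raises the order in
  \<open>ker\<close>: creation opens a new block of length one, the neutral operator prolongs the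
  first block. Either way one copy of \<open>t 0\<close> is prepended.\<close>

lemma phi_Cons_0: "phi (0 # ls) t = vcons (t 0) (phi ls (vshift t))"
  by (rule ext) (auto simp: phi_Cons vcons_def split: nat.splits)

lemma phi_Cons_Suc: "phi (Suc l # ls) t = vcons (t 0) (phi (l # ls) t)"
  by (rule ext) (auto simp: phi_Cons vcons_def split: nat.splits)

fun poly_wt :: "real measure \<Rightarrow> nat list \<Rightarrow> (nat \<Rightarrow> real \<times> real) \<Rightarrow> real" where
  "poly_wt \<nu> [] z = 1"
| "poly_wt \<nu> (l # ls) z = poly (mpoly \<nu> l) (snd (z 0)) * poly_wt \<nu> ls (vshift z)"

text \<open>Restricted, so that the result is a point of the product space over
  \<open>{..<m}\<close>.\<close>

definition tcoords :: "nat \<Rightarrow> (nat \<Rightarrow> real \<times> real) \<Rightarrow> nat \<Rightarrow> real" where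
  "tcoords m z = restrict (\<lambda>i. fst (z i)) {..<m}"

lemma tcoords_vcons: "tcoords (Suc m) (vcons (u, v) z) = vcons u (tcoords m z)"
  by (auto simp: tcoords_def vcons_def restrict_def fun_eq_iff split: nat.splits)

lemma tcoords_vshift: "tcoords m (vshift z) = vshift (tcoords (Suc m) z)"
  by (auto simp: tcoords_def vshift_def restrict_def fun_eq_iff)

lemma tcoords_0 [simp]: "tcoords (Suc m) z 0 = fst (z 0)"
  by (simp add: tcoords_def)

definition slice :: "((nat \<Rightarrow> real) \<Rightarrow> real) \<Rightarrow> real \<Rightarrow> (nat \<Rightarrow> real) \<Rightarrow> real" where
  "slice f u x = f (vcons u x)"

text \<open>Keeps radius and bound of a \<open>B0\<close> function explicit, so that one pair of
  constants can serve all slices simultaneously.\<close>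

definition bsupp :: "nat \<Rightarrow> real \<Rightarrow> real \<Rightarrow> ((nat \<Rightarrow> real) \<Rightarrow> real) \<Rightarrow> bool" where
  "bsupp n R C f \<longleftrightarrow> (\<forall>x. \<bar>f x\<bar> \<le> C) \<and> (\<forall>x. (\<exists>i<n. R < x i) \<longrightarrow> f x = 0)"

lemma bsuppD: "bsupp n R C f \<Longrightarrow> i < n \<Longrightarrow> R < x i \<Longrightarrow> f x = 0"
  by (auto simp: bsupp_def)

lemma bsupp_slice: "bsupp (Suc n) R C f \<Longrightarrow> bsupp n R C (slice f u)"
  by (auto simp: bsupp_def slice_def) (metis vcons_simps(2) Suc_mono)

text \<open>Vanishing is recorded as the bound 0, so that an estimate linear in the bound also
  yields vanishing.\<close>

lemma bsupp_slice_0: "bsupp (Suc n) R C f \<Longrightarrow> R < u \<Longrightarrow> bsupp n R 0 (slice f u)"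
  using bsuppD[of "Suc n" R C f 0 "vcons u _"] by (auto simp: bsupp_def[of n] slice_def)

lemma bsupp_nonneg: "bsupp n R C f \<Longrightarrow> 0 \<le> C"
  unfolding bsupp_def by (meson abs_ge_zero order_trans)

lemma S_set_Suc:
  "z \<in> S_set (Suc m) \<longleftrightarrow> 0 \<le> fst (z 0) \<and> vshift z \<in> S_set m \<and> (m \<noteq> 0 \<longrightarrow> fst (z 1) \<le> fst (z 0))"
proof
  assume z: "z \<in> S_set (Suc m)"
  then show "0 \<le> fst (z 0) \<and> vshift z \<in> S_set m \<and> (m \<noteq> 0 \<longrightarrow> fst (z 1) \<le> fst (z 0))"
    by (auto simp: S_set_def vshift_def)
next
  assume *: "0 \<le> fst (z 0) \<and> vshift z \<in> S_set m \<and> (m \<noteq> 0 \<longrightarrow> fst (z 1) \<le> fst (z 0))"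
  have "fst (z j) \<le> fst (z i)" if "i \<le> j" "j < Suc m" for i j
  proof (cases i)
    case 0
    show ?thesis
    proof (cases j)
      case (Suc j')
      then have "m \<noteq> 0" "fst (z (Suc j')) \<le> fst (z (Suc 0))"
        using * that by (auto simp: S_set_def vshift_def)
      then show ?thesis using * 0 Suc by auto
    qed (use 0 in simp)
  next
    case (Suc i')
    then show ?thesis using * that by (cases j) (auto simp: S_set_def vshift_def)
  qed
  moreover have "0 \<le> fst (z i)" if "i < Suc m" for i
    using * that by (cases i) (auto simp: S_set_def vshift_def)
  ultimately show "z \<in> S_set (Suc m)" by (auto simp: S_set_def)
qed

text \<open>A rectangular index set, because sums over it split off the first entry. The tuples of
  too large order that it contains have coefficient 0 by \<open>ker_big\<close>.\<close>

definition boxes :: "nat \<Rightarrow> nat \<Rightarrow> nat list set" where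
  "boxes B m = {ls. set ls \<subseteq> {..<B} \<and> length ls = m}"

lemma finite_boxes [simp]: "finite (boxes B m)"
  unfolding boxes_def by (rule finite_lists_length_eq) simp

lemma boxes_0 [simp]: "boxes B 0 = {[]}"
  by (auto simp: boxes_def)

lemma sum_boxes_Suc:
  "(\<Sum>ls\<in>boxes B (Suc m). g ls) = (\<Sum>l<B. \<Sum>ls\<in>boxes B m. g (l # ls))"
proof -
  have "boxes B (Suc m) = (\<lambda>(l, ls). l # ls) ` ({..<B} \<times> boxes B m)"
    by (force simp: boxes_def length_Suc_conv image_iff)
  moreover have "inj_on (\<lambda>(l, ls). l # ls) ({..<B} \<times> boxes B m)"
    by (auto simp: inj_on_def)
  ultimately show ?thesis
    by (simp add: sum.reindex sum.cartesian_product o_def case_prod_unfold)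
qed

context compact_prob
begin

text \<open>\<open>ker n ls f\<close> is the coefficient function of the kernel with index \<open>ls\<close> in the monomial of
  order \<open>n\<close>. The cases read off how one more factor acts: the first summand collects creation and the
  raising part of the neutral operator, the integral is annihilation, which only sees \<open>P\<^sub>0 = 1\<close> in the
  first particle. The lower limit \<open>max 0 _\<close> makes \<open>ker n ls f\<close> bounded off \<open>S_set\<close> as well, where
  functions in \<open>B0\<close> need not have bounded support.\<close>
primrec ker :: "nat \<Rightarrow> nat list \<Rightarrow> ((nat \<Rightarrow> real) \<Rightarrow> real) \<Rightarrow> (nat \<Rightarrow> real) \<Rightarrow> real" where
  "ker 0 ls f t = (if ls = [] then f (\<lambda>_. undefined) else 0)"
| "ker (Suc n) ls f t =
    (case ls of [] \<Rightarrow> 0 | l # ls' \<Rightarrow>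
       (if l = 0 then ker n ls' (slice f (t 0)) (vshift t) else ker n ((l - 1) # ls') (slice f (t 0)) t)
       + jacobi_b l * ker n ls (slice f (t 0)) t + jacobi_a (Suc l) * ker n (Suc l # ls') (slice f (t 0)) t)
    + (\<integral>u. indicator {max 0 (if ls = [] then 0 else t 0)..} u * ker n (0 # ls) (slice f u) (vcons u t) \<partial>lborel)"

text \<open>Every tuple consulted in the recursion has order at least \<open>wlen ls - 1\<close>:
  one factor raises the order by at most one.\<close>

lemma ker_big: "n < wlen ls \<Longrightarrow> ker n ls f t = 0"
proof (induction n arbitrary: ls f t)
  case (Suc n)
  then obtain l ls' where ls: "ls = l # ls'" by (cases ls) auto
  have "ker n (0 # ls) g s = 0" "ker n ls g s = 0" "ker n (Suc l # ls') g s = 0" for g s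
    using Suc.prems ls by (auto intro!: Suc.IH)
  moreover have "l = 0 \<Longrightarrow> ker n ls' g s = 0" "l \<noteq> 0 \<Longrightarrow> ker n ((l - 1) # ls') g s = 0" for g s
    using Suc.prems ls by (auto intro!: Suc.IH)
  ultimately show ?case using ls by auto
qed auto

text \<open>The diagonal, lowering and annihilation terms refer to tuples of order at least
  \<open>wlen ls\<close>, too large for the remaining \<open>n\<close> factors, so they vanish by
  \<open>ker_big\<close>. The first summand remains and consumes one coordinate exactly as
  \<open>phi\<close> does.\<close>

lemma ker_top: "wlen ls = n \<Longrightarrow> ker n ls f t = f (phi ls t)"
proof (induction n arbitrary: ls f t)
  case 0
  then show ?case by (cases ls) (auto simp: phi_Nil)
next
  case (Suc n)
  then obtain l ls' where ls: "ls = l # ls'" by (cases ls) auto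
  have z: "ker n (0 # ls) g s = 0" "ker n ls g s = 0" "ker n (Suc l # ls') g s = 0" for g s
    using Suc.prems ls by (auto intro!: ker_big)
  show ?case
  proof (cases l)
    case 0
    then have "ker n ls' (slice f (t 0)) (vshift t) = slice f (t 0) (phi ls' (vshift t))"
      using Suc.prems ls by (intro Suc.IH) auto
    then show ?thesis using z ls 0 by (auto simp: phi_Cons_0 slice_def)
  next
    case (Suc l')
    then have "ker n (l' # ls') (slice f (t 0)) t = slice f (t 0) (phi (l' # ls') t)"
      using Suc.prems ls by (intro Suc.IH) auto
    then show ?thesis using z ls Suc by (auto simp: phi_Cons_Suc slice_def)
  qed
qed

text \<open>The constant depends on \<open>n\<close>, \<open>ls\<close> and \<open>R\<close> but not
  on the function, hence is uniform over slices; linearity in \<open>C\<close> lets slices beyond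
  \<open>R\<close>, which have bound 0, produce zero coefficients.\<close>

lemma ker_bound:
  assumes "0 \<le> R"
  shows "\<exists>K\<ge>0. \<forall>C f. bsupp n R C f \<longrightarrow> bsupp (length ls) R (K * C) (ker n ls f)"
proof (induction n arbitrary: ls)
  case 0
  show ?case by (intro exI[of _ 1]) (auto simp: bsupp_def intro: order_trans[OF abs_ge_zero])
next
  case (Suc n)
  \<comment> \<open>The recursion consults five different tuples, so constants for all tuples are
    chosen at once.\<close>
  have "\<exists>K. \<forall>ls. 0 \<le> K ls \<and> (\<forall>C f. bsupp n R C f \<longrightarrow> bsupp (length ls) R (K ls * C) (ker n ls f))"
    by (rule choice) (use Suc.IH in blast)
  then obtain K where K0: "\<And>ls. 0 \<le> K ls"
    and K: "\<And>ls C f. bsupp n R C f \<Longrightarrow> bsupp (length ls) R (K ls * C) (ker n ls f)" by blast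
  define I where "I f t = (\<integral>u. indicator {max 0 (if ls = [] then 0 else t 0)..} u * ker n (0 # ls) (slice f u) (vcons u t) \<partial>lborel)" for f t
  have I: "bsupp (length ls) R (K (0 # ls) * R * C) (I f)" if f: "bsupp (Suc n) R C f" for C f
  proof -
    have k: "bsupp (Suc (length ls)) R (K (0 # ls) * C) (ker n (0 # ls) (slice f u))" for u
      using K[OF bsupp_slice[OF f], of "0 # ls"] by simp
    have "\<bar>I f t\<bar> \<le> K (0 # ls) * R * C" for t
    \<comment> \<open>A non-integrable integrand has integral 0 by convention, so the estimate can
      precede any measurability argument.\<close>
    proof (cases "integrable lborel (\<lambda>u. indicator {max 0 (if ls = [] then 0 else t 0)..} u * ker n (0 # ls) (slice f u) (vcons u t))")
      case True
      \<comment> \<open>Below 0 the lower limit cuts the integrand off, beyond \<open>R\<close> it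
        vanishes because \<open>u\<close> is the first time of the kernel; the factor
        \<open>R\<close> is the length of the interval left.\<close>
      have "\<bar>I f t\<bar> \<le> (\<integral>u. K (0 # ls) * C * indicator {0..R} u \<partial>lborel)"
        unfolding I_def
      proof (rule integral_abs_bound_integral[OF True])
        fix u :: real
        have "R < u \<Longrightarrow> ker n (0 # ls) (slice f u) (vcons u t) = 0"
          using bsuppD[OF k[of u], of 0 "vcons u t"] by simp
        moreover have "\<bar>ker n (0 # ls) (slice f u) (vcons u t)\<bar> \<le> K (0 # ls) * C"
          using k[of u] by (auto simp: bsupp_def)
        moreover have "0 \<le> K (0 # ls) * C" using K0 bsupp_nonneg[OF f] by simp
        ultimately show "\<bar>indicator {max 0 (if ls = [] then 0 else t 0)..} u * ker n (0 # ls) (slice f u) (vcons u t)\<bar>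
            \<le> K (0 # ls) * C * indicator {0..R} u"
          by (auto simp: indicator_def abs_mult not_le)
      qed (auto intro!: integrable_mult_right integrable_real_indicator simp: emeasure_lborel_Icc_eq)
      then show ?thesis using assms by (simp add: mult_ac)
    next
      case False
      then have "I f t = 0" unfolding I_def by (rule not_integrable_integral_eq)
      then show ?thesis using K0 assms bsupp_nonneg[OF f] by simp
    qed
    moreover have "I f t = 0" if t: "\<exists>i<length ls. R < t i" for t
    proof -
      have "ker n (0 # ls) (slice f u) (vcons u t) = 0" for u
        using t bsuppD[OF k[of u], of "Suc i" "vcons u t" for i] by auto
      then show ?thesis unfolding I_def by simp
    qed
    ultimately show ?thesis by (auto simp: bsupp_def)
  qed
  have zero: "bsupp n R 0 g \<Longrightarrow> ker n ls g s = 0" for ls g s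
    using K[of 0 g ls] by (auto simp: bsupp_def)
  show ?case
  proof (cases ls)
    case Nil
    then have "ker (Suc n) ls f = I f" for f by (simp add: fun_eq_iff I_def)
    then show ?thesis
      using I K0 assms by (intro exI[of _ "K (0 # ls) * R"]) auto
  next
    case (Cons l ls')
    define K' where "K' = K ls' + K ((l - 1) # ls') + \<bar>jacobi_b l\<bar> * K ls + \<bar>jacobi_a (Suc l)\<bar> * K (Suc l # ls') + K (0 # ls) * R"
    have "0 \<le> K'" using K0 assms by (simp add: K'_def)
    moreover have "bsupp (length ls) R (K' * C) (ker (Suc n) ls f)" if f: "bsupp (Suc n) R C f" for C f
    proof -
      have C: "0 \<le> C" using bsupp_nonneg[OF f] .
      have b: "\<bar>ker n ls (slice f u) t\<bar> \<le> K ls * C" for ls u t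
        using K[OF bsupp_slice[OF f], of ls] by (auto simp: bsupp_def)
      have s: "ker n ls (slice f u) t = 0" if "\<exists>i<length ls. R < t i" for ls u t
        using K[OF bsupp_slice[OF f], of ls] that by (auto simp: bsupp_def)
      have z: "ker n ls (slice f u) t = 0" if "R < u" for ls u t
        using zero bsupp_slice_0[OF f that] by blast
      have e: "ker (Suc n) ls f t =
         (if l = 0 then ker n ls' (slice f (t 0)) (vshift t) else ker n ((l - 1) # ls') (slice f (t 0)) t)
         + jacobi_b l * ker n ls (slice f (t 0)) t + jacobi_a (Suc l) * ker n (Suc l # ls') (slice f (t 0)) t + I f t" for t
        using Cons by (simp add: I_def)
      have "\<bar>ker (Suc n) ls f t\<bar> \<le> K' * C" for t
      proof -
        have "\<bar>if l = 0 then ker n ls' (slice f (t 0)) (vshift t) else ker n ((l - 1) # ls') (slice f (t 0)) t\<bar>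
           \<le> K ls' * C + K ((l - 1) # ls') * C"
          using b[of ls'] b[of "(l - 1) # ls'"] K0[of ls'] K0[of "(l - 1) # ls'"] C
          by (auto intro: order_trans[OF b] )
        moreover have "\<bar>jacobi_b l * ker n ls (slice f (t 0)) t\<bar> \<le> \<bar>jacobi_b l\<bar> * (K ls * C)"
          unfolding abs_mult by (intro mult_left_mono b) auto
        moreover have "\<bar>jacobi_a (Suc l) * ker n (Suc l # ls') (slice f (t 0)) t\<bar> \<le> \<bar>jacobi_a (Suc l)\<bar> * (K (Suc l # ls') * C)"
          unfolding abs_mult by (intro mult_left_mono b) auto
        moreover have "\<bar>I f t\<bar> \<le> K (0 # ls) * R * C" using I[OF f] by (auto simp: bsupp_def)
        ultimately have "\<bar>ker (Suc n) ls f t\<bar> \<le> (K ls' * C + K ((l - 1) # ls') * C)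
            + \<bar>jacobi_b l\<bar> * (K ls * C) + \<bar>jacobi_a (Suc l)\<bar> * (K (Suc l # ls') * C) + K (0 # ls) * R * C"
          unfolding e by (intro order_trans[OF abs_triangle_ineq] add_mono)
        then show ?thesis by (simp add: K'_def algebra_simps)
      qed
      moreover have "ker (Suc n) ls f t = 0" if ex: "\<exists>i<length ls. R < t i" for t
      \<comment> \<open>A large first time annihilates the slices themselves; a large later time is
        inherited by every tuple consulted, with shifted index after creation.\<close>
      proof (cases "R < t 0")
        case True
        then have "\<exists>i<length ls. R < t i" using Cons by auto
        then have "I f t = 0" using I[OF f] by (auto simp: bsupp_def)
        then show ?thesis unfolding e using z[OF True] by simp
      next
        case False
        obtain j where j: "j < length ls" "R < t j" using ex by blast
        with False obtain i where "j = Suc i" by (cases j) auto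
        with j have i: "Suc i < length ls" "R < t (Suc i)" by auto
        then have "\<exists>i<length ls'. R < vshift t i" "\<exists>i<length (a # ls'). R < t i" for a
          using Cons by (auto simp: vshift_def)
        then have "ker n ls' (slice f (t 0)) (vshift t) = 0" "\<And>a. ker n (a # ls') (slice f (t 0)) t = 0"
          using s by blast+
        moreover have "I f t = 0" using I[OF f] that by (auto simp: bsupp_def)
        ultimately show ?thesis unfolding e by (simp add: Cons)
      qed
      ultimately show ?thesis by (auto simp: bsupp_def)
    qed
    ultimately show ?thesis by blast
  qed
qed

end

section \<open>Expansion of monomials in kernels\<close>

context compact_prob
begin

abbreviation "Rn n \<equiv> PiM {..<n::nat} (\<lambda>_. lborel :: real measure)"
abbreviation "Rseq \<equiv> PiM (UNIV :: nat set) (\<lambda>_. lborel :: real measure)"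

text \<open>The recursion of \<open>ker\<close> slices the test function at a point that is integrated or substituted
  later, so joint measurability in a parameter is needed; parameter sequences absorb the new variables.\<close>
lemma ker_measurable:
  assumes "case_prod F \<in> borel_measurable (Rseq \<Otimes>\<^sub>M Rn n)"
  shows "(\<lambda>(x, t). ker n ls (F x) t) \<in> borel_measurable (Rseq \<Otimes>\<^sub>M Rn (length ls))"
  using assms
proof (induction n arbitrary: ls F)
  case 0
  have "(\<lambda>p. (fst p, \<lambda>_. undefined)) \<in> measurable (Rseq \<Otimes>\<^sub>M Rn (length ls)) (Rseq \<Otimes>\<^sub>M Rn 0)"
    by (intro measurable_Pair measurable_const measurable_fst) (auto simp: space_PiM)
  from measurable_compose[OF this 0] show ?case
    by (cases ls) (auto simp: case_prod_unfold)
next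
  case (Suc n)
  \<comment> \<open>The head of \<open>y\<close> is the slicing point and its tail the old
    parameter; this is again a jointly measurable family, to which the induction hypothesis
    applies.\<close>
  define F' where "F' y = slice (F (vshift y)) (y 0)" for y
  have F'm: "case_prod F' \<in> borel_measurable (Rseq \<Otimes>\<^sub>M Rn n)"
  proof -
    have "(\<lambda>p. (vshift (fst p), vcons (fst p 0) (snd p))) \<in> measurable (Rseq \<Otimes>\<^sub>M Rn n) (Rseq \<Otimes>\<^sub>M Rn (Suc n))"
      by (intro measurable_Pair vshift_measurable_UNIV vcons_measurable measurable_PiM_nth[of fst _ UNIV]) auto
    from measurable_compose[OF this Suc.prems] show ?thesis
      by (simp add: F'_def slice_def case_prod_unfold)
  qed
  have F': "slice (F x) u = F' (vcons u x)" for x u by (simp add: F'_def)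
  have K: "(\<lambda>w. ker n ks (F' (fst w)) (snd w)) \<in> borel_measurable (Rseq \<Otimes>\<^sub>M Rn (length ks))" for ks
    using Suc.IH[OF F'm, of ks] by (simp add: case_prod_unfold)
  have K1: "(\<lambda>w. ker n ks (F' (g w)) (h w)) \<in> borel_measurable N"
    if "g \<in> measurable N Rseq" "h \<in> measurable N (Rn (length ks))" for g h ks and N :: "'b measure"
    using measurable_compose[OF measurable_Pair[OF that] K] by simp
  have nth0: "(\<lambda>w. snd w 0) \<in> measurable (Rseq \<Otimes>\<^sub>M Rn (Suc m)) lborel" for m
    by (rule measurable_PiM_nth[OF measurable_snd]) auto
  have int: "(\<lambda>w. \<integral>u. indicator {max 0 (if ls = [] then 0 else snd w 0)..} u
        * ker n (0 # ls) (F' (vcons u (fst w))) (vcons u (snd w)) \<partial>lborel)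
      \<in> borel_measurable (Rseq \<Otimes>\<^sub>M Rn (length ls))"
  proof (rule lborel.borel_measurable_lebesgue_integral)
    have k: "(\<lambda>w. ker n (0 # ls) (F' (vcons (snd w) (fst (fst w)))) (vcons (snd w) (snd (fst w))))
      \<in> borel_measurable ((Rseq \<Otimes>\<^sub>M Rn (length ls)) \<Otimes>\<^sub>M lborel)"
      unfolding list.size by (intro K1) (auto intro!: vcons_measurable vcons_measurable_UNIV)
    have "(\<lambda>w. if ls = [] then 0 else snd (fst w) 0)
      \<in> borel_measurable ((Rseq \<Otimes>\<^sub>M Rn (length ls)) \<Otimes>\<^sub>M lborel)"
    proof (cases ls)
      case (Cons a as)
      then show ?thesis using measurable_compose[OF measurable_fst nth0[of "length as"]] by simp
    qed simp
    then have [measurable]: "(\<lambda>w. max 0 (if ls = [] then 0 else snd (fst w) 0))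
      \<in> borel_measurable ((Rseq \<Otimes>\<^sub>M Rn (length ls)) \<Otimes>\<^sub>M lborel)"
      by (intro borel_measurable_max) auto
    have "(\<lambda>w. if max 0 (if ls = [] then 0 else snd (fst w) 0) \<le> snd w then 1 else 0 :: real)
      \<in> borel_measurable ((Rseq \<Otimes>\<^sub>M Rn (length ls)) \<Otimes>\<^sub>M lborel)"
      by measurable
    from borel_measurable_times[OF this k]
    show "(\<lambda>(w, u). indicator {max 0 (if ls = [] then 0 else snd w 0)..} u
        * ker n (0 # ls) (F' (vcons u (fst w))) (vcons u (snd w)))
      \<in> borel_measurable ((Rseq \<Otimes>\<^sub>M Rn (length ls)) \<Otimes>\<^sub>M lborel)"
      unfolding case_prod_unfold indicator_def atLeast_iff of_bool_def .
  qed
  show ?case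
  proof (cases ls)
    case Nil
    then show ?thesis using int by (simp add: case_prod_unfold F')
  next
    case (Cons l ls')
    have c: "(\<lambda>w. vcons (snd w 0) (fst w)) \<in> measurable (Rseq \<Otimes>\<^sub>M Rn (Suc m)) Rseq" for m
      by (intro vcons_measurable_UNIV nth0 measurable_fst)
    have d: "(\<lambda>w. vshift (snd w)) \<in> measurable (Rseq \<Otimes>\<^sub>M Rn (Suc m)) (Rn m)" for m
      by (intro vshift_measurable measurable_snd)
    have "(\<lambda>w. ker n ls' (F' (vcons (snd w 0) (fst w))) (vshift (snd w)))
        \<in> borel_measurable (Rseq \<Otimes>\<^sub>M Rn (Suc (length ls')))"
      by (intro K1 c d)
    moreover have "(\<lambda>w. ker n (a # ls') (F' (vcons (snd w 0) (fst w))) (snd w))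
        \<in> borel_measurable (Rseq \<Otimes>\<^sub>M Rn (Suc (length ls')))" for a
      by (intro K1 c) simp
    ultimately show ?thesis using int
      unfolding Cons ker.simps case_prod_unfold F'
      by (cases "l = 0") (simp_all add: borel_measurable_add borel_measurable_times)
  qed
qed

lemma ker_measurable1:
  assumes "f \<in> borel_measurable (Rn n)"
  shows "ker n ls f \<in> borel_measurable (Rn (length ls))"
proof -
  have m1: "(\<lambda>(x, t). ker n ls f t) \<in> borel_measurable (Rseq \<Otimes>\<^sub>M Rn (length ls))"
    by (rule ker_measurable) (use measurable_compose[OF measurable_snd assms] in \<open>simp add: case_prod_unfold\<close>)
  have m2: "(\<lambda>t. (\<lambda>_. 0, t)) \<in> measurable (Rn (length ls)) (Rseq \<Otimes>\<^sub>M Rn (length ls))"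
    by (intro measurable_Pair measurable_const) (auto simp: space_PiM)
  from measurable_compose[OF m2 m1] show ?thesis unfolding case_prod_conv .
qed

lemma slice_measurable:
  assumes "f \<in> borel_measurable (Rn (Suc n))"
  shows "(\<lambda>w. slice f (fst w) (snd w)) \<in> borel_measurable (lborel \<Otimes>\<^sub>M Rn n)"
  unfolding slice_def
  by (rule measurable_compose[OF vcons_measurable assms]) auto

lemma B0_bsupp:
  assumes "f \<in> B0 n" obtains R C where "0 \<le> R" "bsupp n R C f"
proof -
  obtain C R where *: "\<And>x. \<bar>f x\<bar> \<le> C" "\<And>x. (\<exists>i<n. R < x i) \<Longrightarrow> f x = 0"
    using assms unfolding B0_def by blast
  have "bsupp n (max 0 R) C f" using * by (auto simp: bsupp_def)
  then show ?thesis using that by (metis max.cobounded1)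
qed

lemma B0_iff: "f \<in> B0 n \<longleftrightarrow> f \<in> borel_measurable (Rn n) \<and> (\<exists>R C. 0 \<le> R \<and> bsupp n R C f)"
proof
  assume f: "f \<in> B0 n"
  obtain R C where "0 \<le> R" "bsupp n R C f" using B0_bsupp[OF f] .
  moreover have "f \<in> borel_measurable (Rn n)" using f by (simp add: B0_def)
  ultimately show "f \<in> borel_measurable (Rn n) \<and> (\<exists>R C. 0 \<le> R \<and> bsupp n R C f)" by blast
next
  assume "f \<in> borel_measurable (Rn n) \<and> (\<exists>R C. 0 \<le> R \<and> bsupp n R C f)"
  then show "f \<in> B0 n" unfolding B0_def bsupp_def by blast
qed

lemma B0_slice: assumes "f \<in> B0 (Suc n)" shows "slice f u \<in> B0 n"
proof -
  have "(\<lambda>x. (u, x)) \<in> measurable (Rn n) (lborel \<Otimes>\<^sub>M Rn n)" by simp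
  then have "slice f u \<in> borel_measurable (Rn n)"
    using measurable_compose[OF _ slice_measurable[of f n], of "\<lambda>x. (u, x)"] assms
    by (simp add: B0_def)
  then show ?thesis using assms bsupp_slice unfolding B0_iff by blast
qed

lemma B0_ker: assumes "f \<in> B0 n" shows "ker n ls f \<in> B0 (length ls)"
proof -
  obtain R C where R: "0 \<le> R" and C: "bsupp n R C f" using B0_bsupp[OF assms] .
  have "\<exists>C. bsupp (length ls) R C (ker n ls f)" using ker_bound[OF R, of n ls] C by blast
  moreover have "ker n ls f \<in> borel_measurable (Rn (length ls))"
    using assms by (intro ker_measurable1) (simp add: B0_def)
  ultimately show ?thesis using R unfolding B0_iff by blast
qed

text \<open>The variable \<open>u\<close> occurs both in the slice and in the argument, so
  measurability comes from the parametric version with \<open>u\<close> stored at the head of the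
  parameter sequence. The dominating function on \<open>[0, R]\<close> uses the uniform constant of
  \<open>ker_bound\<close>.\<close>

lemma integrable_ker:
  assumes f: "f \<in> B0 (Suc n)" and a: "0 \<le> a"
  shows "integrable lborel (\<lambda>u. indicator {a..} u * ker n (0 # ls) (slice f u) (vcons u (tcoords (length ls) z)))"
proof -
  obtain R C where R: "0 \<le> R" and C: "bsupp (Suc n) R C f" using B0_bsupp[OF f] .
  obtain K where K: "\<And>C f. bsupp n R C f \<Longrightarrow> bsupp (Suc (length ls)) R (K * C) (ker n (0 # ls) f)"
    using ker_bound[OF R, of n "0 # ls"] unfolding list.size by auto
  have k: "bsupp (Suc (length ls)) R (K * C) (ker n (0 # ls) (slice f u))" for u
    using K[OF bsupp_slice[OF C]] .
  have fm: "f \<in> borel_measurable (Rn (Suc n))" using f by (simp add: B0_def)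
  have m1: "(\<lambda>(x, t). ker n (0 # ls) (slice f (x 0)) t) \<in> borel_measurable (Rseq \<Otimes>\<^sub>M Rn (length (0 # ls)))"
  proof (rule ker_measurable)
    have "(\<lambda>w. (fst w 0, snd w)) \<in> measurable (Rseq \<Otimes>\<^sub>M Rn n) (lborel \<Otimes>\<^sub>M Rn n)"
      by (intro measurable_Pair measurable_PiM_nth[of fst _ UNIV]) auto
    from measurable_compose[OF this slice_measurable[OF fm]]
    show "(\<lambda>(x, t). slice f (x 0) t) \<in> borel_measurable (Rseq \<Otimes>\<^sub>M Rn n)" by (simp add: case_prod_unfold)
  qed
  have m2: "(\<lambda>u. (vcons u (\<lambda>_. 0), vcons u (tcoords (length ls) z)))
      \<in> measurable lborel (Rseq \<Otimes>\<^sub>M Rn (length (0 # ls)))"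
    unfolding list.size
    by (intro measurable_Pair vcons_measurable_UNIV vcons_measurable)
       (auto simp: space_PiM tcoords_def)
  have m: "(\<lambda>u. ker n (0 # ls) (slice f u) (vcons u (tcoords (length ls) z))) \<in> borel_measurable lborel"
    using measurable_compose[OF m2 m1] by simp
  show ?thesis
  proof (rule Bochner_Integration.integrable_bound[where f = "\<lambda>u. K * C * indicator {0..R} u"])
    show "integrable lborel (\<lambda>u. K * C * indicator {0..R} u :: real)"
      by (auto intro!: integrable_mult_right integrable_real_indicator simp: emeasure_lborel_Icc_eq)
    show "(\<lambda>u. indicator {a..} u * ker n (0 # ls) (slice f u) (vcons u (tcoords (length ls) z))) \<in> borel_measurable lborel"
      by (intro borel_measurable_times m) simp
    show "AE u in lborel. norm (indicator {a..} u * ker n (0 # ls) (slice f u) (vcons u (tcoords (length ls) z)))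
        \<le> norm (K * C * indicator {0..R} u)"
    proof (rule AE_I2)
      fix u :: real
      have "R < u \<Longrightarrow> ker n (0 # ls) (slice f u) (vcons u (tcoords (length ls) z)) = 0"
        using bsuppD[OF k[of u], of 0 "vcons u (tcoords (length ls) z)"] by simp
      moreover have "\<bar>ker n (0 # ls) (slice f u) (vcons u (tcoords (length ls) z))\<bar> \<le> K * C"
        using k[of u] by (auto simp: bsupp_def)
      ultimately show "norm (indicator {a..} u * ker n (0 # ls) (slice f u) (vcons u (tcoords (length ls) z)))
        \<le> norm (K * C * indicator {0..R} u)"
        using a by (auto simp: indicator_def not_le)
    qed
  qed
qed

lemma S_set_vcons:
  assumes "z \<in> S_set m" "(if m = 0 then 0 else fst (z 0)) \<le> u"
  shows "vcons (u, v) z \<in> S_set (Suc m)"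
proof -
  have "m \<noteq> 0 \<Longrightarrow> 0 \<le> fst (z 0)" using assms(1) by (auto simp: S_set_def)
  then have "0 \<le> u" using assms(2) by (auto split: if_splits)
  then show ?thesis using assms unfolding S_set_Suc by auto
qed

text \<open>Integrating out \<open>v\<close> kills every \<open>P l\<close> with
  \<open>l > 0\<close>, since \<open>P l\<close> is orthogonal to \<open>P 0 = 1\<close>; only
  tuples with first entry 0 survive, and \<open>0 < B\<close> ensures that they occur in the
  box.\<close>

lemma annihilation_expand:
  assumes f: "f \<in> B0 (Suc n)" and z: "z \<in> S_set m" and B: "0 < B"
    and IH: "\<And>u z. z \<in> S_set (Suc m) \<Longrightarrow>
      mono \<nu> n (slice f u) vacuum (Suc m) z
        = (\<Sum>ls\<in>boxes B (Suc m). poly_wt \<nu> ls z * ker n ls (slice f u) (tcoords (Suc m) z))"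
  defines "a \<equiv> if m = 0 then 0 else fst (z 0)"
  shows "(\<integral>u. indicator {a..} u * (\<integral>v. mono \<nu> n (slice f u) vacuum (Suc m) (vcons (u, v) z) \<partial>\<nu>) \<partial>lborel)
      = (\<Sum>ls\<in>boxes B m. poly_wt \<nu> ls z *
          (\<integral>u. indicator {a..} u * ker n (0 # ls) (slice f u) (vcons u (tcoords m z)) \<partial>lborel))"
proof -
  have a: "0 \<le> a" using z by (auto simp: a_def S_set_def)
  have "indicator {a..} u * (\<integral>v. mono \<nu> n (slice f u) vacuum (Suc m) (vcons (u, v) z) \<partial>\<nu>)
      = (\<Sum>ls\<in>boxes B m. poly_wt \<nu> ls z * (indicator {a..} u * ker n (0 # ls) (slice f u) (vcons u (tcoords m z))))" for u
  proof (cases "a \<le> u")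
    case True
    have "(\<integral>v. mono \<nu> n (slice f u) vacuum (Suc m) (vcons (u, v) z) \<partial>\<nu>)
      = (\<integral>v. (\<Sum>l<B. \<Sum>ls\<in>boxes B m. poly (P l) v *
           (poly_wt \<nu> ls z * ker n (l # ls) (slice f u) (vcons u (tcoords m z)))) \<partial>\<nu>)"
    proof (intro Bochner_Integration.integral_cong refl)
      fix v
      have "vcons (u, v) z \<in> S_set (Suc m)"
        using S_set_vcons[OF z] True by (simp add: a_def)
      then show "mono \<nu> n (slice f u) vacuum (Suc m) (vcons (u, v) z)
        = (\<Sum>l<B. \<Sum>ls\<in>boxes B m. poly (P l) v *
           (poly_wt \<nu> ls z * ker n (l # ls) (slice f u) (vcons u (tcoords m z))))"
        by (simp add: IH sum_boxes_Suc tcoords_vcons mult_ac)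
    qed
    also have "\<dots> = (\<Sum>l<B. \<Sum>ls\<in>boxes B m. L (P l) *
           (poly_wt \<nu> ls z * ker n (l # ls) (slice f u) (vcons u (tcoords m z))))"
      by (simp add: Bochner_Integration.integral_sum integrable_poly L_def)
    also have "\<dots> = (\<Sum>l<B. if l = 0 then (\<Sum>ls\<in>boxes B m.
           (poly_wt \<nu> ls z * ker n (0 # ls) (slice f u) (vcons u (tcoords m z)))) else 0)"
      by (intro sum.cong refl) (auto simp: L_P)
    also have "\<dots> = (\<Sum>ls\<in>boxes B m. poly_wt \<nu> ls z * ker n (0 # ls) (slice f u) (vcons u (tcoords m z)))"
      using B by simp
    finally show ?thesis using True by simp
  next
    case False
    then show ?thesis by simp
  qed
  moreover have "integrable lborel (\<lambda>u. indicator {a..} u * ker n (0 # ls) (slice f u) (vcons u (tcoords m z)))"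
    if "ls \<in> boxes B m" for ls
    using integrable_ker[OF f a, of ls z] that by (simp add: boxes_def)
  ultimately show ?thesis
    by (simp add: Bochner_Integration.integral_sum)
qed

text \<open>The box size \<open>B\<close> is fixed throughout the induction. It exceeds the number
  of factors, so raising never leaves the box with a nonzero coefficient.\<close>

lemma mono_expand:
  assumes "f \<in> B0 n" "z \<in> S_set m" "n < B"
  shows "mono \<nu> n f vacuum m z = (\<Sum>ls\<in>boxes B m. poly_wt \<nu> ls z * ker n ls f (tcoords m z))"
  using assms
proof (induction n arbitrary: f m z)
  case 0
  show ?case
  proof (cases m)
    case (Suc k)
    have "(\<Sum>ls\<in>boxes B m. poly_wt \<nu> ls z * ker 0 ls f (tcoords m z)) = 0"
      using Suc by (intro sum.neutral) (auto simp: boxes_def)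
    with Suc show ?thesis by (simp add: vacuum_def)
  qed (simp add: vacuum_def)
next
  case (Suc n)
  have sl: "(\<lambda>x. f (vcons u x)) = slice f u" for u by (simp add: slice_def fun_eq_iff)
  have IH: "mono \<nu> n (slice f u) vacuum m z = (\<Sum>ls\<in>boxes B m. poly_wt \<nu> ls z * ker n ls (slice f u) (tcoords m z))"
    if "z \<in> S_set m" for u m z
    using Suc.IH[OF B0_slice[OF Suc.prems(1)] that] Suc.prems(3) by simp
  let ?A = "\<lambda>a ls t. \<integral>u. indicator {a..} u * ker n (0 # ls) (slice f u) (vcons u t) \<partial>lborel"
  have ann: "(\<integral>u. indicator {(if m = 0 then 0 else fst (z 0))..} u * (\<integral>v. mono \<nu> n (slice f u) vacuum (Suc m) (vcons (u, v) z) \<partial>\<nu>) \<partial>lborel)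
      = (\<Sum>ls\<in>boxes B m. poly_wt \<nu> ls z * ?A (if m = 0 then 0 else fst (z 0)) ls (tcoords m z))"
    by (rule annihilation_expand[OF Suc.prems(1,2) _ IH]) (use Suc.prems(3) in auto)
  show ?case
  proof (cases m)
    case 0
    then show ?thesis using ann by (simp add: Xop_def sl)
  next
    case (Suc k)
    define t where "t = tcoords m z"
    have t0: "t 0 = fst (z 0)" "vshift t = tcoords k (vshift z)"
      by (simp_all add: t_def Suc tcoords_vshift)
    have zz: "vshift z \<in> S_set k" "0 \<le> fst (z 0)"
      using Suc.prems(2) unfolding Suc S_set_Suc by auto
    define s where "s = snd (z 0)"
    define g where "g l ls = ker n (l # ls) (slice f (t 0)) t" for l ls
    have g0: "g l ls = 0" if "n < Suc l" for l ls
      unfolding g_def using that by (intro ker_big) auto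
    \<comment> \<open>Multiplication by \<open>s\<close> acts on the \<open>P l\<close> as a Jacobi
      matrix; reindexing the sums moves the transposed matrix onto the coefficients, which gives the
      raising, diagonal and lowering terms of \<open>ker\<close>.\<close>
    have key: "s * (\<Sum>l<B. poly (P l) s * g l ls)
      = (\<Sum>l<B. poly (P l) s * ((if l = 0 then 0 else g (l - 1) ls) + jacobi_b l * g l ls + jacobi_a (Suc l) * g (Suc l) ls))"
      for ls
    proof -
      \<comment> \<open>Both boundary terms of the reindexing vanish by order: \<open>g B'\<close>
        on the raising side and \<open>g (Suc B')\<close> on the lowering side.\<close>
      obtain B' where B': "B = Suc B'" "n < Suc B'" "n \<le> B'" using \<open>Suc n < B\<close> by (cases B) auto
      have "s * (\<Sum>l<B. poly (P l) s * g l ls) = (\<Sum>l<B. poly (P (Suc l)) s * g l ls)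
          + (\<Sum>l<B. poly (P l) s * (jacobi_b l * g l ls))
          + (\<Sum>l<B. (if l = 0 then 0 else jacobi_a l * poly (P (l - 1)) s) * g l ls)"
        unfolding sum_distrib_left sum.distrib[symmetric]
        by (intro sum.cong refl) (simp only: mult.assoc[symmetric] poly_P_rec, simp only: algebra_simps)
      also have "(\<Sum>l<B. poly (P (Suc l)) s * g l ls) = (\<Sum>l<B. poly (P l) s * (if l = 0 then 0 else g (l - 1) ls))"
      proof -
        have "(\<Sum>l<B. poly (P (Suc l)) s * g l ls) = (\<Sum>l<B'. poly (P (Suc l)) s * g l ls)"
          unfolding B'(1) using g0[OF B'(2)] by simp
        also have "\<dots> = (\<Sum>l<B. poly (P l) s * (if l = 0 then 0 else g (l - 1) ls))"
          unfolding B'(1) by (subst sum.lessThan_Suc_shift) simp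
        finally show ?thesis .
      qed
      also have "(\<Sum>l<B. (if l = 0 then 0 else jacobi_a l * poly (P (l - 1)) s) * g l ls)
          = (\<Sum>l<B. poly (P l) s * (jacobi_a (Suc l) * g (Suc l) ls))"
      proof -
        have "g (Suc B') ls = 0" using B' by (intro g0) auto
        then show ?thesis
          unfolding B'(1) by (subst sum.lessThan_Suc_shift) (simp add: mult_ac)
      qed
      finally show ?thesis by (simp add: sum.distrib algebra_simps)
    qed
    have "mono \<nu> (Suc n) f vacuum m z = mono \<nu> n (slice f (t 0)) vacuum k (vshift z)
       + s * mono \<nu> n (slice f (t 0)) vacuum m z + (\<Sum>ls\<in>boxes B m. poly_wt \<nu> ls z * ?A (t 0) ls t)"
      using ann unfolding t0 s_def t_def by (simp add: Xop_def sl Suc)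
    \<comment> \<open>The created particle carries the constant \<open>P 0 = 1\<close>; written as a
      sum over all \<open>l\<close> it has the same format as the other parts.\<close>
    also have "mono \<nu> n (slice f (t 0)) vacuum k (vshift z)
        = (\<Sum>ls\<in>boxes B k. \<Sum>l<B. poly_wt \<nu> ls (vshift z) * (poly (P l) s * (if l = 0 then ker n ls (slice f (t 0)) (vshift t) else 0)))"
    proof -
      have "(\<Sum>l<B. poly (P l) s * (if l = 0 then x else 0)) = x" for x
      proof -
        have "(\<Sum>l<B. poly (P l) s * (if l = 0 then x else 0)) = (\<Sum>l<B. if l = 0 then x else 0)"
          by (intro sum.cong refl) auto
        then show ?thesis using \<open>Suc n < B\<close> by simp
      qed
      then show ?thesis by (simp add: IH[OF zz(1)] t0 flip: sum_distrib_left)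
    qed
    also have "s * mono \<nu> n (slice f (t 0)) vacuum m z
        = (\<Sum>ls\<in>boxes B k. poly_wt \<nu> ls (vshift z) * (s * (\<Sum>l<B. poly (P l) s * g l ls)))"
    proof -
      have "mono \<nu> n (slice f (t 0)) vacuum m z
         = (\<Sum>ls\<in>boxes B k. \<Sum>l<B. poly_wt \<nu> ls (vshift z) * (poly (P l) s * g l ls))"
      proof -
        have "mono \<nu> n (slice f (t 0)) vacuum m z = (\<Sum>ls\<in>boxes B m. poly_wt \<nu> ls z * ker n ls (slice f (t 0)) t)"
          unfolding t_def by (rule IH[OF Suc.prems(2)])
        also have "\<dots> = (\<Sum>ls\<in>boxes B k. \<Sum>l<B. poly_wt \<nu> ls (vshift z) * (poly (P l) s * g l ls))"
          unfolding Suc sum_boxes_Suc by (subst sum.swap) (simp add: g_def s_def mult_ac)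
        finally show ?thesis .
      qed
      then show ?thesis
        by (simp add: sum_distrib_left mult.left_commute)
    qed
    also have "(\<Sum>ls\<in>boxes B m. poly_wt \<nu> ls z * ?A (t 0) ls t)
        = (\<Sum>ls\<in>boxes B k. \<Sum>l<B. poly_wt \<nu> ls (vshift z) * (poly (P l) s * ?A (t 0) (l # ls) t))"
      unfolding Suc sum_boxes_Suc by (subst sum.swap) (simp add: s_def mult_ac)
    finally have "mono \<nu> (Suc n) f vacuum m z = (\<Sum>ls\<in>boxes B k. \<Sum>l<B. poly_wt \<nu> ls (vshift z) * (poly (P l) s *
        ((if l = 0 then ker n ls (slice f (t 0)) (vshift t) else 0)
        + ((if l = 0 then 0 else g (l - 1) ls) + jacobi_b l * g l ls + jacobi_a (Suc l) * g (Suc l) ls)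
        + ?A (t 0) (l # ls) t)))"
      unfolding key by (simp add: sum.distrib distrib_left sum_distrib_left)
    \<comment> \<open>On \<open>S_set\<close> the first time is nonnegative, so the limit
      \<open>max 0 (t 0)\<close> in \<open>ker\<close> coincides with the limit \<open>t 0\<close>
      of the annihilation operator.\<close>
    also have "\<dots> = (\<Sum>ls\<in>boxes B k. \<Sum>l<B. poly_wt \<nu> (l # ls) z * ker (Suc n) (l # ls) f t)"
      using zz(2) t0(1) by (intro sum.cong refl) (auto simp: g_def s_def mult_ac max_def)
    also have "\<dots> = (\<Sum>ls\<in>boxes B m. poly_wt \<nu> ls z * ker (Suc n) ls f t)"
      unfolding Suc sum_boxes_Suc by (rule sum.swap)
    finally show ?thesis by (simp add: t_def)
  qed
qed

end

section \<open>Inner products on the Fock space\<close>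

definition level_inner :: "real measure \<Rightarrow> nat \<Rightarrow> fock \<Rightarrow> fock \<Rightarrow> real" where
  "level_inner \<nu> m \<psi> \<phi> = (\<integral>z. indicator (S_set m) z * \<psi> m z * \<phi> m z \<partial>fock_measure \<nu> m)"

lemma fock_inner_lev: "fock_inner \<nu> \<psi> \<phi> = (\<Sum>m. level_inner \<nu> m \<psi> \<phi>)"
  by (simp add: fock_inner_def level_inner_def)

context compact_prob
begin

lemma pair_sf: "sigma_finite_measure (lborel \<Otimes>\<^sub>M \<nu> :: (real \<times> real) measure)"
proof -
  interpret pair_sigma_finite "lborel :: real measure" \<nu> by unfold_locales
  show ?thesis by unfold_locales
qed

lemma psf_Rn: "product_sigma_finite (\<lambda>_. lborel :: real measure)"
  by unfold_locales

lemma psf_nu: "product_sigma_finite (\<lambda>_. \<nu>)"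
  by unfold_locales

lemma psf_fock: "product_sigma_finite (\<lambda>_. lborel \<Otimes>\<^sub>M \<nu> :: (real \<times> real) measure)"
  using pair_sf by (simp add: product_sigma_finite_def)

lemma Rn_nth [measurable]: "(\<lambda>t. t i) \<in> borel_measurable (Rn n)"
proof (cases "i < n")
  case True
  then show ?thesis
    using measurable_component_singleton[of i "{..<n}" "\<lambda>_. lborel"] by simp
next
  case False
  have "t i = undefined" if "t \<in> space (Rn n)" for t
    using that False by (auto simp: space_PiM PiE_def extensional_def)
  then show ?thesis by (subst measurable_cong[where g = "\<lambda>_. undefined"]) auto
qed

lemma fock_nth [measurable]: "i < m \<Longrightarrow> (\<lambda>z. z i) \<in> measurable (fock_measure \<nu> m) (lborel \<Otimes>\<^sub>M \<nu>)"
  unfolding fock_measure_def by (rule measurable_component_singleton) simp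

lemma tcoords_measurable [measurable]: "tcoords m \<in> measurable (fock_measure \<nu> m) (Rn m)"
  unfolding tcoords_def
  by (rule measurable_restrict) (use fock_nth[THEN measurable_compose[OF _ measurable_fst]] in auto)

lemma T_set_measurable [measurable]: "(\<lambda>t. indicator (T_set m) t :: real) \<in> borel_measurable (Rn m)"
proof -
  have "Measurable.pred (Rn m) (\<lambda>t. (\<forall>i\<in>{..<m}. 0 \<le> t i) \<and> (\<forall>j\<in>{..<m}. \<forall>i\<in>{..j}. t j \<le> t i))"
    by (intro pred_intros_logic pred_intros_finite; (simp; fail)?; unfold pred_def; intro borel_measurable_le Rn_nth borel_measurable_const)
  then have "Measurable.pred (Rn m) (\<lambda>t. t \<in> T_set m)"
    by (rule back_subst[where P = "Measurable.pred (Rn m)"]) (auto simp: fun_eq_iff T_set_def)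
  then have "(\<lambda>t. if t \<in> T_set m then 1 else 0 :: real) \<in> borel_measurable (Rn m)" by measurable
  then show ?thesis unfolding indicator_def of_bool_def .
qed

lemma S_T: "(z \<in> S_set m) = (tcoords m z \<in> T_set m)"
  by (auto simp: S_set_def T_set_def tcoords_def)

lemma ind_S_T: "indicator (S_set m) z = (indicator (T_set m) (tcoords m z) :: real)"
  by (simp add: indicator_def S_T)

lemma S_set_measurable [measurable]: "(\<lambda>z. indicator (S_set m) z :: real) \<in> borel_measurable (fock_measure \<nu> m)"
  unfolding ind_S_T by (rule measurable_compose[OF tcoords_measurable T_set_measurable])

section \<open>Separation of the time variables from the variables of \<open>\<nu>\<close>\<close>

definition zipts :: "nat \<Rightarrow> (nat \<Rightarrow> real) \<times> (nat \<Rightarrow> real) \<Rightarrow> nat \<Rightarrow> real \<times> real" where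
  "zipts m p = restrict (\<lambda>i. (fst p i, snd p i)) {..<m}"

abbreviation "Nn m \<equiv> PiM {..<m::nat} (\<lambda>_. \<nu>)"

lemma zipts_measurable [measurable]: "zipts m \<in> measurable (Rn m \<Otimes>\<^sub>M Nn m) (fock_measure \<nu> m)"
  unfolding fock_measure_def zipts_def
  by (intro measurable_restrict measurable_Pair measurable_PiM_nth[of fst] measurable_PiM_nth[of snd]) auto

text \<open>Product measures are determined by boxes. The sides \<open>A i\<close> are arbitrary
  measurable subsets of the plane, so the integral is factored twice: over the \<open>\<nu>\<close>
  variables with the times fixed, then over the times.\<close>

lemma fock_measure_distr: "fock_measure \<nu> m = distr (Rn m \<Otimes>\<^sub>M Nn m) (fock_measure \<nu> m) (zipts m)"
proof -
  interpret F: product_sigma_finite "\<lambda>_. lborel \<Otimes>\<^sub>M \<nu> :: (real \<times> real) measure" by (rule psf_fock)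
  interpret R: product_sigma_finite "\<lambda>_. lborel :: real measure" by (rule psf_Rn)
  interpret V: product_sigma_finite "\<lambda>_. \<nu>" by (rule psf_nu)
  interpret RP: sigma_finite_measure "Rn m" by (rule R.sigma_finite) simp
  interpret VP: sigma_finite_measure "Nn m" by (rule V.sigma_finite) simp
  have "distr (Rn m \<Otimes>\<^sub>M Nn m) (fock_measure \<nu> m) (zipts m) = PiM {..<m} (\<lambda>_. lborel \<Otimes>\<^sub>M \<nu>)"
  proof (rule F.PiM_eqI)
    fix A :: "nat \<Rightarrow> (real \<times> real) set"
    assume A: "\<And>i. i \<in> {..<m} \<Longrightarrow> A i \<in> sets (lborel \<Otimes>\<^sub>M \<nu>)"
    have AE: "Pi\<^sub>E {..<m} A \<in> sets (fock_measure \<nu> m)"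
      unfolding fock_measure_def using A by (intro sets_PiM_I_finite) auto
    have ind: "indicator (zipts m -` Pi\<^sub>E {..<m} A \<inter> space (Rn m \<Otimes>\<^sub>M Nn m)) (t, s)
        = (\<Prod>i<m. indicator (A i) (t i, s i) :: ennreal)"
      if "t \<in> space (Rn m)" "s \<in> space (Nn m)" for t s
      using that by (auto simp: indicator_def zipts_def space_pair_measure PiE_iff prod.If_cases split: if_splits)
    have "emeasure (distr (Rn m \<Otimes>\<^sub>M Nn m) (fock_measure \<nu> m) (zipts m)) (Pi\<^sub>E {..<m} A)
      = emeasure (Rn m \<Otimes>\<^sub>M Nn m) (zipts m -` Pi\<^sub>E {..<m} A \<inter> space (Rn m \<Otimes>\<^sub>M Nn m))"
      by (rule emeasure_distr[OF zipts_measurable AE])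
    also have "\<dots> = (\<integral>\<^sup>+ t. \<integral>\<^sup>+ s. (\<Prod>i<m. indicator (A i) (t i, s i)) \<partial>Nn m \<partial>Rn m)"
      using measurable_sets[OF zipts_measurable AE]
      by (subst VP.emeasure_pair_measure) (auto intro!: nn_integral_cong simp: ind)
    also have "\<dots> = (\<integral>\<^sup>+ t. (\<Prod>i<m. \<integral>\<^sup>+ s. indicator (A i) (t i, s) \<partial>\<nu>) \<partial>Rn m)"
    proof (intro nn_integral_cong V.product_nn_integral_prod)
      fix t i assume "i \<in> {..<m}"
      then have [measurable]: "A i \<in> sets (lborel \<Otimes>\<^sub>M \<nu>)" by (rule A)
      show "(\<lambda>s. indicator (A i) (t i, s) :: ennreal) \<in> borel_measurable \<nu>" by measurable
    qed simp
    also have "\<dots> = (\<Prod>i<m. \<integral>\<^sup>+ t. \<integral>\<^sup>+ s. indicator (A i) (t, s) \<partial>\<nu> \<partial>lborel)"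
    proof (intro R.product_nn_integral_prod)
      fix i assume "i \<in> {..<m}"
      then have [measurable]: "A i \<in> sets (lborel \<Otimes>\<^sub>M \<nu>)" by (rule A)
      show "(\<lambda>t. \<integral>\<^sup>+ s. indicator (A i) (t, s) \<partial>\<nu>) \<in> borel_measurable lborel" by measurable
    qed simp
    also have "\<dots> = (\<Prod>i<m. emeasure (lborel \<Otimes>\<^sub>M \<nu>) (A i))"
      using A by (intro prod.cong refl) (simp add: emeasure_pair_measure)
    finally show "emeasure (distr (Rn m \<Otimes>\<^sub>M Nn m) (fock_measure \<nu> m) (zipts m)) (Pi\<^sub>E {..<m} A)
        = (\<Prod>i<m. emeasure (lborel \<Otimes>\<^sub>M \<nu>) (A i))" .
  qed (auto simp: fock_measure_def)
  then show ?thesis by (simp add: fock_measure_def)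
qed

lemma poly_snd_measurable:
  "i < m \<Longrightarrow> (\<lambda>z. poly q (snd (z i))) \<in> borel_measurable (fock_measure \<nu> m)"
  by (rule measurable_compose[OF measurable_compose[OF fock_nth measurable_snd] poly_measurable])

lemma fock_integral_prod:
  fixes F :: "(nat \<Rightarrow> real) \<Rightarrow> real" and q :: "nat \<Rightarrow> real poly"
  assumes F: "integrable (Rn m) F"
  shows "integrable (fock_measure \<nu> m) (\<lambda>z. F (tcoords m z) * (\<Prod>i<m. poly (q i) (snd (z i))))"
    and "(\<integral>z. F (tcoords m z) * (\<Prod>i<m. poly (q i) (snd (z i))) \<partial>fock_measure \<nu> m)
      = (\<integral>t. F t \<partial>Rn m) * (\<Prod>i<m. L (q i))"
proof -
  interpret R: product_sigma_finite "\<lambda>_. lborel :: real measure" by (rule psf_Rn)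
  interpret V: product_sigma_finite "\<lambda>_. \<nu>" by (rule psf_nu)
  interpret RP: sigma_finite_measure "Rn m" by (rule R.sigma_finite) simp
  interpret VP: sigma_finite_measure "Nn m" by (rule V.sigma_finite) simp
  interpret RV: pair_sigma_finite "Rn m" "Nn m" by unfold_locales
  define H where "H s = (\<Prod>i<m. poly (q i) (s i))" for s
  define G where "G z = F (tcoords m z) * (\<Prod>i<m. poly (q i) (snd (z i)))" for z
  have Fm: "F \<in> borel_measurable (Rn m)" using F by simp
  have H: "integrable (Nn m) H" "(\<integral>s. H s \<partial>Nn m) = (\<Prod>i<m. L (q i))"
    unfolding H_def L_def using integrable_poly
    by (auto intro!: V.product_integrable_prod V.product_integral_prod)
  have Gm: "G \<in> borel_measurable (fock_measure \<nu> m)"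
    unfolding G_def
  proof (rule borel_measurable_times)
    show "(\<lambda>z. F (tcoords m z)) \<in> borel_measurable (fock_measure \<nu> m)"
      by (rule measurable_compose[OF tcoords_measurable Fm])
    show "(\<lambda>z. \<Prod>i<m. poly (q i) (snd (z i))) \<in> borel_measurable (fock_measure \<nu> m)"
      by (rule borel_measurable_prod) (use poly_snd_measurable in auto)
  qed
  have G: "G (zipts m p) = F (fst p) * H (snd p)" if "p \<in> space (Rn m \<Otimes>\<^sub>M Nn m)" for p
  proof -
    \<comment> \<open>Since \<open>tcoords\<close> restricts to \<open>{..<m}\<close>, it recovers
      the times from \<open>zipts\<close> only for extensional points, which the product space
      supplies.\<close>
    have "fst p \<in> extensional {..<m}"
      using that by (auto simp: space_pair_measure space_PiM PiE_def)
    then have "tcoords m (zipts m p) = fst p"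
      by (auto simp: tcoords_def zipts_def fun_eq_iff restrict_def extensional_def)
    then show ?thesis by (simp add: G_def H_def zipts_def)
  qed
  have I: "integrable (Rn m \<Otimes>\<^sub>M Nn m) (\<lambda>p. F (fst p) * H (snd p))"
  proof (rule RV.Fubini_integrable)
    show "(\<lambda>p. F (fst p) * H (snd p)) \<in> borel_measurable (Rn m \<Otimes>\<^sub>M Nn m)"
      using H(1) Fm by measurable
  qed (use F H(1) in \<open>auto simp: abs_mult\<close>)
  have "integrable (Rn m \<Otimes>\<^sub>M Nn m) (\<lambda>p. G (zipts m p))"
    using I by (rule Bochner_Integration.integrable_cong[THEN iffD1, rotated -1]) (auto simp: G)
  then have "integrable (distr (Rn m \<Otimes>\<^sub>M Nn m) (fock_measure \<nu> m) (zipts m)) G"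
    by (subst integrable_distr_eq[OF zipts_measurable Gm])
  then show "integrable (fock_measure \<nu> m) (\<lambda>z. F (tcoords m z) * (\<Prod>i<m. poly (q i) (snd (z i))))"
    unfolding G_def[symmetric] by (simp add: fock_measure_distr[symmetric])
  have "(\<integral>z. G z \<partial>fock_measure \<nu> m) = (\<integral>p. G (zipts m p) \<partial>(Rn m \<Otimes>\<^sub>M Nn m))"
    by (subst fock_measure_distr) (rule integral_distr[OF zipts_measurable Gm])
  also have "\<dots> = (\<integral>p. F (fst p) * H (snd p) \<partial>(Rn m \<Otimes>\<^sub>M Nn m))"
    by (intro Bochner_Integration.integral_cong refl G)
  also have "\<dots> = (\<integral>t. \<integral>s. F t * H s \<partial>Nn m \<partial>Rn m)"
    using RV.integral_fst'[OF I] by simp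
  also have "\<dots> = (\<integral>t. F t \<partial>Rn m) * (\<Prod>i<m. L (q i))"
    using H by simp
  finally show "(\<integral>z. F (tcoords m z) * (\<Prod>i<m. poly (q i) (snd (z i))) \<partial>fock_measure \<nu> m)
      = (\<integral>t. F t \<partial>Rn m) * (\<Prod>i<m. L (q i))" unfolding G_def .
qed

lemma poly_wt_prod: "poly_wt \<nu> ls z = (\<Prod>i<length ls. poly (P (ls ! i)) (snd (z i)))"
proof (induction ls arbitrary: z)
  case (Cons l ls)
  show ?case
    unfolding poly_wt.simps Cons.IH list.size Nat.add_0_right add_Suc_right prod.lessThan_Suc_shift
    by (simp add: vshift_def)
qed simp

text \<open>Domination by a multiple of the indicator of a cube \<open>[0, R]^m\<close>. The upper
  faces come from the support of \<open>f\<close>; the lower ones come from \<open>T_set\<close>, as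
  \<open>B0\<close> leaves negative coordinates unrestricted.\<close>

lemma T_integrable:
  assumes f: "f \<in> B0 m" and g: "g \<in> B0 m"
  shows "integrable (Rn m) (\<lambda>t. indicator (T_set m) t * f t * g t)"
proof -
  interpret R: product_sigma_finite "\<lambda>_. lborel :: real measure" by (rule psf_Rn)
  obtain R C where f': "0 \<le> R" "bsupp m R C f" using B0_bsupp[OF f] .
  obtain R' C' where g': "0 \<le> R'" "bsupp m R' C' g" using B0_bsupp[OF g] .
  have "integrable (Rn m) (\<lambda>t. (\<Prod>i<m. indicator {0..R} (t i) :: real))"
    by (intro R.product_integrable_prod) (auto intro!: integrable_real_indicator simp: emeasure_lborel_Icc_eq)
  then have "integrable (Rn m) (\<lambda>t. C * C' * (\<Prod>i<m. indicator {0..R} (t i) :: real))"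
    by simp
  then show ?thesis
  proof (rule Bochner_Integration.integrable_bound)
    show "(\<lambda>t. indicator (T_set m) t * f t * g t) \<in> borel_measurable (Rn m)"
      using f g unfolding B0_iff by (intro borel_measurable_times T_set_measurable) auto
    show "AE t in Rn m. norm (indicator (T_set m) t * f t * g t)
        \<le> norm (C * C' * (\<Prod>i<m. indicator {0..R} (t i)))"
    proof (rule AE_I2)
      fix t
      have CC: "0 \<le> C" "0 \<le> C'" using f' g' bsupp_nonneg by auto
      show "norm (indicator (T_set m) t * f t * g t) \<le> norm (C * C' * (\<Prod>i<m. indicator {0..R} (t i)))"
      proof (cases "t \<in> T_set m \<and> (\<forall>i<m. t i \<le> R)")
        case True
        then have "(\<Prod>i<m. indicator {0..R} (t i) :: real) = 1"
          by (intro prod.neutral) (auto simp: T_set_def)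
        moreover have "\<bar>f t * g t\<bar> \<le> C * C'"
          unfolding abs_mult using f' g' CC by (intro mult_mono) (auto simp: bsupp_def)
        ultimately show ?thesis using True CC by simp
      next
        case False
        then have "indicator (T_set m) t * f t * g t = 0"
          using bsuppD[OF f'(2), of _ t] by (auto simp: not_le)
        then show ?thesis unfolding \<open>indicator (T_set m) t * f t * g t = 0\<close> by simp
      qed
    qed
  qed
qed

text \<open>Distinct tuples of equal length differ at some position, and that position contributes a
  factor 0 by orthogonality of the \<open>P l\<close>.\<close>

lemma level_inner_prod:
  assumes f: "f \<in> B0 m" and g: "g \<in> B0 m" and l: "length ls = m" "length ls' = m"
  shows "integrable (fock_measure \<nu> m) (\<lambda>z. indicator (S_set m) z * (poly_wt \<nu> ls z * f (tcoords m z)) * (poly_wt \<nu> ls' z * g (tcoords m z)))"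
    and "(\<integral>z. indicator (S_set m) z * (poly_wt \<nu> ls z * f (tcoords m z)) * (poly_wt \<nu> ls' z * g (tcoords m z)) \<partial>fock_measure \<nu> m)
     = (if ls = ls' then (\<Prod>i<m. cconst \<nu> (Suc (ls ! i))) * (\<integral>t. indicator (T_set m) t * f t * g t \<partial>Rn m) else 0)"
proof -
  have e: "indicator (S_set m) z * (poly_wt \<nu> ls z * f (tcoords m z)) * (poly_wt \<nu> ls' z * g (tcoords m z))
    = (indicator (T_set m) (tcoords m z) * f (tcoords m z) * g (tcoords m z)) * (\<Prod>i<m. poly (P (ls ! i) * P (ls' ! i)) (snd (z i)))" for z
    unfolding poly_wt_prod l ind_S_T poly_mult prod.distrib by (simp add: mult_ac)
  note * = fock_integral_prod[OF T_integrable[OF f g], of "\<lambda>i. P (ls ! i) * P (ls' ! i)"]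
  show "integrable (fock_measure \<nu> m) (\<lambda>z. indicator (S_set m) z * (poly_wt \<nu> ls z * f (tcoords m z)) * (poly_wt \<nu> ls' z * g (tcoords m z)))"
    unfolding e by (rule *)
  have "(\<Prod>i<m. L (P (ls ! i) * P (ls' ! i))) = (if ls = ls' then (\<Prod>i<m. cconst \<nu> (Suc (ls ! i))) else 0)"
  proof (cases "ls = ls'")
    case False
    then obtain i where "i < m" "ls ! i \<noteq> ls' ! i" using l by (metis nth_equalityI)
    then have "L (P (ls ! i) * P (ls' ! i)) = 0" using L_P_P by simp
    then show ?thesis using \<open>i < m\<close> False by (auto intro!: prod_zero)
  qed (simp add: cconst_Suc)
  then show "(\<integral>z. indicator (S_set m) z * (poly_wt \<nu> ls z * f (tcoords m z)) * (poly_wt \<nu> ls' z * g (tcoords m z)) \<partial>fock_measure \<nu> m)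
     = (if ls = ls' then (\<Prod>i<m. cconst \<nu> (Suc (ls ! i))) * (\<integral>t. indicator (T_set m) t * f t * g t \<partial>Rn m) else 0)"
    unfolding e *(2) by simp
qed

section \<open>The Fock space as a semidefinite inner product space\<close>

lemma fock_spaceD:
  assumes "\<psi> \<in> fock_space \<nu>"
  shows "\<psi> m \<in> borel_measurable (fock_measure \<nu> m)"
    "integrable (fock_measure \<nu> m) (\<lambda>z. indicator (S_set m) z * (\<psi> m z)\<^sup>2)"
    "summable (\<lambda>m. level_inner \<nu> m \<psi> \<psi>)"
  using assms by (auto simp: fock_space_def level_inner_def power2_eq_square mult.assoc)

lemma fock_spaceI:
  assumes "\<And>m. \<psi> m \<in> borel_measurable (fock_measure \<nu> m)"
    "\<And>m. integrable (fock_measure \<nu> m) (\<lambda>z. indicator (S_set m) z * \<psi> m z * \<psi> m z)"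
    "summable (\<lambda>m. level_inner \<nu> m \<psi> \<psi>)"
  shows "\<psi> \<in> fock_space \<nu>"
  using assms by (auto simp: fock_space_def level_inner_def power2_eq_square mult.assoc)

text \<open>The crude inequality \<open>\<bar>x * y\<bar> \<le> x\<^sup>2 + y\<^sup>2\<close>
  suffices: its right-hand side is integrable on each level and summable over the levels.\<close>

lemma level_inner_integrable:
  assumes "\<psi> \<in> fock_space \<nu>" "\<phi> \<in> fock_space \<nu>"
  shows "integrable (fock_measure \<nu> m) (\<lambda>z. indicator (S_set m) z * \<psi> m z * \<phi> m z)"
    "\<bar>level_inner \<nu> m \<psi> \<phi>\<bar> \<le> level_inner \<nu> m \<psi> \<psi> + level_inner \<nu> m \<phi> \<phi>"
proof -
  note a = fock_spaceD[OF assms(1)] and b = fock_spaceD[OF assms(2)]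
  have s: "integrable (fock_measure \<nu> m) (\<lambda>z. indicator (S_set m) z * (\<psi> m z)\<^sup>2 + indicator (S_set m) z * (\<phi> m z)\<^sup>2)"
    using a(2) b(2) by (rule Bochner_Integration.integrable_add)
  have ab: "\<bar>x * y\<bar> \<le> x\<^sup>2 + y\<^sup>2" for x y :: real
  proof -
    have "2 * (\<bar>x\<bar> * \<bar>y\<bar>) \<le> x\<^sup>2 + y\<^sup>2"
      using zero_le_power2[of "\<bar>x\<bar> - \<bar>y\<bar>"] by (simp add: power2_eq_square algebra_simps)
    moreover have "0 \<le> \<bar>x\<bar> * \<bar>y\<bar>" by simp
    ultimately show ?thesis unfolding abs_mult by linarith
  qed
  have bd: "\<bar>indicator (S_set m) z * \<psi> m z * \<phi> m z\<bar>
      \<le> indicator (S_set m) z * (\<psi> m z)\<^sup>2 + indicator (S_set m) z * (\<phi> m z)\<^sup>2" for z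
    using ab by (auto simp: indicator_def)
  show i: "integrable (fock_measure \<nu> m) (\<lambda>z. indicator (S_set m) z * \<psi> m z * \<phi> m z)"
    using s
  proof (rule Bochner_Integration.integrable_bound)
    show "(\<lambda>z. indicator (S_set m) z * \<psi> m z * \<phi> m z) \<in> borel_measurable (fock_measure \<nu> m)"
      using a(1) b(1) by (intro borel_measurable_times S_set_measurable)
  qed (use bd in \<open>auto intro!: AE_I2 intro: order_trans[OF bd abs_ge_self]\<close>)
  have "\<bar>level_inner \<nu> m \<psi> \<phi>\<bar> \<le> (\<integral>z. indicator (S_set m) z * (\<psi> m z)\<^sup>2 + indicator (S_set m) z * (\<phi> m z)\<^sup>2 \<partial>fock_measure \<nu> m)"
    unfolding level_inner_def by (intro order_trans[OF integral_abs_bound] integral_mono integrable_abs i s bd)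
  also have "\<dots> = level_inner \<nu> m \<psi> \<psi> + level_inner \<nu> m \<phi> \<phi>"
    using a(2) b(2) by (simp add: level_inner_def power2_eq_square mult.assoc)
  finally show "\<bar>level_inner \<nu> m \<psi> \<phi>\<bar> \<le> level_inner \<nu> m \<psi> \<psi> + level_inner \<nu> m \<phi> \<phi>" .
qed

lemma level_inner_summable:
  assumes "\<psi> \<in> fock_space \<nu>" "\<phi> \<in> fock_space \<nu>"
  shows "summable (\<lambda>m. level_inner \<nu> m \<psi> \<phi>)"
proof (rule summable_comparison_test')
  show "summable (\<lambda>m. level_inner \<nu> m \<psi> \<psi> + level_inner \<nu> m \<phi> \<phi>)"
    by (rule summable_add[OF fock_spaceD(3)[OF assms(1)] fock_spaceD(3)[OF assms(2)]])
  show "norm (level_inner \<nu> m \<psi> \<phi>) \<le> level_inner \<nu> m \<psi> \<psi> + level_inner \<nu> m \<phi> \<phi>" for m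
    unfolding real_norm_def by (rule level_inner_integrable(2)[OF assms])
qed

lemma level_inner_add_left:
  assumes "\<psi> \<in> fock_space \<nu>" "\<psi>' \<in> fock_space \<nu>" "\<phi> \<in> fock_space \<nu>"
  shows "level_inner \<nu> m (\<lambda>m z. \<psi> m z + c * \<psi>' m z) \<phi> = level_inner \<nu> m \<psi> \<phi> + c * level_inner \<nu> m \<psi>' \<phi>"
proof -
  have "level_inner \<nu> m (\<lambda>m z. \<psi> m z + c * \<psi>' m z) \<phi>
    = (\<integral>z. indicator (S_set m) z * \<psi> m z * \<phi> m z + c * (indicator (S_set m) z * \<psi>' m z * \<phi> m z) \<partial>fock_measure \<nu> m)"
    unfolding level_inner_def by (intro Bochner_Integration.integral_cong refl) (simp add: algebra_simps)
  also have "\<dots> = level_inner \<nu> m \<psi> \<phi> + c * level_inner \<nu> m \<psi>' \<phi>"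
    unfolding level_inner_def using level_inner_integrable(1)[OF assms(1,3)] level_inner_integrable(1)[OF assms(2,3)] by simp
  finally show ?thesis .
qed

lemma level_inner_commute: "level_inner \<nu> m \<psi> \<phi> = level_inner \<nu> m \<phi> \<psi>"
  unfolding level_inner_def by (intro Bochner_Integration.integral_cong refl) simp

lemma fock_inner_commute: "fock_inner \<nu> \<psi> \<phi> = fock_inner \<nu> \<phi> \<psi>"
  unfolding fock_inner_lev level_inner_commute[of _ \<psi> \<phi>] ..

lemma fock_space_add:
  assumes "\<psi> \<in> fock_space \<nu>" "\<psi>' \<in> fock_space \<nu>"
  shows "(\<lambda>m z. \<psi> m z + c * \<psi>' m z) \<in> fock_space \<nu>"
proof -
  let ?s = "\<lambda>m z. \<psi> m z + c * \<psi>' m z"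
  note a = fock_spaceD[OF assms(1)] and b = fock_spaceD[OF assms(2)]
  have e: "indicator (S_set m) z * ?s m z * ?s m z = indicator (S_set m) z * \<psi> m z * \<psi> m z
     + 2 * c * (indicator (S_set m) z * \<psi> m z * \<psi>' m z) + c\<^sup>2 * (indicator (S_set m) z * \<psi>' m z * \<psi>' m z)" for m z
    by (cases "z \<in> S_set m") (simp_all add: power2_eq_square algebra_simps)
  have i: "integrable (fock_measure \<nu> m) (\<lambda>z. indicator (S_set m) z * ?s m z * ?s m z)" for m
    unfolding e by (intro Bochner_Integration.integrable_add integrable_mult_right level_inner_integrable(1) assms)
  have l: "level_inner \<nu> m ?s ?s = level_inner \<nu> m \<psi> \<psi> + 2 * c * level_inner \<nu> m \<psi> \<psi>' + c\<^sup>2 * level_inner \<nu> m \<psi>' \<psi>'" for m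
    unfolding level_inner_def e
    by (simp add: level_inner_integrable(1)[OF assms(1,1)] level_inner_integrable(1)[OF assms(1,2)] level_inner_integrable(1)[OF assms(2,2)])
  show ?thesis
  proof (rule fock_spaceI[OF _ i])
    show "?s m \<in> borel_measurable (fock_measure \<nu> m)" for m
      using a(1)[of m] b(1)[of m] by simp
    show "summable (\<lambda>m. level_inner \<nu> m ?s ?s)"
      unfolding l by (intro summable_add summable_mult level_inner_summable assms)
  qed
qed

lemma fock_inner_add_left:
  assumes "\<psi> \<in> fock_space \<nu>" "\<psi>' \<in> fock_space \<nu>" "\<phi> \<in> fock_space \<nu>"
  shows "fock_inner \<nu> (\<lambda>m z. \<psi> m z + c * \<psi>' m z) \<phi> = fock_inner \<nu> \<psi> \<phi> + c * fock_inner \<nu> \<psi>' \<phi>"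
proof -
  note a = level_inner_summable[OF assms(1,3)] and b = level_inner_summable[OF assms(2,3)]
  have "(\<lambda>m. level_inner \<nu> m \<psi> \<phi> + c * level_inner \<nu> m \<psi>' \<phi>) sums (fock_inner \<nu> \<psi> \<phi> + c * fock_inner \<nu> \<psi>' \<phi>)"
    unfolding fock_inner_lev using a b by (intro sums_add sums_mult summable_sums)
  then have "(\<lambda>m. level_inner \<nu> m (\<lambda>m z. \<psi> m z + c * \<psi>' m z) \<phi>) sums (fock_inner \<nu> \<psi> \<phi> + c * fock_inner \<nu> \<psi>' \<phi>)"
    unfolding level_inner_add_left[OF assms] .
  then show ?thesis by (subst fock_inner_lev) (rule sums_unique[symmetric])
qed

lemma fock_space_diff:
  assumes "\<psi> \<in> fock_space \<nu>" "\<psi>' \<in> fock_space \<nu>"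
  shows "(\<lambda>m z. \<psi> m z - \<psi>' m z) \<in> fock_space \<nu>"
  using fock_space_add[OF assms, of "-1"] by simp

lemma fock_inner_diff_left:
  assumes "\<psi> \<in> fock_space \<nu>" "\<psi>' \<in> fock_space \<nu>" "\<phi> \<in> fock_space \<nu>"
  shows "fock_inner \<nu> (\<lambda>m z. \<psi> m z - \<psi>' m z) \<phi> = fock_inner \<nu> \<psi> \<phi> - fock_inner \<nu> \<psi>' \<phi>"
  using fock_inner_add_left[OF assms, of "-1"] by simp

lemma fock_inner_diff_right:
  assumes "\<psi> \<in> fock_space \<nu>" "\<psi>' \<in> fock_space \<nu>" "\<phi> \<in> fock_space \<nu>"
  shows "fock_inner \<nu> \<phi> (\<lambda>m z. \<psi> m z - \<psi>' m z) = fock_inner \<nu> \<phi> \<psi> - fock_inner \<nu> \<phi> \<psi>'"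
  using fock_inner_diff_left[OF assms] by (simp add: fock_inner_commute)

lemma level_inner_nonneg: "0 \<le> level_inner \<nu> m \<psi> \<psi>"
  unfolding level_inner_def by (rule integral_nonneg_AE) (auto simp: mult.assoc indicator_def)

lemma fock_inner_nonneg: "\<psi> \<in> fock_space \<nu> \<Longrightarrow> 0 \<le> fock_inner \<nu> \<psi> \<psi>"
  unfolding fock_inner_lev by (intro suminf_nonneg level_inner_summable level_inner_nonneg)

text \<open>The quadratic in \<open>t\<close> may degenerate, since nonzero representatives can have
  norm 0; hence the separate case \<open>?c = 0\<close>.\<close>

lemma fock_Cauchy_Schwarz:
  assumes a: "\<psi> \<in> fock_space \<nu>" and b: "\<phi> \<in> fock_space \<nu>"
  shows "\<bar>fock_inner \<nu> \<psi> \<phi>\<bar> \<le> fock_norm \<nu> \<psi> * fock_norm \<nu> \<phi>"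
proof -
  let ?a = "fock_inner \<nu> \<psi> \<psi>" and ?b = "fock_inner \<nu> \<psi> \<phi>" and ?c = "fock_inner \<nu> \<phi> \<phi>"
  have q: "0 \<le> ?a + 2 * t * ?b + t\<^sup>2 * ?c" for t
  proof -
    let ?s = "\<lambda>m z. \<psi> m z + t * \<phi> m z"
    have s: "?s \<in> fock_space \<nu>" using a b by (rule fock_space_add)
    have "fock_inner \<nu> ?s ?s = fock_inner \<nu> \<psi> ?s + t * fock_inner \<nu> \<phi> ?s"
      by (rule fock_inner_add_left[OF a b s])
    also have "fock_inner \<nu> \<psi> ?s = ?a + t * ?b"
      using fock_inner_add_left[OF a b a, of t] by (simp add: fock_inner_commute)
    also have "fock_inner \<nu> \<phi> ?s = ?b + t * ?c"
      using fock_inner_add_left[OF a b b, of t] by (simp add: fock_inner_commute)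
    finally show ?thesis using fock_inner_nonneg[OF s] by (simp add: power2_eq_square algebra_simps)
  qed
  have c: "0 \<le> ?c" using b by (rule fock_inner_nonneg)
  have "?b\<^sup>2 \<le> ?a * ?c"
  proof (cases "?c = 0")
    case True
    have "?b = 0"
    proof (rule ccontr)
      assume "?b \<noteq> 0"
      \<comment> \<open>For \<open>?c = 0\<close> the expression is affine in \<open>t\<close>; this
        \<open>t\<close> gives it the value \<open>-1\<close>.\<close>
      then have "?a + 2 * (- (?a + 1) / (2 * ?b)) * ?b = - 1" by (simp add: field_simps)
      then show False using q[of "- (?a + 1) / (2 * ?b)"] True by simp
    qed
    with True show ?thesis by simp
  next
    case False
    with c have "0 < ?c" by simp
    \<comment> \<open>The minimiser of the quadratic.\<close>
    have "?a + 2 * (- ?b / ?c) * ?b + (- ?b / ?c)\<^sup>2 * ?c = (?a * ?c - ?b\<^sup>2) / ?c"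
      using False by (simp add: field_simps power2_eq_square)
    then have "0 \<le> (?a * ?c - ?b\<^sup>2) / ?c" using q[of "- ?b / ?c"] by simp
    then show ?thesis using \<open>0 < ?c\<close> by (simp add: zero_le_divide_iff)
  qed
  then have "sqrt (?b\<^sup>2) \<le> sqrt (?a * ?c)" by (rule real_sqrt_le_mono)
  then show ?thesis by (simp add: fock_norm_def real_sqrt_mult)
qed

lemma fock_inner_null:
  assumes "\<psi> \<in> fock_space \<nu>" "\<phi> \<in> fock_space \<nu>" "fock_inner \<nu> \<psi> \<psi> = 0"
  shows "fock_inner \<nu> \<psi> \<phi> = 0"
  using fock_Cauchy_Schwarz[OF assms(1,2)] assms(3) by (simp add: fock_norm_def)

text \<open>The integrands agree pointwise, so this transfers inner products from a monomial to its
  kernel expansion without first placing the monomial in \<open>fock_space\<close>.\<close>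

lemma fock_inner_cong:
  assumes "\<And>m z. z \<in> S_set m \<Longrightarrow> \<psi> m z = \<psi>' m z"
  shows "fock_inner \<nu> \<psi> \<phi> = fock_inner \<nu> \<psi>' \<phi>"
proof -
  have "level_inner \<nu> m \<psi> \<phi> = level_inner \<nu> m \<psi>' \<phi>" for m
    unfolding level_inner_def by (intro Bochner_Integration.integral_cong refl) (auto simp: indicator_def assms)
  then show ?thesis by (simp add: fock_inner_lev)
qed

lemma fock_norm_cong:
  assumes "\<And>m z. z \<in> S_set m \<Longrightarrow> \<psi> m z = \<psi>' m z"
  shows "fock_norm \<nu> \<psi> = fock_norm \<nu> \<psi>'"
proof -
  have "fock_inner \<nu> \<psi> \<psi> = fock_inner \<nu> \<psi>' \<psi>" by (rule fock_inner_cong[OF assms])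
  also have "\<dots> = fock_inner \<nu> \<psi> \<psi>'" by (rule fock_inner_commute)
  also have "\<dots> = fock_inner \<nu> \<psi>' \<psi>'" by (rule fock_inner_cong[OF assms])
  finally show ?thesis by (simp add: fock_norm_def)
qed

text \<open>When two particles share a time, the point of \<open>T_n\<close> no longer reveals the
  tuple it came from; test functions can separate tuples only on these points.\<close>

definition strict_pts :: "nat \<Rightarrow> (nat \<Rightarrow> real \<times> real) set" where
  "strict_pts m = {z \<in> S_set m. \<forall>i<m. \<forall>j<m. i \<noteq> j \<longrightarrow> fst (z i) \<noteq> fst (z j)}"

end

text \<open>Fubini in coordinate \<open>i\<close>: with the others fixed, \<open>h (x i)\<close> has
  to hit the single value \<open>h (x j)\<close>. The function \<open>h\<close> covers bare times as
  well as the first components of pairs.\<close>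

lemma AE_PiM_neq:
  assumes M: "sigma_finite_measure M" and I: "finite I" "i \<in> I" "j \<in> I" "i \<noteq> j"
    and h[measurable]: "h \<in> borel_measurable M" and n: "\<And>c::real. AE y in M. h y \<noteq> c"
  shows "AE x in PiM I (\<lambda>_. M). h (x i) \<noteq> h (x j)"
proof -
  interpret product_sigma_finite "\<lambda>_. M" using M by (simp add: product_sigma_finite_def)
  define J where "J = I - {i}"
  have J: "finite J" "i \<notin> J" "I = insert i J" "j \<in> J" using I by (auto simp: J_def)
  let ?e = "\<lambda>x. if h (x i) = h (x j) then 1 else 0 :: ennreal"
  have m: "(\<lambda>x. h (x k)) \<in> borel_measurable (PiM I (\<lambda>_. M))" if "k \<in> I" for k
    by (rule measurable_compose[OF measurable_component_singleton[OF that] h])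
  have e: "?e \<in> borel_measurable (PiM I (\<lambda>_. M))"
    using m[OF I(2)] m[OF I(3)] by measurable
  have "(\<integral>\<^sup>+ x. ?e x \<partial>PiM I (\<lambda>_. M)) = (\<integral>\<^sup>+ x. (\<integral>\<^sup>+ y. ?e (x(i := y)) \<partial>M) \<partial>PiM J (\<lambda>_. M))"
    unfolding J(3) by (rule product_nn_integral_insert[OF J(1,2) e[unfolded J(3)]])
  also have "\<dots> = (\<integral>\<^sup>+ x. 0 \<partial>PiM J (\<lambda>_. M))"
  proof (intro nn_integral_cong)
    fix x
    have "(\<integral>\<^sup>+ y. ?e (x(i := y)) \<partial>M) = (\<integral>\<^sup>+ y. 0 \<partial>M)"
    proof (rule nn_integral_cong_AE)
      show "AE y in M. ?e (x(i := y)) = 0"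
        using n[of "h (x j)"] by eventually_elim (use I(4) in simp)
    qed
    then show "(\<integral>\<^sup>+ y. ?e (x(i := y)) \<partial>M) = 0" by simp
  qed
  finally have "(\<integral>\<^sup>+ x. ?e x \<partial>PiM I (\<lambda>_. M)) = 0" by simp
  then have "AE x in PiM I (\<lambda>_. M). ?e x = 0"
    using nn_integral_0_iff_AE[OF e] by blast
  then show ?thesis by eventually_elim (auto split: if_splits)
qed

lemma AE_Rn_distinct: "AE t in PiM {..<m::nat} (\<lambda>_. lborel :: real measure). \<forall>i<m. \<forall>j<m. i \<noteq> j \<longrightarrow> t i \<noteq> t j"
proof -
  have "AE t in PiM {..<m::nat} (\<lambda>_. lborel :: real measure). \<forall>i\<in>{..<m}. \<forall>j\<in>{..<m}. i \<noteq> j \<longrightarrow> t i \<noteq> t j"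
  proof (intro AE_finite_allI)
    fix i j assume ij: "i \<in> {..<m}" "j \<in> {..<m}"
    show "AE t in PiM {..<m::nat} (\<lambda>_. lborel :: real measure). i \<noteq> j \<longrightarrow> t i \<noteq> t j"
    proof (cases "i = j")
      case False
      have "AE t in PiM {..<m::nat} (\<lambda>_. lborel :: real measure). t i \<noteq> t j"
        by (rule AE_PiM_neq[OF sigma_finite_lborel _ ij False, of "\<lambda>x. x"]) (simp_all add: AE_lborel_singleton)
      then show ?thesis by eventually_elim simp
    qed simp
  qed auto
  then show ?thesis by eventually_elim auto
qed

context compact_prob
begin

lemma AE_fock_distinct:
  "AE z in fock_measure \<nu> m. \<forall>i<m. \<forall>j<m. i \<noteq> j \<longrightarrow> fst (z i) \<noteq> fst (z j)"
proof -
  interpret pair_sigma_finite "lborel :: real measure" \<nu> by unfold_locales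
  have n: "AE y in lborel \<Otimes>\<^sub>M \<nu>. fst y \<noteq> c" for c :: real
  proof (rule AE_pair_measure)
    show "{x \<in> space (lborel \<Otimes>\<^sub>M \<nu>). fst x \<noteq> c} \<in> sets (lborel \<Otimes>\<^sub>M \<nu>)" by measurable
    show "AE x in lborel. AE y in \<nu>. fst (x, y) \<noteq> c"
      using AE_lborel_singleton[of c] by eventually_elim simp
  qed
  have h: "fst \<in> borel_measurable (lborel \<Otimes>\<^sub>M \<nu>)" by simp
  have "AE z in fock_measure \<nu> m. \<forall>i\<in>{..<m}. \<forall>j\<in>{..<m}. i \<noteq> j \<longrightarrow> fst (z i) \<noteq> fst (z j)"
  proof (intro AE_finite_allI)
    fix i j assume ij: "i \<in> {..<m}" "j \<in> {..<m}"
    show "AE z in fock_measure \<nu> m. i \<noteq> j \<longrightarrow> fst (z i) \<noteq> fst (z j)"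
    proof (cases "i = j")
      case False
      have "AE z in fock_measure \<nu> m. fst (z i) \<noteq> fst (z j)"
        unfolding fock_measure_def by (rule AE_PiM_neq[OF pair_sf _ ij False h n]) simp
      then show ?thesis by eventually_elim simp
    qed simp
  qed auto
  then show ?thesis by eventually_elim auto
qed

lemma fock_norm_strict:
  assumes "\<And>m z. z \<in> strict_pts m \<Longrightarrow> \<psi> m z = 0"
  shows "fock_norm \<nu> \<psi> = 0"
proof -
  have "level_inner \<nu> m \<psi> \<psi> = 0" for m
    unfolding level_inner_def
  proof (rule integral_eq_zero_AE)
    show "AE z in fock_measure \<nu> m. indicator (S_set m) z * \<psi> m z * \<psi> m z = 0"
      using AE_fock_distinct[of m]
    proof eventually_elim
      case (elim z)
      then show ?case using assms[of z m] by (auto simp: strict_pts_def indicator_def)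
    qed
  qed
  then show ?thesis by (simp add: fock_norm_def fock_inner_lev)
qed

end

section \<open>The orthogonal projection\<close>

lemma blk_less: "k < wlen ls \<Longrightarrow> blk ls k < length ls"
proof (induction ls arbitrary: k)
  case (Cons l ls)
  then show ?case
    unfolding blk_Cons[OF Cons.prems] by (auto intro!: Cons.IH)
qed simp

lemma blk_mono: assumes "i \<le> j" "j < wlen ls" shows "blk ls i \<le> blk ls j"
proof -
  have "j < (\<Sum>a<Suc (length ls). Suc (ls ! a))"
    using assms(2) unfolding psum_length[symmetric] by simp
  then have "j < (\<Sum>a<Suc (blk ls j). Suc (ls ! a))"
    unfolding blk_def by (rule LeastI)
  then show ?thesis
    using assms(1) unfolding blk_def[of ls i] by (intro Least_le) simp
qed

lemma blk_surj: "j < length ls \<Longrightarrow> \<exists>k<wlen ls. blk ls k = j"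
proof (induction ls arbitrary: j)
  case (Cons l ls)
  show ?case
  proof (cases j)
    case 0
    have "blk (l # ls) 0 = 0" by (subst blk_Cons) auto
    with 0 show ?thesis by (intro exI[of _ 0]) simp
  next
    case (Suc j')
    with Cons obtain k where k: "k < wlen ls" "blk ls k = j'" by auto
    then have "blk (l # ls) (k + Suc l) = j" using Suc by (subst blk_Cons) auto
    then show ?thesis using k(1) by (intro exI[of _ "k + Suc l"]) simp
  qed
qed simp

lemma phi_nth: "k < wlen ls \<Longrightarrow> phi ls t k = t (blk ls k)"
  by (simp add: phi_def)

definition strict_dec :: "nat \<Rightarrow> (nat \<Rightarrow> real) \<Rightarrow> bool" where
  "strict_dec m t \<longleftrightarrow> (\<forall>j. Suc j < m \<longrightarrow> t (Suc j) < t j)"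

lemma phi_0: "ls \<noteq> [] \<Longrightarrow> phi ls t 0 = t 0"
  by (cases ls) (auto simp: phi_Cons)

text \<open>If the first block on the left were shorter, position \<open>Suc l\<close> would still
  read \<open>t' 0 = t 0\<close> on the right, but \<open>t 1 < t 0\<close> on the left. Equal total
  order guarantees that the left side has a second block.\<close>

lemma phi_first_block:
  assumes "strict_dec (length (l # ls)) t" "wlen (l # ls) = wlen (l' # ls')"
    and eq: "phi (l # ls) t = phi (l' # ls') t'"
  shows "\<not> l < l'"
proof
  assume ll: "l < l'"
  with assms(2) have ne: "ls \<noteq> []" by auto
  have "t 0 = t' 0" using fun_cong[OF eq, of 0] by (simp add: phi_Cons)
  moreover have "phi ls (vshift t) 0 = t' 0" using fun_cong[OF eq, of "Suc l"] ll by (simp add: phi_Cons)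
  moreover have "phi ls (vshift t) 0 = t 1" using ne by (simp add: phi_0 vshift_def)
  moreover have "t 1 < t 0" using assms(1) ne by (auto simp: strict_dec_def)
  ultimately show False by simp
qed

text \<open>Disjointness of the strata: the lengths of the runs of equal coordinates determine the
  tuple, one block at a time.\<close>

lemma phi_inj:
  assumes "strict_dec (length ls) t" "strict_dec (length ls') t'" "wlen ls = wlen ls'" "phi ls t = phi ls' t'"
  shows "ls = ls'"
  using assms
proof (induction ls arbitrary: ls' t t')
  case Nil
  then show ?case by (cases ls') auto
next
  case (Cons l ls)
  then obtain l' ls'' where ls': "ls' = l' # ls''" by (cases ls') auto
  have "\<not> l < l'"
    using Cons.prems unfolding ls' by (intro phi_first_block[of l ls t l' ls'' t']) auto
  moreover have "\<not> l' < l"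
    using Cons.prems unfolding ls' by (intro phi_first_block[of l' ls'' t' l ls t]) auto
  ultimately have l: "l = l'" by simp
  have "phi ls (vshift t) = phi ls'' (vshift t')"
  proof
    fix k
    show "phi ls (vshift t) k = phi ls'' (vshift t') k"
      using fun_cong[OF Cons.prems(4), of "k + Suc l"] unfolding ls' l by (simp add: phi_Cons)
  qed
  moreover have "strict_dec (length ls) (vshift t)" "strict_dec (length ls'') (vshift t')"
    using Cons.prems(1,2) unfolding ls' by (auto simp: strict_dec_def vshift_def)
  ultimately have "ls = ls''" using Cons.prems(3) unfolding ls' l by (intro Cons.IH) auto
  with l ls' show ?case by simp
qed

lemma T_set_phi: "t \<in> T_set (length ls) \<Longrightarrow> phi ls t \<in> T_set (wlen ls)"
  using blk_mono[of _ _ ls] by (auto simp: T_set_def phi_nth blk_less)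

definition Wle :: "nat \<Rightarrow> nat list set" where "Wle n = {ls. wlen ls \<le> n}"
definition Wn :: "nat \<Rightarrow> nat list set" where "Wn n = {ls. wlen ls = n}"
definition Wlt :: "nat \<Rightarrow> nat list set" where "Wlt n = {ls. wlen ls < n}"

lemma wlen_bounds: "length ls \<le> wlen ls" "l \<in> set ls \<Longrightarrow> l < wlen ls"
  by (induction ls) auto

lemma finite_Wle [simp]: "finite (Wle n)"
proof (rule finite_subset)
  show "Wle n \<subseteq> {ls. set ls \<subseteq> {..<Suc n} \<and> length ls \<le> n}"
  proof
    fix ls assume "ls \<in> Wle n"
    then have "wlen ls \<le> n" by (simp add: Wle_def)
    then show "ls \<in> {ls. set ls \<subseteq> {..<Suc n} \<and> length ls \<le> n}"
      using wlen_bounds(1)[of ls] wlen_bounds(2)[of _ ls] by fastforce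
  qed
qed (rule finite_lists_length_le, simp)

lemma Wle_split: "Wle n = Wn n \<union> Wlt n" "Wn n \<inter> Wlt n = {}"
  by (auto simp: Wle_def Wn_def Wlt_def)

lemma finite_Wn [simp]: "finite (Wn n)" and finite_Wlt [simp]: "finite (Wlt n)"
  using finite_Wle[of n] unfolding Wle_split(1) by auto

lemma comps_Wn: "1 \<le> n \<Longrightarrow> comps n = Wn n"
  by (auto simp: comps_def Wn_def)

section \<open>Finite combinations of kernels and their inner products\<close>

definition level_vec :: "real measure \<Rightarrow> nat list \<Rightarrow> ((nat \<Rightarrow> real) \<Rightarrow> real) \<Rightarrow> fock" where
  "level_vec \<nu> ls F = (\<lambda>m z. if m = length ls then poly_wt \<nu> ls z * F (tcoords m z) else 0)"

definition level_comb :: "real measure \<Rightarrow> nat list set \<Rightarrow> (nat list \<Rightarrow> (nat \<Rightarrow> real) \<Rightarrow> real) \<Rightarrow> fock" where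
  "level_comb \<nu> A H = (\<lambda>m z. \<Sum>ls\<in>A. level_vec \<nu> ls (H ls) m z)"

context compact_prob
begin

lemma B0_lincomb:
  assumes "f \<in> B0 n" "g \<in> B0 n" shows "(\<lambda>x. f x + c * g x) \<in> B0 n"
proof -
  obtain R C where f: "0 \<le> R" "bsupp n R C f" using B0_bsupp[OF assms(1)] .
  obtain R' C' where g: "0 \<le> R'" "bsupp n R' C' g" using B0_bsupp[OF assms(2)] .
  have "\<bar>f x + c * g x\<bar> \<le> C + \<bar>c\<bar> * C'" for x
  proof -
    have "\<bar>c * g x\<bar> \<le> \<bar>c\<bar> * C'" unfolding abs_mult using g by (intro mult_left_mono) (auto simp: bsupp_def)
    moreover have "\<bar>f x\<bar> \<le> C" using f by (auto simp: bsupp_def)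
    ultimately show ?thesis by linarith
  qed
  moreover have "f x + c * g x = 0" if "\<exists>i<n. max R R' < x i" for x
    using that bsuppD[OF f(2), of _ x] bsuppD[OF g(2), of _ x] by auto
  ultimately have "bsupp n (max R R') (C + \<bar>c\<bar> * C') (\<lambda>x. f x + c * g x)"
    by (auto simp: bsupp_def)
  moreover have "(\<lambda>x. f x + c * g x) \<in> borel_measurable (Rn n)"
    using assms unfolding B0_iff by auto
  ultimately show ?thesis using f(1) unfolding B0_iff by (intro conjI exI[of _ "max R R'"] exI) auto
qed

lemma B0_zero: "(\<lambda>_. 0) \<in> B0 n"
  unfolding B0_iff by (auto intro!: exI[of _ 0] simp: bsupp_def)

lemma B0_scale: "f \<in> B0 n \<Longrightarrow> (\<lambda>x. c * f x) \<in> B0 n"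
  using B0_lincomb[OF B0_zero, of f n c] by simp

lemma B0_add: "f \<in> B0 n \<Longrightarrow> g \<in> B0 n \<Longrightarrow> (\<lambda>x. f x + g x) \<in> B0 n"
  using B0_lincomb[of f n g 1] by simp

lemma level_inner_ev:
  assumes "F \<in> B0 (length ls)" "G \<in> B0 (length ls')"
  shows "level_inner \<nu> m (level_vec \<nu> ls F) (level_vec \<nu> ls' G) = (if ls = ls' \<and> m = length ls then (\<Prod>i<m. cconst \<nu> (Suc (ls ! i))) *
      (\<integral>t. indicator (T_set m) t * F t * G t \<partial>Rn m) else 0)"
proof (cases "m = length ls \<and> m = length ls'")
  case True
  then have m: "length ls = m" "length ls' = m" by auto
  have "level_inner \<nu> m (level_vec \<nu> ls F) (level_vec \<nu> ls' G)
    = (\<integral>z. indicator (S_set m) z * (poly_wt \<nu> ls z * F (tcoords m z)) * (poly_wt \<nu> ls' z * G (tcoords m z)) \<partial>fock_measure \<nu> m)"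
    unfolding level_inner_def level_vec_def m by simp
  also note level_inner_prod(2)[OF assms[unfolded m] m]
  finally show ?thesis using m by simp
next
  case False
  then have "indicator (S_set m) z * level_vec \<nu> ls F m z * level_vec \<nu> ls' G m z = 0" for z by (auto simp: level_vec_def)
  then have "level_inner \<nu> m (level_vec \<nu> ls F) (level_vec \<nu> ls' G) = 0"
    unfolding level_inner_def by (intro integral_eq_zero_AE AE_I2)
  with False show ?thesis by auto
qed

lemma level_vec_fock_space:
  assumes F: "F \<in> B0 (length ls)" shows "level_vec \<nu> ls F \<in> fock_space \<nu>"
proof (rule fock_spaceI)
  fix m
  show "level_vec \<nu> ls F m \<in> borel_measurable (fock_measure \<nu> m)"
  proof (cases "m = length ls")
    case True
    have "(\<lambda>z. poly_wt \<nu> ls z) \<in> borel_measurable (fock_measure \<nu> m)"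
      unfolding poly_wt_prod True by (rule borel_measurable_prod) (use poly_snd_measurable in auto)
    moreover have "(\<lambda>z. F (tcoords m z)) \<in> borel_measurable (fock_measure \<nu> m)"
      using F by (intro measurable_compose[OF tcoords_measurable]) (simp add: B0_iff True)
    ultimately show ?thesis using True by (simp add: level_vec_def)
  qed (simp add: level_vec_def)
  show "integrable (fock_measure \<nu> m) (\<lambda>z. indicator (S_set m) z * level_vec \<nu> ls F m z * level_vec \<nu> ls F m z)"
  proof (cases "m = length ls")
    case True
    then have m: "length ls = m" by simp
    show ?thesis unfolding level_vec_def m using level_inner_prod(1)[OF F[unfolded m] F[unfolded m] m m] by simp
  qed (simp add: level_vec_def)
next
  show "summable (\<lambda>m. level_inner \<nu> m (level_vec \<nu> ls F) (level_vec \<nu> ls F))"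
    by (rule summable_finite[of "{length ls}"]) (auto simp: level_inner_ev[OF F F])
qed

lemma level_vec_inner:
  assumes "F \<in> B0 (length ls)" "G \<in> B0 (length ls')"
  shows "fock_inner \<nu> (level_vec \<nu> ls F) (level_vec \<nu> ls' G) = (if ls = ls' then (\<Prod>i<length ls. cconst \<nu> (Suc (ls ! i))) *
      (\<integral>t. indicator (T_set (length ls)) t * F t * G t \<partial>Rn (length ls)) else 0)"
proof -
  have "fock_inner \<nu> (level_vec \<nu> ls F) (level_vec \<nu> ls' G) = (\<Sum>m\<in>{length ls}. level_inner \<nu> m (level_vec \<nu> ls F) (level_vec \<nu> ls' G))"
    unfolding fock_inner_lev by (rule suminf_finite) (auto simp: level_inner_ev[OF assms])
  then show ?thesis by (simp add: level_inner_ev[OF assms])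
qed

lemma zero_fock_space: "(\<lambda>m z. 0) \<in> fock_space \<nu>"
  by (rule fock_spaceI) (auto simp: level_inner_def)

lemma level_comb_insert:
  "finite A \<Longrightarrow> ls \<notin> A \<Longrightarrow> level_comb \<nu> (insert ls A) H = (\<lambda>m z. level_vec \<nu> ls (H ls) m z + 1 * level_comb \<nu> A H m z)"
  by (simp add: level_comb_def)

lemma level_comb_fock_space:
  assumes "finite A" "\<And>ls. ls \<in> A \<Longrightarrow> H ls \<in> B0 (length ls)"
  shows "level_comb \<nu> A H \<in> fock_space \<nu>"
  using assms
proof (induction A rule: finite_induct)
  case empty
  then show ?case using zero_fock_space by (simp add: level_comb_def)
next
  case (insert ls A)
  then show ?case
    unfolding level_comb_insert[OF insert.hyps(1,2)] by (intro fock_space_add level_vec_fock_space) auto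
qed

lemma level_comb_inner_left:
  assumes "finite A" "\<And>ls. ls \<in> A \<Longrightarrow> H ls \<in> B0 (length ls)" "\<phi> \<in> fock_space \<nu>"
  shows "fock_inner \<nu> (level_comb \<nu> A H) \<phi> = (\<Sum>ls\<in>A. fock_inner \<nu> (level_vec \<nu> ls (H ls)) \<phi>)"
  using assms(1,2)
proof (induction A rule: finite_induct)
  case empty
  then show ?case by (simp add: level_comb_def fock_inner_lev level_inner_def)
next
  case (insert ls A)
  have "fock_inner \<nu> (level_comb \<nu> (insert ls A) H) \<phi> = fock_inner \<nu> (level_vec \<nu> ls (H ls)) \<phi> + 1 * fock_inner \<nu> (level_comb \<nu> A H) \<phi>"
    unfolding level_comb_insert[OF insert.hyps(1,2)] using insert.prems insert.hyps(1)
    by (intro fock_inner_add_left level_vec_fock_space level_comb_fock_space assms(3)) auto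
  then show ?case using insert by simp
qed

lemma level_comb_inner:
  assumes A: "finite A" "\<And>ls. ls \<in> A \<Longrightarrow> H ls \<in> B0 (length ls)"
    and A': "finite A'" "\<And>ls. ls \<in> A' \<Longrightarrow> H' ls \<in> B0 (length ls)"
  shows "fock_inner \<nu> (level_comb \<nu> A H) (level_comb \<nu> A' H') = (\<Sum>ls\<in>A \<inter> A'. (\<Prod>i<length ls. cconst \<nu> (Suc (ls ! i))) *
      (\<integral>t. indicator (T_set (length ls)) t * H ls t * H' ls t \<partial>Rn (length ls)))"
proof -
  have "fock_inner \<nu> (level_comb \<nu> A H) (level_comb \<nu> A' H') = (\<Sum>ls\<in>A. fock_inner \<nu> (level_vec \<nu> ls (H ls)) (level_comb \<nu> A' H'))"
    by (intro level_comb_inner_left level_comb_fock_space A A')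
  also have "\<dots> = (\<Sum>ls\<in>A. \<Sum>ls'\<in>A'. fock_inner \<nu> (level_vec \<nu> ls (H ls)) (level_vec \<nu> ls' (H' ls')))"
  proof (intro sum.cong refl)
    fix ls assume "ls \<in> A"
    then have e: "level_vec \<nu> ls (H ls) \<in> fock_space \<nu>" by (intro level_vec_fock_space A)
    have "fock_inner \<nu> (level_vec \<nu> ls (H ls)) (level_comb \<nu> A' H') = fock_inner \<nu> (level_comb \<nu> A' H') (level_vec \<nu> ls (H ls))"
      by (rule fock_inner_commute)
    also have "\<dots> = (\<Sum>ls'\<in>A'. fock_inner \<nu> (level_vec \<nu> ls' (H' ls')) (level_vec \<nu> ls (H ls)))"
      by (rule level_comb_inner_left[OF A' e])
    also have "\<dots> = (\<Sum>ls'\<in>A'. fock_inner \<nu> (level_vec \<nu> ls (H ls)) (level_vec \<nu> ls' (H' ls')))"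
      by (intro sum.cong refl fock_inner_commute)
    finally show "fock_inner \<nu> (level_vec \<nu> ls (H ls)) (level_comb \<nu> A' H')
      = (\<Sum>ls'\<in>A'. fock_inner \<nu> (level_vec \<nu> ls (H ls)) (level_vec \<nu> ls' (H' ls')))" .
  qed
  also have "\<dots> = (\<Sum>ls\<in>A. \<Sum>ls'\<in>A'. if ls' = ls then (\<Prod>i<length ls. cconst \<nu> (Suc (ls ! i))) *
      (\<integral>t. indicator (T_set (length ls)) t * H ls t * H' ls t \<partial>Rn (length ls)) else 0)"
    using A(2) A'(2) by (intro sum.cong refl) (auto simp: level_vec_inner)
  also have "\<dots> = (\<Sum>ls\<in>A. if ls \<in> A' then (\<Prod>i<length ls. cconst \<nu> (Suc (ls ! i))) *
      (\<integral>t. indicator (T_set (length ls)) t * H ls t * H' ls t \<partial>Rn (length ls)) else 0)"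
    using A'(1) by simp
  finally show ?thesis using A(1) by (simp add: sum.inter_restrict)
qed

text \<open>Passes from boxes to tuples sorted by order; discarded and added tuples contribute 0 by
  \<open>ker_big\<close>. One index set serves all levels because \<open>level_vec\<close> vanishes
  off its own level.\<close>

lemma mono_comb:
  assumes f: "f \<in> B0 n" and z: "z \<in> S_set m" and N: "n \<le> N"
  shows "mono \<nu> n f vacuum m z = level_comb \<nu> (Wle N) (\<lambda>ls. ker n ls f) m z"
proof -
  let ?D = "{ls \<in> Wle n. length ls = m}"
  have "mono \<nu> n f vacuum m z = (\<Sum>ls\<in>boxes (Suc n) m. poly_wt \<nu> ls z * ker n ls f (tcoords m z))"
    using f z by (intro mono_expand) auto
  also have "\<dots> = (\<Sum>ls\<in>?D. poly_wt \<nu> ls z * ker n ls f (tcoords m z))"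
  proof (rule sum.mono_neutral_right)
    show "?D \<subseteq> boxes (Suc n) m"
      using wlen_bounds(2) by (fastforce simp: boxes_def Wle_def)
    show "\<forall>ls\<in>boxes (Suc n) m - ?D. poly_wt \<nu> ls z * ker n ls f (tcoords m z) = 0"
      by (auto simp: boxes_def Wle_def intro!: ker_big)
  qed simp
  also have "\<dots> = (\<Sum>ls\<in>?D. level_vec \<nu> ls (ker n ls f) m z)"
    by (intro sum.cong refl) (auto simp: level_vec_def)
  also have "\<dots> = (\<Sum>ls\<in>Wle N. level_vec \<nu> ls (ker n ls f) m z)"
  proof (rule sum.mono_neutral_left)
    show "?D \<subseteq> Wle N" using N by (auto simp: Wle_def)
    show "\<forall>ls\<in>Wle N - ?D. level_vec \<nu> ls (ker n ls f) m z = 0"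
      by (auto simp: level_vec_def Wle_def intro!: ker_big)
  qed simp
  finally show ?thesis by (simp add: level_comb_def)
qed

text \<open>Equality is claimed on \<open>S_set\<close> only, where the kernel expansion of
  monomials is available; inner products see no more than that.\<close>

lemma polyvec_comb:
  assumes "p \<in> polyvec \<nu> N"
  shows "\<exists>H. (\<forall>ls. H ls \<in> B0 (length ls)) \<and> (\<forall>m. \<forall>z\<in>S_set m. p m z = level_comb \<nu> (Wle N) H m z)"
  using assms
proof induction
  case (mono_in k f)
  then show ?case
    using B0_ker mono_comb by (intro exI[of _ "\<lambda>ls. ker k ls f"]) auto
next
  case (add_in x y)
  then obtain H H' where "\<And>ls. H ls \<in> B0 (length ls)" "\<And>m z. z \<in> S_set m \<Longrightarrow> x m z = level_comb \<nu> (Wle N) H m z"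
    "\<And>ls. H' ls \<in> B0 (length ls)" "\<And>m z. z \<in> S_set m \<Longrightarrow> y m z = level_comb \<nu> (Wle N) H' m z" by blast
  then show ?case
    by (intro exI[of _ "\<lambda>ls t. H ls t + H' ls t"])
       (auto intro!: B0_add sum.cong simp: level_comb_def sum.distrib[symmetric] level_vec_def algebra_simps)
next
  case (scale_in x c)
  then obtain H where "\<And>ls. H ls \<in> B0 (length ls)" "\<And>m z. z \<in> S_set m \<Longrightarrow> x m z = level_comb \<nu> (Wle N) H m z" by blast
  then show ?case
    by (intro exI[of _ "\<lambda>ls t. c * H ls t"])
       (auto intro!: B0_scale sum.cong simp: level_comb_def sum_distrib_left level_vec_def)
qed

lemma polyvec_zero: "(\<lambda>m z. 0) \<in> polyvec \<nu> N"
  using polyvec.scale_in[OF polyvec.mono_in[of 0 N "\<lambda>_. 0" \<nu>], of 0] B0_zero by simp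

lemma polyvec_sum:
  assumes "finite A" "\<And>a. a \<in> A \<Longrightarrow> p a \<in> polyvec \<nu> N"
  shows "(\<lambda>m z. \<Sum>a\<in>A. p a m z) \<in> polyvec \<nu> N"
  using assms
proof (induction A rule: finite_induct)
  case empty
  then show ?case using polyvec_zero by simp
next
  case (insert a A)
  have "(\<lambda>m z. p a m z + (\<Sum>a\<in>A. p a m z)) \<in> polyvec \<nu> N"
    using insert by (intro polyvec.add_in) auto
  then show ?case using insert.hyps by simp
qed

text \<open>The witness is \<open>F\<close> transported to the stratum of \<open>ls\<close> and extended by zero; \<open>st j\<close> is a
  position in the \<open>j\<close>-th block.\<close>
lemma lift_exists:
  assumes F: "F \<in> B0 (length ls)"
  shows "\<exists>f\<in>B0 (wlen ls). \<forall>ls' t. wlen ls' = wlen ls \<longrightarrow> strict_dec (length ls') t \<longrightarrow> t \<in> extensional {..<length ls'} \<longrightarrow>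
    f (phi ls' t) = (if ls' = ls then F t else 0)"
proof -
  let ?m = "length ls" and ?k = "wlen ls"
  have "\<exists>st. \<forall>j. j < ?m \<longrightarrow> st j < ?k \<and> blk ls (st j) = j"
    by (rule choice) (use blk_surj in blast)
  then obtain st where st: "\<And>j. j < ?m \<Longrightarrow> st j < ?k" "\<And>j. j < ?m \<Longrightarrow> blk ls (st j) = j" by blast
  define T where "T x = restrict (\<lambda>j. x (st j)) {..<?m}" for x :: "nat \<Rightarrow> real"
  define C where "C x \<longleftrightarrow> (\<forall>i\<in>{..<?k}. x i = x (st (blk ls i))) \<and> (\<forall>j\<in>{..<?m - 1}. x (st (Suc j)) < x (st j))" for x :: "nat \<Rightarrow> real"
  define f where "f x = (if C x then F (T x) else 0)" for x
  have TC: "phi ls (T x) i = x i" if "C x" "i < ?k" for x i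
    using that by (simp add: phi_nth T_def blk_less C_def)
  obtain R D where R: "0 \<le> R" and D: "bsupp ?m R D F" using B0_bsupp[OF F] .
  have "f x = 0" if "\<exists>i<?k. R < x i" for x
  proof (cases "C x")
    case True
    from that obtain i where i: "i < ?k" "R < x i" by blast
    then have "R < T x (blk ls i)" using TC[OF True i(1)] by (simp add: phi_nth)
    then have "F (T x) = 0" using bsuppD[OF D blk_less[OF i(1)]] by blast
    then show ?thesis by (simp add: f_def)
  qed (simp add: f_def)
  moreover have "\<bar>f x\<bar> \<le> D" for x
    using D bsupp_nonneg[OF D] by (auto simp: f_def bsupp_def)
  ultimately have "bsupp ?k R D f" by (simp add: bsupp_def)
  moreover have "f \<in> borel_measurable (Rn ?k)"
    unfolding f_def
  proof (rule measurable_If)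
    have "T \<in> measurable (Rn ?k) (Rn ?m)"
      unfolding T_def by (rule measurable_restrict) (use Rn_nth in simp)
    then show "(\<lambda>x. F (T x)) \<in> borel_measurable (Rn ?k)"
      by (rule measurable_compose) (use F in \<open>simp add: B0_iff\<close>)
    have "Measurable.pred (Rn ?k) C"
      unfolding C_def
      by (intro pred_intros_logic pred_intros_finite; (simp; fail)?; unfold pred_def;
          intro borel_measurable_less borel_measurable_eq Rn_nth)
    then show "{x \<in> space (Rn ?k). C x} \<in> sets (Rn ?k)" by (simp add: pred_def)
  qed simp
  ultimately have "f \<in> B0 ?k" using R unfolding B0_iff by blast
  moreover have "f (phi ls' t) = (if ls' = ls then F t else 0)"
    if w: "wlen ls' = ?k" and s: "strict_dec (length ls') t" and e: "t \<in> extensional {..<length ls'}" for ls' t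
  proof (cases "ls' = ls")
    case True
    have pt: "phi ls t (st j) = t j" if "j < ?m" for j
      using st[OF that] by (simp add: phi_nth)
    then have "T (phi ls t) = t"
      using e True by (auto simp: T_def restrict_def extensional_def fun_eq_iff)
    moreover have "C (phi ls t)"
    proof -
      have "phi ls t (st (blk ls i)) = phi ls t i" if "i < ?k" for i
        using pt[OF blk_less[OF that]] that by (simp add: phi_nth)
      moreover have "phi ls t (st (Suc j)) < phi ls t (st j)" if "j < ?m - 1" for j
        using s that True by (simp add: pt strict_dec_def)
      ultimately show ?thesis by (auto simp: C_def)
    qed
    ultimately show ?thesis using True by (simp add: f_def)
  next
    case False
    \<comment> \<open>A point satisfying \<open>C\<close> is \<open>phi ls\<close> of strictly
      decreasing times, so \<open>phi_inj\<close> would force \<open>ls' = ls\<close>.\<close>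
    have "\<not> C (phi ls' t)"
    proof
      assume c: "C (phi ls' t)"
      have "phi ls (T (phi ls' t)) = phi ls' t"
      proof
        fix i show "phi ls (T (phi ls' t)) i = phi ls' t i"
          using TC[OF c, of i] w by (cases "i < ?k") (auto simp: phi_def)
      qed
      moreover have "strict_dec ?m (T (phi ls' t))"
        using c by (auto simp: strict_dec_def T_def C_def)
      ultimately have "ls = ls'" using s w by (intro phi_inj) auto
      with False show False by simp
    qed
    then show ?thesis using False by (simp add: f_def)
  qed
  ultimately show ?thesis by blast
qed

lemma strict_pts_sdec: "z \<in> strict_pts m \<Longrightarrow> strict_dec m (tcoords m z)"
  unfolding strict_dec_def strict_pts_def S_set_def tcoords_def
  by (auto simp: less_le)

text \<open>Triangular elimination by induction on the order: the lower kernels left over from the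
  monomial are polynomials already and are subtracted. Agreement holds on \<open>strict_pts\<close>
  because the function of \<open>lift_exists\<close> is controlled only at strictly decreasing
  times.\<close>

lemma level_vec_polyvec:
  assumes "F \<in> B0 (length ls)" "wlen ls \<le> N"
  shows "\<exists>p\<in>polyvec \<nu> N. \<forall>m. \<forall>z\<in>strict_pts m. level_vec \<nu> ls F m z = p m z"
  using assms
proof (induction "wlen ls" arbitrary: ls F rule: less_induct)
  case less
  let ?k = "wlen ls"
  obtain f where f: "f \<in> B0 ?k" and fp: "\<And>ls' t. wlen ls' = ?k \<Longrightarrow> strict_dec (length ls') t \<Longrightarrow>
      t \<in> extensional {..<length ls'} \<Longrightarrow> f (phi ls' t) = (if ls' = ls then F t else 0)"
    using lift_exists[OF less.prems(1)] by blast
  have "\<exists>p. \<forall>ls'. ls' \<in> Wlt ?k \<longrightarrow> p ls' \<in> polyvec \<nu> N \<and> (\<forall>m. \<forall>z\<in>strict_pts m. level_vec \<nu> ls' (ker ?k ls' f) m z = p ls' m z)"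
  proof (rule choice, rule allI)
    fix ls'
    show "\<exists>p. ls' \<in> Wlt ?k \<longrightarrow> p \<in> polyvec \<nu> N \<and> (\<forall>m. \<forall>z\<in>strict_pts m. level_vec \<nu> ls' (ker ?k ls' f) m z = p m z)"
    proof (cases "ls' \<in> Wlt ?k")
      case True
      then have "wlen ls' < ?k" by (simp add: Wlt_def)
      from less.hyps[OF this B0_ker[OF f]] this less.prems(2) show ?thesis by auto
    qed simp
  qed
  then obtain p where p: "\<And>ls'. ls' \<in> Wlt ?k \<Longrightarrow> p ls' \<in> polyvec \<nu> N"
    "\<And>ls' m z. ls' \<in> Wlt ?k \<Longrightarrow> z \<in> strict_pts m \<Longrightarrow> level_vec \<nu> ls' (ker ?k ls' f) m z = p ls' m z" by blast
  define q where "q = (\<lambda>m z. mono \<nu> ?k f vacuum m z + (- 1) * (\<Sum>ls'\<in>Wlt ?k. p ls' m z))"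
  have "q \<in> polyvec \<nu> N"
    unfolding q_def
    by (intro polyvec.add_in polyvec.mono_in[OF less.prems(2) f] polyvec.scale_in[of "\<lambda>m z. \<Sum>ls'\<in>Wlt ?k. p ls' m z"] polyvec_sum p) auto
  moreover have "level_vec \<nu> ls F m z = q m z" if z: "z \<in> strict_pts m" for m z
  proof -
    have top: "level_vec \<nu> ls' (ker ?k ls' f) m z = (if ls' = ls then level_vec \<nu> ls F m z else 0)" if "ls' \<in> Wn ?k" for ls'
    proof -
      have w: "wlen ls' = ?k" using that by (simp add: Wn_def)
      show ?thesis
      proof (cases "m = length ls'")
        case True
        have "tcoords m z \<in> extensional {..<length ls'}" by (auto simp: tcoords_def True)
        then have "f (phi ls' (tcoords m z)) = (if ls' = ls then F (tcoords m z) else 0)"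
          using strict_pts_sdec[OF z] w unfolding True by (intro fp) auto
        then show ?thesis using True by (auto simp: level_vec_def ker_top[OF w])
      qed (auto simp: level_vec_def)
    qed
    have "z \<in> S_set m" using z by (simp add: strict_pts_def)
    then have "mono \<nu> ?k f vacuum m z = level_comb \<nu> (Wle ?k) (\<lambda>ls. ker ?k ls f) m z"
      by (rule mono_comb[OF f]) simp
    also have "\<dots> = (\<Sum>ls'\<in>Wn ?k. level_vec \<nu> ls' (ker ?k ls' f) m z) + (\<Sum>ls'\<in>Wlt ?k. level_vec \<nu> ls' (ker ?k ls' f) m z)"
      unfolding level_comb_def Wle_split(1) by (rule sum.union_disjoint) (auto simp: Wle_split(2))
    also have "(\<Sum>ls'\<in>Wn ?k. level_vec \<nu> ls' (ker ?k ls' f) m z) = (\<Sum>ls'\<in>Wn ?k. if ls' = ls then level_vec \<nu> ls F m z else 0)"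
      by (intro sum.cong refl top)
    also have "\<dots> = level_vec \<nu> ls F m z"
      by (subst sum.delta) (simp_all, simp add: Wn_def)
    also have "(\<Sum>ls'\<in>Wlt ?k. level_vec \<nu> ls' (ker ?k ls' f) m z) = (\<Sum>ls'\<in>Wlt ?k. p ls' m z)"
      by (intro sum.cong refl p(2) z)
    finally show ?thesis by (simp add: q_def)
  qed
  ultimately show ?case by blast
qed

text \<open>The combination agrees with a polynomial off a null set, hence has distance 0 from it; a
  constant approximating sequence suffices.\<close>

lemma level_comb_fclos:
  assumes A: "A \<subseteq> Wle N" and H: "\<And>ls. ls \<in> A \<Longrightarrow> H ls \<in> B0 (length ls)"
  shows "level_comb \<nu> A H \<in> fclos \<nu> (polyvec \<nu> N)"
proof -
  have fin: "finite A" using A finite_Wle by (rule finite_subset)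
  have "\<exists>p. \<forall>ls. ls \<in> A \<longrightarrow> p ls \<in> polyvec \<nu> N \<and> (\<forall>m. \<forall>z\<in>strict_pts m. level_vec \<nu> ls (H ls) m z = p ls m z)"
  proof (rule choice, rule allI)
    fix ls
    show "\<exists>p. ls \<in> A \<longrightarrow> p \<in> polyvec \<nu> N \<and> (\<forall>m. \<forall>z\<in>strict_pts m. level_vec \<nu> ls (H ls) m z = p m z)"
    proof (cases "ls \<in> A")
      case True
      then have "wlen ls \<le> N" using A by (auto simp: Wle_def)
      from level_vec_polyvec[OF H[OF True] this] show ?thesis by blast
    qed simp
  qed
  then obtain p where p: "\<And>ls. ls \<in> A \<Longrightarrow> p ls \<in> polyvec \<nu> N"
    "\<And>ls m z. ls \<in> A \<Longrightarrow> z \<in> strict_pts m \<Longrightarrow> level_vec \<nu> ls (H ls) m z = p ls m z" by blast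
  define q where "q = (\<lambda>m z. \<Sum>ls\<in>A. p ls m z)"
  have q: "q \<in> polyvec \<nu> N" unfolding q_def by (intro polyvec_sum fin p)
  have "fock_norm \<nu> (\<lambda>m z. level_comb \<nu> A H m z - q m z) = 0"
    by (rule fock_norm_strict) (auto simp: level_comb_def q_def p(2))
  then show ?thesis
    unfolding fclos_def using q level_comb_fock_space[OF fin H]
    by (intro CollectI conjI exI[of _ "\<lambda>_. q"]) auto
qed

text \<open>Orthogonality passes to the closure by Cauchy-Schwarz. Each approximant is first
  replaced by a combination of kernels equal to it on \<open>S_set\<close>, which is known to lie in
  \<open>fock_space\<close>.\<close>

lemma fclos_orth:
  assumes y: "y \<in> fock_space \<nu>"
    and orth: "\<And>H. (\<forall>ls. H ls \<in> B0 (length ls)) \<Longrightarrow> fock_inner \<nu> y (level_comb \<nu> (Wle N) H) = 0"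
    and w: "w \<in> fclos \<nu> (polyvec \<nu> N)"
  shows "fock_inner \<nu> y w = 0"
proof -
  from w obtain \<phi> where ws: "w \<in> fock_space \<nu>" and \<phi>: "\<And>k. \<phi> k \<in> polyvec \<nu> N"
    and lim: "(\<lambda>k. fock_norm \<nu> (\<lambda>m z. w m z - \<phi> k m z)) \<longlonglongrightarrow> 0"
    unfolding fclos_def by blast
  have "\<bar>fock_inner \<nu> y w\<bar> \<le> fock_norm \<nu> y * fock_norm \<nu> (\<lambda>m z. w m z - \<phi> k m z)" for k
  proof -
    obtain H where H: "\<And>ls. H ls \<in> B0 (length ls)" "\<And>m z. z \<in> S_set m \<Longrightarrow> \<phi> k m z = level_comb \<nu> (Wle N) H m z"
      using polyvec_comb[OF \<phi>[of k]] by blast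
    let ?c = "level_comb \<nu> (Wle N) H"
    have c: "?c \<in> fock_space \<nu>" by (intro level_comb_fock_space finite_Wle H)
    have "fock_inner \<nu> y w = fock_inner \<nu> y (\<lambda>m z. w m z - ?c m z)"
      using orth[of H] H(1) by (simp add: fock_inner_diff_right[OF ws c y])
    also have "\<bar>\<dots>\<bar> \<le> fock_norm \<nu> y * fock_norm \<nu> (\<lambda>m z. w m z - ?c m z)"
      by (intro fock_Cauchy_Schwarz y fock_space_diff ws c)
    also have "fock_norm \<nu> (\<lambda>m z. w m z - ?c m z) = fock_norm \<nu> (\<lambda>m z. w m z - \<phi> k m z)"
      by (rule fock_norm_cong) (simp add: H(2))
    finally show ?thesis .
  qed
  moreover have "(\<lambda>k. fock_norm \<nu> y * fock_norm \<nu> (\<lambda>m z. w m z - \<phi> k m z)) \<longlonglongrightarrow> 0"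
    using tendsto_mult_left[OF lim] by simp
  ultimately have "\<bar>fock_inner \<nu> y w\<bar> \<le> 0" by (intro LIMSEQ_le_const) auto
  then show ?thesis by simp
qed

text \<open>By \<open>ker_top\<close>, the part of the monomial consisting of its kernels of order
  exactly \<open>n\<close>; it is the candidate for the projection.\<close>

definition orth_vec :: "nat \<Rightarrow> ((nat \<Rightarrow> real) \<Rightarrow> real) \<Rightarrow> fock" where
  "orth_vec n f = level_comb \<nu> (Wn n) (\<lambda>ls t. f (phi ls t))"

text \<open>The composition is itself a coefficient \<open>ker n ls f\<close>, so measurability and
  bounds are inherited from there.\<close>

lemma B0_phi:
  assumes "f \<in> B0 n" "ls \<in> Wn n" shows "(\<lambda>t. f (phi ls t)) \<in> B0 (length ls)"
proof -
  have "ker n ls f = (\<lambda>t. f (phi ls t))" using assms(2) by (intro ext ker_top) (simp add: Wn_def)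
  then show ?thesis using B0_ker[OF assms(1), of ls] by simp
qed

lemma orth_vec_fock_space: "f \<in> B0 n \<Longrightarrow> orth_vec n f \<in> fock_space \<nu>"
  unfolding orth_vec_def by (intro level_comb_fock_space B0_phi) auto

lemma orth_vec_Sspace:
  assumes n: "1 \<le> n" and f: "f \<in> B0 n"
  shows "orth_vec n f \<in> Sspace \<nu> n"
proof -
  have "orth_vec n f \<in> fclos \<nu> (polyvec \<nu> n)"
    unfolding orth_vec_def using f by (intro level_comb_fclos B0_phi) (auto simp: Wn_def Wle_def)
  moreover have "fock_inner \<nu> (orth_vec n f) w = 0" if "w \<in> fclos \<nu> (polyvec \<nu> (n - 1))" for w
  proof (rule fclos_orth[OF orth_vec_fock_space[OF f] _ that])
    fix H :: "nat list \<Rightarrow> (nat \<Rightarrow> real) \<Rightarrow> real" assume H: "\<forall>ls. H ls \<in> B0 (length ls)"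
    \<comment> \<open>Here \<open>1 \<le> n\<close> matters: for \<open>n = 0\<close> truncated
      subtraction would leave \<open>[]\<close> in both sets.\<close>
    have "Wn n \<inter> Wle (n - 1) = {}" using n by (auto simp: Wn_def Wle_def)
    moreover have "fock_inner \<nu> (orth_vec n f) (level_comb \<nu> (Wle (n - 1)) H) = (\<Sum>ls\<in>Wn n \<inter> Wle (n - 1).
        (\<Prod>i<length ls. cconst \<nu> (Suc (ls ! i))) *
        (\<integral>t. indicator (T_set (length ls)) t * f (phi ls t) * H ls t \<partial>Rn (length ls)))"
      unfolding orth_vec_def using H f by (intro level_comb_inner B0_phi) auto
    ultimately show "fock_inner \<nu> (orth_vec n f) (level_comb \<nu> (Wle (n - 1)) H) = 0" by simp
  qed
  ultimately show ?thesis by (simp add: Sspace_def)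
qed

lemma mono_Qv:
  assumes n: "1 \<le> n" and f: "f \<in> B0 n"
  obtains r where "r \<in> fclos \<nu> (polyvec \<nu> (n - 1))" "\<And>m z. z \<in> S_set m \<Longrightarrow> mono \<nu> n f vacuum m z = orth_vec n f m z + r m z"
proof
  let ?r = "level_comb \<nu> (Wlt n) (\<lambda>ls. ker n ls f)"
  show "?r \<in> fclos \<nu> (polyvec \<nu> (n - 1))"
    using n by (intro level_comb_fclos B0_ker f) (auto simp: Wlt_def Wle_def)
  fix m z assume "z \<in> S_set m"
  then have "mono \<nu> n f vacuum m z = level_comb \<nu> (Wle n) (\<lambda>ls. ker n ls f) m z"
    by (rule mono_comb[OF f]) simp
  also have "\<dots> = level_comb \<nu> (Wn n) (\<lambda>ls. ker n ls f) m z + ?r m z"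
    unfolding level_comb_def Wle_split(1) by (rule sum.union_disjoint) (auto simp: Wle_split(2))
  also have "level_comb \<nu> (Wn n) (\<lambda>ls. ker n ls f) m z = orth_vec n f m z"
    unfolding orth_vec_def level_comb_def by (intro sum.cong refl) (auto simp: level_vec_def Wn_def ker_top)
  finally show "mono \<nu> n f vacuum m z = orth_vec n f m z + ?r m z" .
qed

lemma fclos_fock_space: "w \<in> fclos \<nu> A \<Longrightarrow> w \<in> fock_space \<nu>"
  by (simp add: fclos_def)

lemma Sspace_fock_space: "w \<in> Sspace \<nu> n \<Longrightarrow> w \<in> fock_space \<nu>"
  unfolding Sspace_def by (blast intro: fclos_fock_space)

lemma orth_vec_proj:
  assumes n: "1 \<le> n" and f: "f \<in> B0 n"
  shows "is_proj \<nu> (Sspace \<nu> n) (mono \<nu> n f vacuum) (orth_vec n f)"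
proof -
  obtain r where r: "r \<in> fclos \<nu> (polyvec \<nu> (n - 1))"
    and e: "\<And>m z. z \<in> S_set m \<Longrightarrow> mono \<nu> n f vacuum m z = orth_vec n f m z + r m z"
    using mono_Qv[OF assms] by blast
  have "fock_inner \<nu> (\<lambda>m z. mono \<nu> n f vacuum m z - orth_vec n f m z) w = 0" if w: "w \<in> Sspace \<nu> n" for w
  proof -
    have "fock_inner \<nu> (\<lambda>m z. mono \<nu> n f vacuum m z - orth_vec n f m z) w = fock_inner \<nu> r w"
      by (rule fock_inner_cong) (simp add: e)
    also have "\<dots> = fock_inner \<nu> w r" by (rule fock_inner_commute)
    also have "\<dots> = 0" using w r by (simp add: Sspace_def)
    finally show ?thesis .
  qed
  then show ?thesis using orth_vec_Sspace[OF assms] by (simp add: is_proj_def)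
qed

text \<open>The chosen vector and \<open>orth_vec n f\<close> are both projections, so their
  difference is orthogonal to \<open>Sspace\<close>, in particular to both of them. It is therefore
  orthogonal to itself, and a null vector pairs to 0 with everything.\<close>

lemma orth_poly_Qv:
  assumes n: "1 \<le> n" and f: "f \<in> B0 n"
  shows "orth_poly \<nu> n f \<in> fock_space \<nu>"
    and "\<phi> \<in> fock_space \<nu> \<Longrightarrow> fock_inner \<nu> (orth_poly \<nu> n f) \<phi> = fock_inner \<nu> (orth_vec n f) \<phi>"
proof -
  let ?y = "orth_poly \<nu> n f" and ?Q = "orth_vec n f"
  have y: "is_proj \<nu> (Sspace \<nu> n) (mono \<nu> n f vacuum) ?y"
    unfolding orth_poly_def by (rule someI[of "is_proj \<nu> (Sspace \<nu> n) (mono \<nu> n f vacuum)", OF orth_vec_proj[OF assms]])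
  have yS: "?y \<in> Sspace \<nu> n" and QS: "?Q \<in> Sspace \<nu> n"
    using y orth_vec_Sspace[OF assms] by (auto simp: is_proj_def)
  have yf: "?y \<in> fock_space \<nu>" and Qf: "?Q \<in> fock_space \<nu>"
    using yS QS Sspace_fock_space by auto
  obtain r where r: "r \<in> fclos \<nu> (polyvec \<nu> (n - 1))"
    and e: "\<And>m z. z \<in> S_set m \<Longrightarrow> mono \<nu> n f vacuum m z = orth_vec n f m z + r m z"
    using mono_Qv[OF assms] by blast
  \<comment> \<open>A stand-in for the monomial: equal to it on \<open>S_set\<close> and visibly in
    \<open>fock_space\<close>, so that inner products can be split.\<close>
  define x where "x = (\<lambda>m z. ?Q m z + 1 * r m z)"
  have x: "x \<in> fock_space \<nu>"
    unfolding x_def by (intro fock_space_add Qf fclos_fock_space[OF r])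
  have eq: "fock_inner \<nu> v w = fock_inner \<nu> x w"
    if w: "w \<in> Sspace \<nu> n" and v: "is_proj \<nu> (Sspace \<nu> n) (mono \<nu> n f vacuum) v" for v w
  proof -
    have "v \<in> Sspace \<nu> n" using v by (simp add: is_proj_def)
    then have vf: "v \<in> fock_space \<nu>" by (rule Sspace_fock_space)
    have "0 = fock_inner \<nu> (\<lambda>m z. mono \<nu> n f vacuum m z - v m z) w"
      using v w by (simp add: is_proj_def)
    also have "\<dots> = fock_inner \<nu> (\<lambda>m z. x m z - v m z) w"
      by (rule fock_inner_cong) (simp add: e x_def)
    also have "\<dots> = fock_inner \<nu> x w - fock_inner \<nu> v w"
      by (rule fock_inner_diff_left[OF x vf Sspace_fock_space[OF w]])
    finally show ?thesis by simp
  qed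
  let ?d = "\<lambda>m z. ?y m z - ?Q m z"
  have d: "?d \<in> fock_space \<nu>" by (rule fock_space_diff[OF yf Qf])
  have dw: "fock_inner \<nu> ?d w = 0" if "w \<in> Sspace \<nu> n" for w
    using eq[OF that y] eq[OF that orth_vec_proj[OF assms]]
    by (simp add: fock_inner_diff_left[OF yf Qf Sspace_fock_space[OF that]])
  have "fock_inner \<nu> ?d ?d = 0"
    by (simp add: fock_inner_diff_right[OF yf Qf d] dw yS QS)
  then have "fock_inner \<nu> ?d \<phi> = 0" if "\<phi> \<in> fock_space \<nu>" for \<phi>
    using fock_inner_null[OF d that] by simp
  then show "\<phi> \<in> fock_space \<nu> \<Longrightarrow> fock_inner \<nu> ?y \<phi> = fock_inner \<nu> ?Q \<phi>"
    by (simp add: fock_inner_diff_left[OF yf Qf])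
  show "?y \<in> fock_space \<nu>" by (rule yf)
qed

lemma orth_poly_inner:
  assumes n: "1 \<le> n" and f: "f \<in> B0 n" and g: "g \<in> B0 n"
  shows "fock_inner \<nu> (orth_poly \<nu> n f) (orth_poly \<nu> n g) = (\<Sum>ls\<in>Wn n. (\<Prod>i<length ls. cconst \<nu> (Suc (ls ! i))) *
      (\<integral>t. indicator (T_set (length ls)) t * f (phi ls t) * g (phi ls t) \<partial>Rn (length ls)))"
proof -
  have "fock_inner \<nu> (orth_poly \<nu> n f) (orth_poly \<nu> n g) = fock_inner \<nu> (orth_vec n f) (orth_poly \<nu> n g)"
    by (rule orth_poly_Qv(2)[OF n f orth_poly_Qv(1)[OF n g]])
  also have "\<dots> = fock_inner \<nu> (orth_poly \<nu> n g) (orth_vec n f)" by (rule fock_inner_commute)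
  also have "\<dots> = fock_inner \<nu> (orth_vec n g) (orth_vec n f)"
    by (rule orth_poly_Qv(2)[OF n g orth_vec_fock_space[OF f]])
  also have "\<dots> = fock_inner \<nu> (orth_vec n f) (orth_vec n g)" by (rule fock_inner_commute)
  also have "\<dots> = (\<Sum>ls\<in>Wn n \<inter> Wn n. (\<Prod>i<length ls. cconst \<nu> (Suc (ls ! i))) *
      (\<integral>t. indicator (T_set (length ls)) t * f (phi ls t) * g (phi ls t) \<partial>Rn (length ls)))"
    unfolding orth_vec_def using f g by (intro level_comb_inner B0_phi) auto
  finally show ?thesis by simp
qed

end

section \<open>The measure \<open>m_n\<close>\<close>

lemma emeasure_sum_measure:
  assumes I: "finite I" and M: "\<And>i. i \<in> I \<Longrightarrow> sets (M i) = sets N" and A: "A \<in> sets N"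
  shows "emeasure (measure_of (space N) (sets N) (\<lambda>A. \<Sum>i\<in>I. emeasure (M i) A)) A = (\<Sum>i\<in>I. emeasure (M i) A)"
proof (rule emeasure_measure_of[OF refl sets.space_closed])
  let ?S = "sets (measure_of (space N) (sets N) (\<lambda>A. \<Sum>i\<in>I. emeasure (M i) A))"
  have S: "?S = sets N" by simp
  show "A \<in> ?S" using A by simp
  show "positive ?S (\<lambda>A. \<Sum>i\<in>I. emeasure (M i) A)" by (simp add: positive_def)
  show "countably_additive ?S (\<lambda>A. \<Sum>i\<in>I. emeasure (M i) A)"
    unfolding S
  proof (rule countably_additiveI)
    fix F :: "nat \<Rightarrow> 'b set"
    assume F: "range F \<subseteq> sets N" "disjoint_family F"
    have "(\<Sum>k. \<Sum>i\<in>I. emeasure (M i) (F k)) = (\<Sum>i\<in>I. \<Sum>k. emeasure (M i) (F k))"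
      by (rule suminf_sum) simp
    also have "\<dots> = (\<Sum>i\<in>I. emeasure (M i) (\<Union>k. F k))"
      using F M by (intro sum.cong refl suminf_emeasure) auto
    finally show "(\<Sum>k. \<Sum>i\<in>I. emeasure (M i) (F k)) = (\<Sum>i\<in>I. emeasure (M i) (\<Union>k. F k))" .
  qed
qed

text \<open>Induction over nonnegative measurable functions; in the limit step the supremum commutes
  with the finite sum because the integrals increase.\<close>

lemma nn_integral_sum_measure:
  assumes I: "finite I" and M: "\<And>i. i \<in> I \<Longrightarrow> sets (M i) = sets N" and f: "f \<in> borel_measurable N"
  shows "(\<integral>\<^sup>+x. f x \<partial>measure_of (space N) (sets N) (\<lambda>A. \<Sum>i\<in>I. emeasure (M i) A)) = (\<Sum>i\<in>I. \<integral>\<^sup>+x. f x \<partial>M i)"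
proof -
  let ?S = "measure_of (space N) (sets N) (\<lambda>A. \<Sum>i\<in>I. emeasure (M i) A)"
  have S: "sets ?S = sets N" by simp
  have mS: "g \<in> borel_measurable ?S" if "g \<in> borel_measurable N" for g :: "'b \<Rightarrow> ennreal"
    using that by (simp add: measurable_cong_sets[OF S refl])
  have mM: "g \<in> borel_measurable (M i)" if "i \<in> I" "g \<in> borel_measurable N" for i and g :: "'b \<Rightarrow> ennreal"
    using that(2) by (simp add: measurable_cong_sets[OF M[OF that(1)] refl])
  have spS: "space ?S = space N" using sets_eq_imp_space_eq[OF S] .
  have spM: "i \<in> I \<Longrightarrow> space (M i) = space N" for i using sets_eq_imp_space_eq[OF M] .
  show ?thesis using f
  proof (induction f rule: borel_measurable_induct)
    case (cong f g)
    have "(\<integral>\<^sup>+x. f x \<partial>?S) = (\<integral>\<^sup>+x. g x \<partial>?S)"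
    proof (rule nn_integral_cong)
      fix x assume "x \<in> space ?S"
      then have "x \<in> space N" unfolding spS .
      then show "f x = g x" by (rule cong(3))
    qed
    also have "\<dots> = (\<Sum>i\<in>I. \<integral>\<^sup>+x. g x \<partial>M i)" by (rule cong(4))
    also have "\<dots> = (\<Sum>i\<in>I. \<integral>\<^sup>+x. f x \<partial>M i)"
      using cong(3) by (intro sum.cong refl nn_integral_cong) (simp add: spM)
    finally show ?case .
  next
    case (set A)
    then show ?case
      using M by (simp add: emeasure_sum_measure[OF I M set] del: emeasure_measure_of_conv)
  next
    case (mult u c)
    then show ?case by (simp add: nn_integral_cmult mS mM sum_distrib_left)
  next
    case (add u v)
    then show ?case by (simp add: nn_integral_add mS mM sum.distrib)
  next
    case (seq U)
    have "(\<integral>\<^sup>+x. (SUP i. U i) x \<partial>?S) = (SUP i. \<integral>\<^sup>+x. U i x \<partial>?S)"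
      unfolding SUP_apply using seq by (intro nn_integral_monotone_convergence_SUP mS) auto
    also have "\<dots> = (SUP i. \<Sum>k\<in>I. \<integral>\<^sup>+x. U i x \<partial>M k)" using seq by simp
    also have "\<dots> = (\<Sum>k\<in>I. SUP i. \<integral>\<^sup>+x. U i x \<partial>M k)"
      using seq by (intro ennreal_SUP_sum) (auto simp: incseq_def le_fun_def intro!: nn_integral_mono)
    also have "\<dots> = (\<Sum>k\<in>I. \<integral>\<^sup>+x. (SUP i. U i) x \<partial>M k)"
      unfolding SUP_apply using seq
      by (intro sum.cong refl nn_integral_monotone_convergence_SUP[symmetric] mM) auto
    finally show ?case .
  qed
qed

text \<open>Positive and negative parts have finite integral for each summand, so
  \<open>enn2real\<close> passes through the finite sums.\<close>

lemma integral_sum_measure: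
  fixes f :: "'a \<Rightarrow> real"
  assumes I: "finite I" and M: "\<And>i. i \<in> I \<Longrightarrow> sets (M i) = sets N" and f: "f \<in> borel_measurable N"
    and int: "\<And>i. i \<in> I \<Longrightarrow> integrable (M i) f"
  shows "(\<integral>x. f x \<partial>measure_of (space N) (sets N) (\<lambda>A. \<Sum>i\<in>I. emeasure (M i) A)) = (\<Sum>i\<in>I. \<integral>x. f x \<partial>M i)"
proof -
  let ?S = "measure_of (space N) (sets N) (\<lambda>A. \<Sum>i\<in>I. emeasure (M i) A)"
  have S: "sets ?S = sets N" by simp
  have nn: "(\<integral>\<^sup>+x. ennreal (g x) \<partial>?S) = (\<Sum>i\<in>I. \<integral>\<^sup>+x. ennreal (g x) \<partial>M i)" if "g \<in> borel_measurable N" for g :: "'a \<Rightarrow> real"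
    using that by (intro nn_integral_sum_measure[OF I M]) auto
  have fin: "(\<integral>\<^sup>+x. ennreal (f x) \<partial>M i) < top" "(\<integral>\<^sup>+x. ennreal (- f x) \<partial>M i) < top" if "i \<in> I" for i
    using int[OF that] by (auto simp: real_integrable_def top.not_eq_extremum)
  have "integrable ?S f"
    unfolding real_integrable_def
    using I f fin by (auto simp: nn measurable_cong_sets[OF S refl] top.not_eq_extremum)
  then have "integral\<^sup>L ?S f = enn2real (\<Sum>i\<in>I. \<integral>\<^sup>+x. ennreal (f x) \<partial>M i) - enn2real (\<Sum>i\<in>I. \<integral>\<^sup>+x. ennreal (- f x) \<partial>M i)"
    using f by (simp add: real_lebesgue_integral_def nn)
  also have "\<dots> = (\<Sum>i\<in>I. enn2real (\<integral>\<^sup>+x. ennreal (f x) \<partial>M i) - enn2real (\<integral>\<^sup>+x. ennreal (- f x) \<partial>M i))"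
    using fin by (simp add: enn2real_sum sum_subtractf)
  also have "\<dots> = (\<Sum>i\<in>I. integral\<^sup>L (M i) f)"
    by (intro sum.cong refl) (simp add: real_lebesgue_integral_def[OF int])
  finally show ?thesis .
qed

section \<open>Integrals over the strata\<close>

lemma Dec_T_set: "t \<in> Dec m \<Longrightarrow> t \<in> T_set m"
proof -
  assume t: "t \<in> Dec m"
  have le: "t j \<le> t i" if "i \<le> j" "j < m" for i j
    using that
  proof (induction rule: dec_induct)
    case (step n)
    then have "t (Suc n) < t n" using t by (auto simp: Dec_def)
    with step show ?case by simp
  qed simp
  moreover have "0 \<le> t i" if "i < m" for i
  proof -
    have "t (m - 1) \<le> t i" using that by (intro le) auto
    moreover have "0 \<le> t (m - 1)" using t that by (auto simp: Dec_def)
    ultimately show ?thesis by simp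
  qed
  ultimately show "t \<in> T_set m" by (auto simp: T_set_def)
qed

lemma T_set_Dec:
  assumes "t \<in> T_set m" "\<forall>i<m. \<forall>j<m. i \<noteq> j \<longrightarrow> t i \<noteq> t j" shows "t \<in> Dec m"
proof -
  have "t (Suc j) < t j" if "Suc j < m" for j
  proof -
    have "t (Suc j) \<le> t j" using assms(1) that unfolding T_set_def by simp
    moreover have "t (Suc j) \<noteq> t j" using assms(2) that by simp
    ultimately show ?thesis by simp
  qed
  moreover have "0 \<le> t (m - 1)" if "0 < m" using assms(1) that unfolding T_set_def by simp
  ultimately show ?thesis unfolding Dec_def by blast
qed

context compact_prob
begin

lemma cconst_prod_nonneg: "0 \<le> (\<Prod>i<m. cconst \<nu> (Suc (ls ! i)))"
  by (intro prod_nonneg) (simp add: cconst_Suc L_square_nonneg)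

lemma phi_measurable: "phi ls \<in> measurable (Rn (length ls)) (Rn (wlen ls))"
  unfolding phi_def by (rule measurable_restrict) (use Rn_nth in simp)

lemma Dec_measurable: "(\<lambda>t. indicator (Dec m) t :: real) \<in> borel_measurable (Rn m)"
proof -
  have "Measurable.pred (Rn m) (\<lambda>t. (\<forall>j\<in>{..<m - 1}. t (Suc j) < t j) \<and> (0 < m \<longrightarrow> 0 \<le> t (m - 1)))"
    by (intro pred_intros_logic pred_intros_finite; (simp; fail)?; unfold pred_def;
        intro borel_measurable_less borel_measurable_le Rn_nth borel_measurable_const)
  then have "Measurable.pred (Rn m) (\<lambda>t. t \<in> Dec m)"
    by (rule back_subst[where P = "Measurable.pred (Rn m)"]) (auto simp: fun_eq_iff Dec_def)
  then have "(\<lambda>t. if t \<in> Dec m then 1 else 0 :: real) \<in> borel_measurable (Rn m)" by measurable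
  then show ?thesis unfolding indicator_def of_bool_def .
qed

text \<open>Pull back along \<open>phi\<close> and absorb the density. Since ties are null, the
  strict order in \<open>Dec\<close> may be weakened to \<open>T_set\<close>, and \<open>phi\<close>
  maps \<open>T_set\<close> into \<open>T_set\<close>, so the indicator on \<open>T_n\<close> is 1
  there.\<close>

lemma integral_m_comp:
  assumes f: "f \<in> B0 n" and g: "g \<in> B0 n" and ls: "ls \<in> Wn n"
  shows "integrable (m_comp \<nu> ls) (\<lambda>t. indicator (T_set n) t * f t * g t)"
    and "(\<integral>t. indicator (T_set n) t * f t * g t \<partial>m_comp \<nu> ls) = (\<Prod>i<length ls. cconst \<nu> (Suc (ls ! i))) *
      (\<integral>t. indicator (T_set (length ls)) t * f (phi ls t) * g (phi ls t) \<partial>Rn (length ls))"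
proof -
  let ?m = "length ls" and ?c = "\<Prod>i<length ls. cconst \<nu> (Suc (ls ! i))"
  let ?D = "density (Rn ?m) (\<lambda>t. ennreal (?c * indicator (Dec ?m) t))"
  let ?h = "\<lambda>t. indicator (T_set n) t * f t * g t :: real"
  let ?k = "\<lambda>t. indicator (T_set ?m) t * f (phi ls t) * g (phi ls t)"
  have w: "wlen ls = n" using ls by (simp add: Wn_def)
  have D: "m_comp \<nu> ls = distr ?D (Rn n) (phi ls)"
  proof -
    have "ennreal ?c * indicator (Dec ?m) t = ennreal (?c * indicator (Dec ?m) t)" for t
      by (simp add: indicator_def)
    then show ?thesis unfolding m_comp_def w by simp
  qed
  have ph: "phi ls \<in> measurable ?D (Rn n)"
    using phi_measurable[of ls] unfolding w by (simp add: measurable_cong_sets[OF sets_density refl])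
  have ph': "phi ls \<in> measurable (Rn ?m) (Rn n)" using phi_measurable[of ls] unfolding w .
  have hm: "?h \<in> borel_measurable (Rn n)"
    using f g unfolding B0_iff by (intro borel_measurable_times T_set_measurable) auto
  have hp: "(\<lambda>t. ?h (phi ls t)) \<in> borel_measurable (Rn ?m)"
    by (rule measurable_compose[OF ph' hm])
  have cm: "(\<lambda>t. ?c * indicator (Dec ?m) t) \<in> borel_measurable (Rn ?m)"
    by (intro borel_measurable_times borel_measurable_const Dec_measurable)
  have c0: "AE t in Rn ?m. 0 \<le> ?c * indicator (Dec ?m) t"
    using cconst_prod_nonneg[of ls ?m] by (intro AE_I2) simp
  have km: "?k \<in> borel_measurable (Rn ?m)"
    using T_integrable[OF B0_phi[OF f ls] B0_phi[OF g ls]] by (rule borel_measurable_integrable)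
  have ae: "AE t in Rn ?m. (?c * indicator (Dec ?m) t) *\<^sub>R ?h (phi ls t) = ?c * ?k t"
    using AE_Rn_distinct[of ?m]
  proof eventually_elim
    case (elim t)
    then have "t \<in> Dec ?m \<longleftrightarrow> t \<in> T_set ?m" using Dec_T_set T_set_Dec by blast
    moreover have "t \<in> T_set ?m \<Longrightarrow> phi ls t \<in> T_set n" using T_set_phi[of t ls] by (simp add: w)
    ultimately show ?case by (simp add: indicator_def)
  qed
  have m1: "(\<lambda>t. (?c * indicator (Dec ?m) t) *\<^sub>R ?h (phi ls t)) \<in> borel_measurable (Rn ?m)"
    by (intro borel_measurable_scaleR cm hp)
  have m2: "(\<lambda>t. ?c * ?k t) \<in> borel_measurable (Rn ?m)"
    by (intro borel_measurable_times borel_measurable_const km)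
  have i2: "integrable (Rn ?m) (\<lambda>t. ?c * ?k t)"
    by (intro integrable_mult_right T_integrable[OF B0_phi[OF f ls] B0_phi[OF g ls]])
  have "integrable (Rn ?m) (\<lambda>t. (?c * indicator (Dec ?m) t) *\<^sub>R ?h (phi ls t))"
    using integrable_cong_AE[OF m1 m2 ae] i2 by blast
  then have "integrable ?D (\<lambda>t. ?h (phi ls t))"
    using integrable_density[OF hp cm c0] by blast
  then show "integrable (m_comp \<nu> ls) ?h"
    unfolding D using integrable_distr_eq[OF ph hm] by blast
  have "(\<integral>t. ?h t \<partial>m_comp \<nu> ls) = (\<integral>t. ?h (phi ls t) \<partial>?D)"
    unfolding D by (rule integral_distr[OF ph hm])
  also have "\<dots> = (\<integral>t. (?c * indicator (Dec ?m) t) *\<^sub>R ?h (phi ls t) \<partial>Rn ?m)"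
    by (rule integral_density[OF hp cm c0])
  also have "\<dots> = (\<integral>t. ?c * ?k t \<partial>Rn ?m)"
    by (rule integral_cong_AE[OF m1 m2 ae])
  also have "\<dots> = ?c * (\<integral>t. ?k t \<partial>Rn ?m)" by (rule integral_mult_right_zero)
  finally show "(\<integral>t. ?h t \<partial>m_comp \<nu> ls) = ?c * (\<integral>t. ?k t \<partial>Rn ?m)" .
qed

lemma sets_m_meas: "sets (m_meas \<nu> n) = sets (Rn n)"
  by (simp add: m_meas_def)

lemma integral_m_meas:
  assumes n: "1 \<le> n" and f: "f \<in> B0 n" and g: "g \<in> B0 n"
  shows "(\<integral>t. indicator (T_set n) t * f t * g t \<partial>m_meas \<nu> n)
    = fock_inner \<nu> (orth_poly \<nu> n f) (orth_poly \<nu> n g)"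
proof -
  have hm: "(\<lambda>t. indicator (T_set n) t * f t * g t :: real) \<in> borel_measurable (Rn n)"
    using f g unfolding B0_iff by (intro borel_measurable_times T_set_measurable) auto
  have "(\<integral>t. indicator (T_set n) t * f t * g t \<partial>m_meas \<nu> n)
    = (\<Sum>ls\<in>Wn n. \<integral>t. indicator (T_set n) t * f t * g t \<partial>m_comp \<nu> ls)"
    unfolding m_meas_def comps_Wn[OF n]
    by (rule integral_sum_measure[OF finite_Wn _ hm integral_m_comp(1)[OF f g]])
       (auto simp: m_comp_def Wn_def)
  then show ?thesis
    by (simp add: orth_poly_inner[OF assms] integral_m_comp(2)[OF f g])
qed

text \<open>The inner products among the two vectors are integrals whose integrands agree almost
  everywhere; all are equal, so the expanded squared norm of the difference cancels.\<close>

lemma orth_poly_AE_eq: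
  assumes n: "1 \<le> n" and f: "f \<in> B0 n" and f': "f' \<in> B0 n"
    and ae: "AE t in m_meas \<nu> n. t \<in> T_set n \<longrightarrow> f t = f' t"
  shows "fock_norm \<nu> (\<lambda>m z. orth_poly \<nu> n f m z - orth_poly \<nu> n f' m z) = 0"
proof -
  let ?y = "orth_poly \<nu> n f" and ?y' = "orth_poly \<nu> n f'"
  have y: "?y \<in> fock_space \<nu>" and y': "?y' \<in> fock_space \<nu>"
    using orth_poly_Qv(1)[OF n] f f' by auto
  have hm: "(\<lambda>t. indicator (T_set n) t * g t * h t :: real) \<in> borel_measurable (m_meas \<nu> n)"
    if "g \<in> B0 n" "h \<in> B0 n" for g h
    using that unfolding B0_iff measurable_cong_sets[OF sets_m_meas refl]
    by (intro borel_measurable_times T_set_measurable) auto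
  have "(\<integral>t. indicator (T_set n) t * f t * f t \<partial>m_meas \<nu> n) = (\<integral>t. indicator (T_set n) t * f t * f' t \<partial>m_meas \<nu> n)"
    using ae by (intro integral_cong_AE hm f f') (auto simp: indicator_def elim: eventually_mono)
  moreover have "(\<integral>t. indicator (T_set n) t * f' t * f' t \<partial>m_meas \<nu> n) = (\<integral>t. indicator (T_set n) t * f t * f' t \<partial>m_meas \<nu> n)"
    using ae by (intro integral_cong_AE hm f f') (auto simp: indicator_def elim: eventually_mono)
  ultimately have "fock_inner \<nu> ?y ?y = fock_inner \<nu> ?y ?y'" "fock_inner \<nu> ?y' ?y' = fock_inner \<nu> ?y ?y'"
    by (simp_all only: integral_m_meas[OF n f f] integral_m_meas[OF n f f'] integral_m_meas[OF n f' f'])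
  moreover have "fock_inner \<nu> (\<lambda>m z. ?y m z - ?y' m z) (\<lambda>m z. ?y m z - ?y' m z)
    = fock_inner \<nu> ?y ?y - fock_inner \<nu> ?y ?y' - (fock_inner \<nu> ?y' ?y - fock_inner \<nu> ?y' ?y')"
    by (simp only: fock_inner_diff_left[OF y y' fock_space_diff[OF y y']] fock_inner_diff_right[OF y y' y] fock_inner_diff_right[OF y y' y'])
  ultimately show ?thesis
    by (simp add: fock_norm_def fock_inner_commute[of ?y' ?y])
qed

end

theorem theorem3p2:
  fixes \<nu> :: "real measure" and n :: nat and f g :: "(nat \<Rightarrow> real) \<Rightarrow> real"
  assumes "prob_space \<nu>" and "sets \<nu> = sets borel"
    and "\<exists>K. compact K \<and> K \<in> sets \<nu> \<and> emeasure \<nu> K = 1"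
    and "1 \<le> n" and "f \<in> B0 n" and "g \<in> B0 n"
  shows "(fock_inner \<nu> (orth_poly \<nu> n f) (orth_poly \<nu> n g)
           = (\<integral>t. indicator (T_set n) t * f t * g t \<partial>m_meas \<nu> n))
    \<and> (\<forall>f' \<in> B0 n. (AE t in m_meas \<nu> n. t \<in> T_set n \<longrightarrow> f t = f' t) \<longrightarrow>
           fock_norm \<nu> (\<lambda>m z. orth_poly \<nu> n f m z - orth_poly \<nu> n f' m z) = 0)"
proof -
  interpret compact_prob \<nu>
    using assms(1-3) by (simp add: compact_prob_def compact_prob_axioms_def)
  show ?thesis
    using integral_m_meas[OF assms(4-6)] orth_poly_AE_eq[OF assms(4,5)] by simp
qed

end
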